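(* Let $\mathcal{P}\in\mathbb{P}$ and $\epsilon,\tau\in\mathbb{R}_{>0}$. Let $\gamma^\star$ be the optimal objective of OP3 and, for $n\in\mathbb{Z}_{>0}$, let $\check\gamma_n^\star$ be the optimal objective of OP6. Then for each $n\in\mathbb{Z}_{>0}$, $\check\gamma_n^\star\le\gamma^\star$. Furthermore, $\check\gamma_n^\star$ is monotonically nondecreasing in $n$, and $\lim_{n\to\infty}\check\gamma_n^\star=\gamma^\star$.
   Context: Notation. $X^H$ is the conjugate transpose, $\succeq$ the Hermitian order, $\mathbb{C}_{>0}$ the open right half-plane, $\mathbb{O}_{>1}=\{q\in\mathbb{C}:|q|>1\}$. $\hat{\mathbb{H}}_\infty$ (resp. $\tilde{\mathbb{H}}_\infty$) is the set of matrix functions analytic and uniformly bounded on $\mathbb{C}_{>0}$ (resp. $\mathbb{O}_{>1}$). $\tilde{\mathbb{H}}_2$ is the set of matrix functions $\tilde S$ analytic on $\mathbb{O}_{>1}$ with $\|\tilde S\|_{\tilde{\mathbb{H}}_2}^2=\sup_{\beta>0}\frac1{2\pi}\int_{-\pi}^{\pi}\mathrm{tr}(\tilde S^H\tilde S)(e^{\beta+j\Omega})\,d\Omega<\infty$. Values on the unit circle are boundary limits (existing a.e.). The Markov coefficients $\bar S(k)$ of $\tilde S$ are those in $\tilde S(q)=\sum_{k\ge0}\bar S(k)q^{-k}$. Plant class $\mathbb{P}$. $\mathcal{P}:\{w,u\}\mapsto\{z,y\}$ is finite-dimensional LTI with $y(t),u(t)\in\mathbb{C}^{n_u}$, $\hat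 P_{ij}(s)=C_j(sI-A)^{-1}B_i+D_{ij}$, $i\in\{w,u\}$, $j\in\{z,y\}$, constant complex matrices, $D_{wz}=0$, $D_{wy}=0$, overall realization minimal; all $\hat P_{ij}\in\hat{\mathbb{H}}_\infty$; and $u\mapsto y$ is passive, i.e. $\hat P_{uy}(s)+\hat P_{uy}^H(s)\succeq0$ on $\mathbb{C}_{>0}$. Bilinear transformation. For $\tau>0$ and $s=\frac1{2\tau}\frac{q-1}{q+1}$, put $\tilde P_{ij}(q)=\hat P_{ij}(s)$, and $\tilde P_{fz}(q)=\frac1{1+q}\tilde P_{wz}(q)$, $\tilde P_{fy}(q)=\frac1{1+q}\tilde P_{wy}(q)$. Factor $\tilde F$: the rational matrix function with $\tilde F,\tilde F^{-1}\in\tilde{\mathbb{H}}_\infty$, $\tilde F(\infty)$ Hermitian, and $[\tilde P_{uy}+\tilde P_{uy}^H+\epsilon I]^{-1}=\tilde F+\tilde F^H$ on $|q|=1$; its Markov coefficients are $\bar F(k)$. OP3: minimize $\gamma(\tilde Q)=\frac1\tau\|\tilde T_{fz}\|_{\tilde{\mathbb{H}}_2}^2$, $\tilde T_{fz}=\tilde P_{fz}-\tilde P_{uz}\tilde Q\tilde P_{fy}$, over $n_u\times n_u$ functions $\tilde Q\in\tilde{\mathbb{H}}_\infty$ (parametrized by Markov coefficients $\bar Q(k)$, $k\ge0$) subject to: $\tilde U=\begin{bmatrix} \tilde Q & \tilde Q \\ 0 & \tilde F \end{bmatrix}$ satisfies $\tilde U(e^{j\Omega})+\tilde U^H(e^{j\Omega})\succeq0$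 for all $\Omega\in[-\pi,\pi]$. OP6 (for given $n$). Let $\check\gamma_n=\frac1\tau\sum_{k=0}^n\mathrm{tr}(\bar T_{fz}^H(k)\bar T_{fz}(k))$, which depends only on $\check x_n=\mathrm{vec}\{\bar Q(0),\dots,\bar Q(n)\}$ and is a convex quadratic function of it. Let $\bar V(k)=\begin{bmatrix} \bar Q(k) & 0 \\ \bar Q(k) & \bar F(k) \end{bmatrix}$, $k=0,\dots,n$. The multiplier variables are $\Xi_{33}=\Xi_{33}^H\in\mathbb{C}^{2n_u\times2n_u}$ and $\Xi_{23}\in\mathbb{C}^{2nn_u\times2n_u}$, $\Xi_{23}$ being the block column with $2n_u\times2n_u$ blocks $\Xi_n,\Xi_{n-1},\dots,\Xi_1$ from top to bottom; put $\Xi_0=\Xi_{33}$. The dual function is $$\check\gamma_{d,n}(\Xi_{23},\Xi_{33})=\inf_{\bar Q(0),\dots,\bar Q(n)}\Big\{\check\gamma_n-2\,\mathrm{Re}\sum_{k=0}^n\mathrm{tr}\big(\bar V(k)\,\Xi_k\big)\Big\}$$ (equal to $-\infty$ where the infimum is unbounded below). OP6 is: maximize $\check\gamma_{d,n}$ over $(\Xi_{23},\Xi_{33})$ and $\Sigma_\Xi=\Sigma_\Xi^H\in\mathbb{C}^{2nn_u\times2nn_u}$ subject to $$\begin{bmatrix} \Phi^H\Sigma_\Xi\Phi-\Sigma_\Xi & \Phi^H\Sigma_\Xi\Gamma-\Xi_{23} \\ \Gamma^H\Sigma_\Xi\Phi-\Xi_{23}^H & \Gamma^H\Sigma_\Xi\Gamma-\Xi_{33}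 \end{bmatrix}\preceq0,\quad \Phi=\begin{bmatrix} 0 & I_{2(n-1)n_u} \\ 0 & 0 \end{bmatrix}\in\mathbb{C}^{2nn_u\times 2nn_u},\quad \Gamma=\begin{bmatrix} 0 \\ I_{2n_u} \end{bmatrix}\in\mathbb{C}^{2nn_u\times2n_u}.$$ The optimal objective is the supremum value. *)

theory Defs
  imports
    "HOL-Complex_Analysis.Complex_Analysis"
    "HOL-Computational_Algebra.Polynomial"
    "Jordan_Normal_Form.Gauss_Jordan_Elimination"
    "Jordan_Normal_Form.Schur_Decomposition"
    "Jordan_Normal_Form.Spectral_Radius"
begin

text \<open>Matrices are those of \<^theory>\<open>Jordan_Normal_Form.Matrix\<close>, whose dimensions are terms: the
  order \<open>n\<close> of the relaxation enters the matrix sizes, and the state dimension may be zero.\<close>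

hide_const (open) Finite_Cartesian_Product.vec Finite_Cartesian_Product.mat

section \<open>Matrices and matrix functions\<close>

definition mat_trace :: "complex mat \<Rightarrow> complex" where
  "mat_trace M = (\<Sum>i<dim_row M. M $$ (i, i))"

definition psd :: "complex mat \<Rightarrow> bool" where
  "psd M \<longleftrightarrow> dim_row M = dim_col M \<and> mat_adjoint M = M \<and>
     (\<forall>v \<in> carrier_vec (dim_row M). 0 \<le> Re ((M *\<^sub>v v) \<bullet>c v))"

definition herm_le :: "complex mat \<Rightarrow> complex mat \<Rightarrow> bool" (infix \<open>\<preceq>\<^sub>H\<close> 50) where
  "M \<preceq>\<^sub>H N \<longleftrightarrow> psd (N - M)"

definition right_half_plane :: "complex set" where
  "right_half_plane = {s. 0 < Re s}"

definition outer_disc :: "complex set" where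
  "outer_disc = {q. 1 < cmod q}"

text \<open>Only the values on the domain matter; elsewhere the functions below are unconstrained.\<close>

definition mat_analytic_on :: "(complex \<Rightarrow> complex mat) \<Rightarrow> complex set \<Rightarrow> nat \<Rightarrow> nat \<Rightarrow> bool" where
  "mat_analytic_on S X nr nc \<longleftrightarrow> (\<forall>q\<in>X. S q \<in> carrier_mat nr nc) \<and>
     (\<forall>i<nr. \<forall>j<nc. (\<lambda>q. S q $$ (i, j)) analytic_on X)"

definition H_inf :: "complex set \<Rightarrow> nat \<Rightarrow> nat \<Rightarrow> (complex \<Rightarrow> complex mat) set" where
  "H_inf X nr nc = {S. mat_analytic_on S X nr nc \<and>
     (\<exists>M. \<forall>q\<in>X. \<forall>i<nr. \<forall>j<nc. cmod (S q $$ (i, j)) \<le> M)}"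

text \<open>Squared norm of \<open>\<H>\<^sub>2\<close> on the exterior of the disc; it is \<open>\<infinity>\<close> exactly for the
  analytic functions that are not in \<open>\<H>\<^sub>2\<close>.\<close>

definition h2_norm_sq :: "(complex \<Rightarrow> complex mat) \<Rightarrow> ereal" where
  "h2_norm_sq S = (SUP \<beta>\<in>{0<..}. ereal (1 / (2 * pi) *
     integral {-pi..pi} (\<lambda>\<Omega>. let M = S (exp (Complex \<beta> \<Omega>)) in Re (mat_trace (mat_adjoint M * M)))))"

text \<open>Radial limit, from outside the disc, at a point \<open>w\<close> of the unit circle.\<close>

definition has_boundary_value ::
  "(complex \<Rightarrow> complex mat) \<Rightarrow> complex \<Rightarrow> nat \<Rightarrow> nat \<Rightarrow> complex mat \<Rightarrow> bool" where
  "has_boundary_value S w nr nc L \<longleftrightarrow> L \<in> carrier_mat nr nc \<and>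
     (\<forall>i<nr. \<forall>j<nc. ((\<lambda>r. S (of_real r * w) $$ (i, j)) \<longlongrightarrow> L $$ (i, j)) (at_right 1))"

text \<open>Coefficient \<open>k\<close> of the expansion in powers of \<open>1/q\<close> on the exterior of the disc; the expansion
  exists and is unique for functions that are analytic and bounded there.\<close>

definition markov_entry :: "(complex \<Rightarrow> complex) \<Rightarrow> nat \<Rightarrow> complex" where
  "markov_entry f = (THE c. \<forall>q\<in>outer_disc. (\<lambda>k. c k / q ^ k) sums f q)"

definition markov :: "nat \<Rightarrow> nat \<Rightarrow> (complex \<Rightarrow> complex mat) \<Rightarrow> nat \<Rightarrow> complex mat" where
  "markov nr nc S k = mat nr nc (\<lambda>(i, j). markov_entry (\<lambda>q. S q $$ (i, j)) k)"

definition mat_rational_on :: "(complex \<Rightarrow> complex mat) \<Rightarrow> complex set \<Rightarrow> nat \<Rightarrow> nat \<Rightarrow> bool" where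
  "mat_rational_on S X nr nc \<longleftrightarrow> (\<forall>i<nr. \<forall>j<nc. \<exists>a b :: complex poly.
     \<forall>q\<in>X. poly b q \<noteq> 0 \<and> S q $$ (i, j) = poly a q / poly b q)"


section \<open>The plant class\<close>

record plant =
  mat_A :: "complex mat"
  B_w :: "complex mat"
  B_u :: "complex mat"
  C_z :: "complex mat"
  C_y :: "complex mat"
  D_wz :: "complex mat"
  D_wy :: "complex mat"
  D_uz :: "complex mat"
  D_uy :: "complex mat"

definition n_x :: "plant \<Rightarrow> nat" where "n_x P = dim_row (mat_A P)"
definition n_w :: "plant \<Rightarrow> nat" where "n_w P = dim_col (B_w P)"
definition n_u :: "plant \<Rightarrow> nat" where "n_u P = dim_col (B_u P)"
definition n_z :: "plant \<Rightarrow> nat" where "n_z P = dim_row (C_z P)"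

text \<open>The outputs \<open>y\<close> have the same dimension as the inputs \<open>u\<close>.\<close>

definition well_formed :: "plant \<Rightarrow> bool" where
  "well_formed P \<longleftrightarrow>
     mat_A P \<in> carrier_mat (n_x P) (n_x P) \<and>
     B_w P \<in> carrier_mat (n_x P) (n_w P) \<and> B_u P \<in> carrier_mat (n_x P) (n_u P) \<and>
     C_z P \<in> carrier_mat (n_z P) (n_x P) \<and> C_y P \<in> carrier_mat (n_u P) (n_x P) \<and>
     D_wz P \<in> carrier_mat (n_z P) (n_w P) \<and> D_wy P \<in> carrier_mat (n_u P) (n_w P) \<and>
     D_uz P \<in> carrier_mat (n_z P) (n_u P) \<and> D_uy P \<in> carrier_mat (n_u P) (n_u P)"

definition transfer ::
  "complex mat \<Rightarrow> complex mat \<Rightarrow> complex mat \<Rightarrow> complex mat \<Rightarrow> complex \<Rightarrow> complex mat" where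
  "transfer A B C D s = C * the (mat_inverse (s \<cdot>\<^sub>m 1\<^sub>m (dim_row A) - A)) * B + D"

definition hat_wz :: "plant \<Rightarrow> complex \<Rightarrow> complex mat" where
  "hat_wz P = transfer (mat_A P) (B_w P) (C_z P) (D_wz P)"
definition hat_wy :: "plant \<Rightarrow> complex \<Rightarrow> complex mat" where
  "hat_wy P = transfer (mat_A P) (B_w P) (C_y P) (D_wy P)"
definition hat_uz :: "plant \<Rightarrow> complex \<Rightarrow> complex mat" where
  "hat_uz P = transfer (mat_A P) (B_u P) (C_z P) (D_uz P)"
definition hat_uy :: "plant \<Rightarrow> complex \<Rightarrow> complex mat" where
  "hat_uy P = transfer (mat_A P) (B_u P) (C_y P) (D_uy P)"

definition same_transfer :: "plant \<Rightarrow> plant \<Rightarrow> bool" where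
  "same_transfer P P' \<longleftrightarrow> n_w P = n_w P' \<and> n_u P = n_u P' \<and> n_z P = n_z P' \<and>
     (\<forall>s. s \<notin> spectrum (mat_A P) \<union> spectrum (mat_A P') \<longrightarrow>
        hat_wz P s = hat_wz P' s \<and> hat_wy P s = hat_wy P' s \<and>
        hat_uz P s = hat_uz P' s \<and> hat_uy P s = hat_uy P' s)"

definition minimal_realization :: "plant \<Rightarrow> bool" where
  "minimal_realization P \<longleftrightarrow>
     (\<forall>P'. well_formed P' \<and> same_transfer P P' \<longrightarrow> n_x P \<le> n_x P')"

text \<open>At an eigenvalue of \<^term>\<open>mat_A P\<close> the value of \<^const>\<open>transfer\<close> is meaningless. By minimality an
  eigenvalue in the right half-plane is a pole of one of the four blocks, so the boundedness
  conditions exclude it.\<close>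

definition plant_class :: "plant set" where
  "plant_class = {P. well_formed P \<and> minimal_realization P \<and>
     D_wz P = 0\<^sub>m (n_z P) (n_w P) \<and> D_wy P = 0\<^sub>m (n_u P) (n_w P) \<and>
     hat_wz P \<in> H_inf right_half_plane (n_z P) (n_w P) \<and>
     hat_wy P \<in> H_inf right_half_plane (n_u P) (n_w P) \<and>
     hat_uz P \<in> H_inf right_half_plane (n_z P) (n_u P) \<and>
     hat_uy P \<in> H_inf right_half_plane (n_u P) (n_u P) \<and>
     (\<forall>s\<in>right_half_plane. 0\<^sub>m (n_u P) (n_u P) \<preceq>\<^sub>H hat_uy P s + mat_adjoint (hat_uy P s))}"


section \<open>The bilinear transformation and the factor\<close>

definition bilinear :: "real \<Rightarrow> (complex \<Rightarrow> complex mat) \<Rightarrow> complex \<Rightarrow> complex mat" where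
  "bilinear \<tau> S q = S (1 / (2 * of_real \<tau>) * ((q - 1) / (q + 1)))"

definition P_fz :: "plant \<Rightarrow> real \<Rightarrow> complex \<Rightarrow> complex mat" where
  "P_fz P \<tau> q = (1 / (1 + q)) \<cdot>\<^sub>m bilinear \<tau> (hat_wz P) q"
definition P_fy :: "plant \<Rightarrow> real \<Rightarrow> complex \<Rightarrow> complex mat" where
  "P_fy P \<tau> q = (1 / (1 + q)) \<cdot>\<^sub>m bilinear \<tau> (hat_wy P) q"
definition P_uz :: "plant \<Rightarrow> real \<Rightarrow> complex \<Rightarrow> complex mat" where
  "P_uz P \<tau> q = bilinear \<tau> (hat_uz P) q"
definition P_uy :: "plant \<Rightarrow> real \<Rightarrow> complex \<Rightarrow> complex mat" where
  "P_uy P \<tau> q = bilinear \<tau> (hat_uy P) q"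

text \<open>These conditions determine \<open>F\<close> on the exterior of the disc. The boundary values of \<^const>\<open>P_uy\<close>
  include the point \<open>-1\<close>, which corresponds to \<open>s = \<infinity>\<close>.\<close>

definition is_factor :: "plant \<Rightarrow> real \<Rightarrow> real \<Rightarrow> (complex \<Rightarrow> complex mat) \<Rightarrow> bool" where
  "is_factor P \<epsilon> \<tau> F \<longleftrightarrow>
     mat_rational_on F outer_disc (n_u P) (n_u P) \<and>
     F \<in> H_inf outer_disc (n_u P) (n_u P) \<and>
     (\<exists>G \<in> H_inf outer_disc (n_u P) (n_u P). \<forall>q\<in>outer_disc. mat_inverse (F q) = Some (G q)) \<and>
     (\<exists>L \<in> carrier_mat (n_u P) (n_u P).
        (\<forall>i<n_u P. \<forall>j<n_u P. ((\<lambda>q. F q $$ (i, j)) \<longlongrightarrow> L $$ (i, j)) at_infinity) \<and>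
        mat_adjoint L = L) \<and>
     (\<forall>w. cmod w = 1 \<longrightarrow> (\<exists>Y L. has_boundary_value (P_uy P \<tau>) w (n_u P) (n_u P) Y \<and>
        has_boundary_value F w (n_u P) (n_u P) L \<and>
        mat_inverse (Y + mat_adjoint Y + of_real \<epsilon> \<cdot>\<^sub>m 1\<^sub>m (n_u P)) = Some (L + mat_adjoint L)))"


section \<open>The synthesis problem\<close>

definition T_fz :: "plant \<Rightarrow> real \<Rightarrow> (complex \<Rightarrow> complex mat) \<Rightarrow> complex \<Rightarrow> complex mat" where
  "T_fz P \<tau> Q q = P_fz P \<tau> q - P_uz P \<tau> q * Q q * P_fy P \<tau> q"

definition op3_objective :: "plant \<Rightarrow> real \<Rightarrow> (complex \<Rightarrow> complex mat) \<Rightarrow> ereal" where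
  "op3_objective P \<tau> Q = ereal (1 / \<tau>) * h2_norm_sq (T_fz P \<tau> Q)"

definition op3_U ::
  "plant \<Rightarrow> (complex \<Rightarrow> complex mat) \<Rightarrow> (complex \<Rightarrow> complex mat) \<Rightarrow> complex \<Rightarrow> complex mat" where
  "op3_U P F Q q = four_block_mat (Q q) (Q q) (0\<^sub>m (n_u P) (n_u P)) (F q)"

text \<open>Boundary values of bounded analytic functions exist only almost everywhere, so the
  constraint on the circle is imposed almost everywhere.\<close>

definition op3_feasible :: "plant \<Rightarrow> (complex \<Rightarrow> complex mat) \<Rightarrow> (complex \<Rightarrow> complex mat) set" where
  "op3_feasible P F = {Q \<in> H_inf outer_disc (n_u P) (n_u P).
     AE \<Omega> in lebesgue_on {-pi..pi}. \<exists>L.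
       has_boundary_value (op3_U P F Q) (cis \<Omega>) (2 * n_u P) (2 * n_u P) L \<and>
       0\<^sub>m (2 * n_u P) (2 * n_u P) \<preceq>\<^sub>H L + mat_adjoint L}"

definition op3_value :: "plant \<Rightarrow> real \<Rightarrow> (complex \<Rightarrow> complex mat) \<Rightarrow> ereal" where
  "op3_value P \<tau> F = (INF Q \<in> op3_feasible P F. op3_objective P \<tau> Q)"


section \<open>The finite-dimensional dual problem\<close>

definition fir :: "nat \<Rightarrow> nat \<Rightarrow> (nat \<Rightarrow> complex mat) \<Rightarrow> complex \<Rightarrow> complex mat" where
  "fir m n Qc q = mat m m (\<lambda>(i, j). \<Sum>k\<le>n. Qc k $$ (i, j) / q ^ k)"

text \<open>The Markov coefficients \<open>0, \<dots>, n\<close> of \<open>T\<^sub>f\<^sub>z\<close> depend only on those of \<open>Q\<close>, so they may be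
  computed from the \<open>Q\<close> whose remaining coefficients vanish.\<close>

definition gamma_check :: "plant \<Rightarrow> real \<Rightarrow> nat \<Rightarrow> (nat \<Rightarrow> complex mat) \<Rightarrow> real" where
  "gamma_check P \<tau> n Qc = 1 / \<tau> * (\<Sum>k\<le>n.
     let T = markov (n_z P) (n_w P) (T_fz P \<tau> (fir (n_u P) n Qc)) k
     in Re (mat_trace (mat_adjoint T * T)))"

definition op6_V ::
  "plant \<Rightarrow> (complex \<Rightarrow> complex mat) \<Rightarrow> (nat \<Rightarrow> complex mat) \<Rightarrow> nat \<Rightarrow> complex mat" where
  "op6_V P F Qc k =
     four_block_mat (Qc k) (0\<^sub>m (n_u P) (n_u P)) (Qc k) (markov (n_u P) (n_u P) F k)"

text \<open>From top to bottom, the blocks of \<open>\<Xi>\<^sub>2\<^sub>3\<close> are \<open>\<Xi>\<^sub>n, \<dots>, \<Xi>\<^sub>1\<close>; moreover \<open>\<Xi>\<^sub>0 = \<Xi>\<^sub>3\<^sub>3\<close>.\<close>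

definition Xi_block :: "nat \<Rightarrow> nat \<Rightarrow> complex mat \<Rightarrow> complex mat \<Rightarrow> nat \<Rightarrow> complex mat" where
  "Xi_block m n X23 X33 k =
     (if k = 0 then X33 else mat m m (\<lambda>(i, j). X23 $$ ((n - k) * m + i, j)))"

definition op6_dual ::
  "plant \<Rightarrow> real \<Rightarrow> (complex \<Rightarrow> complex mat) \<Rightarrow> nat \<Rightarrow> complex mat \<Rightarrow> complex mat \<Rightarrow> ereal" where
  "op6_dual P \<tau> F n X23 X33 =
     (INF Qc \<in> {Qc. \<forall>k\<le>n. Qc k \<in> carrier_mat (n_u P) (n_u P)}.
        ereal (gamma_check P \<tau> n Qc -
          2 * Re (\<Sum>k\<le>n. mat_trace (op6_V P F Qc k * Xi_block (2 * n_u P) n X23 X33 k))))"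

definition op6_Phi :: "nat \<Rightarrow> nat \<Rightarrow> complex mat" where
  "op6_Phi m n = four_block_mat (0\<^sub>m ((n - 1) * m) m) (1\<^sub>m ((n - 1) * m))
     (0\<^sub>m m m) (0\<^sub>m m ((n - 1) * m))"

definition op6_Gamma :: "nat \<Rightarrow> nat \<Rightarrow> complex mat" where
  "op6_Gamma m n = 0\<^sub>m ((n - 1) * m) m @\<^sub>r 1\<^sub>m m"

definition op6_lmi :: "nat \<Rightarrow> nat \<Rightarrow> complex mat \<Rightarrow> complex mat \<Rightarrow> complex mat \<Rightarrow> complex mat" where
  "op6_lmi m n X23 X33 S = (let \<Phi> = op6_Phi m n; \<Gamma> = op6_Gamma m n in
     four_block_mat
       (mat_adjoint \<Phi> * S * \<Phi> - S) (mat_adjoint \<Phi> * S * \<Gamma> - X23)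
       (mat_adjoint \<Gamma> * S * \<Phi> - mat_adjoint X23) (mat_adjoint \<Gamma> * S * \<Gamma> - X33))"

definition op6_feasible :: "nat \<Rightarrow> nat \<Rightarrow> (complex mat \<times> complex mat \<times> complex mat) set" where
  "op6_feasible m n = {(X23, X33, S).
     X23 \<in> carrier_mat (n * m) m \<and>
     X33 \<in> carrier_mat m m \<and> mat_adjoint X33 = X33 \<and>
     S \<in> carrier_mat (n * m) (n * m) \<and> mat_adjoint S = S \<and>
     op6_lmi m n X23 X33 S \<preceq>\<^sub>H 0\<^sub>m (n * m + m) (n * m + m)}"

definition op6_value :: "plant \<Rightarrow> real \<Rightarrow> (complex \<Rightarrow> complex mat) \<Rightarrow> nat \<Rightarrow> ereal" where
  "op6_value P \<tau> F n =
     (SUP (X23, X33, S) \<in> op6_feasible (2 * n_u P) n. op6_dual P \<tau> F n X23 X33)"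

end

theory Submission
  imports Defs
begin

text \<open>
  The constraint of the synthesis problem says that \<open>V = [Q 0; Q F]\<close> has a nonnegative Hermitian part
  on the circle: the two block forms state that mutually adjoint operators are contractions for
  the inner product given by \<open>F + F\<^sup>H\<close>. Multipliers feasible for the matrix inequality are exactly the
  block diagonal sums of positive semidefinite matrices \<open>Z\<close>, and the dual function is the Lagrangian
  of ``the truncated block Toeplitz matrix of \<open>V\<close> plus its adjoint is positive semidefinite''. Weak
  duality follows, because Toeplitz forms of a feasible \<open>Q\<close> are integrals of nonnegative functions, and
  monotonicity follows by padding \<open>Z\<close> with zeros.

  For the limit, minimise the truncated objective plus \<open>n + 1\<close> times the squared distance of the Toeplitz
  matrix to the positive semidefinite cone. The scaled residual is a multiplier whose dual value is at
  least the truncated objective at the minimiser, and the coefficients of the minimisers are bounded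
  uniformly in \<open>n\<close>. A limit point \<open>Q\<close> has nonnegative Toeplitz forms of every order, so it is bounded
  and passive on the exterior of the disc, and its objective is at most the limit of the dual values.
  Since its radial limits need not be controlled, replace it by the dilations \<open>(1 - d) Q(r q)\<close>: they are
  feasible on the circle because \<open>F + F\<^sup>H\<close> is uniformly positive and continuous up to the circle, and
  their objectives converge to that of \<open>Q\<close>.
\<close>

section \<open>Positive semidefinite kernels\<close>

text \<open>The Toeplitz form of \<open>V\<close> contains the unknown \<open>Q\<close> next to the
  fixed \<open>F\<close>. Testing it on two coordinates plays an unknown entry against a fixed one,
  and this is the source of all compactness: it bounds the coefficients uniformly in n and later the
  values of the limit function. \<open>Q = 0\<close> is feasible, because \<open>F\<close> has a
  positive Hermitian part on the circle. Its objective is at most some C for every n and sets the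
  scale of the penalty: weight n + 1 forces every entry of the Toeplitz matrix to within sqrt (C /
  (n + 1)) of the cone. The main obstacle is that the synthesis problem constrains boundary values,
  while the dual problems speak of coefficients. From the circle to coefficients one averages over
  circles of radius r > 1 and lets r tend to 1 by dominated convergence; from coefficients back to
  the circle one passes through the interior and dilates. A second obstacle is the pole of
  \<open>1 / (1 + q)\<close> at q = -1, the image of s = infinity. Strict properness of the channels
  from w cancels it, so that \<open>P_fz\<close> and \<open>P_fy\<close> are bounded and have square
  summable coefficients.\<close>

definition kform :: "'i set \<Rightarrow> ('i \<Rightarrow> 'i \<Rightarrow> complex) \<Rightarrow> ('i \<Rightarrow> complex) \<Rightarrow> complex" where
  "kform I K x = (\<Sum>a\<in>I. \<Sum>b\<in>I. cnj (x a) * K a b * x b)"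

text \<open>Kernels on an arbitrary index set stand for matrices, so that block matrices can be
  indexed by pairs (block, entry). Under Hermitian symmetry the form is real, and asking for its
  real part loses nothing.\<close>

definition kpsd :: "'i set \<Rightarrow> ('i \<Rightarrow> 'i \<Rightarrow> complex) \<Rightarrow> bool" where
  "kpsd I K \<longleftrightarrow> (\<forall>a\<in>I. \<forall>b\<in>I. K b a = cnj (K a b)) \<and> (\<forall>x. 0 \<le> Re (kform I K x))"

lemma kpsd_hermitian: "kpsd I K \<Longrightarrow> a \<in> I \<Longrightarrow> b \<in> I \<Longrightarrow> K b a = cnj (K a b)"
  unfolding kpsd_def by blast

lemma kpsd_form_nonneg: "kpsd I K \<Longrightarrow> 0 \<le> Re (kform I K x)"
  by (simp add: kpsd_def)

lemma kpsdI:
  assumes "\<And>a b. a \<in> I \<Longrightarrow> b \<in> I \<Longrightarrow> K b a = cnj (K a b)" "\<And>x. 0 \<le> Re (kform I K x)"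
  shows "kpsd I K"
  using assms unfolding kpsd_def by blast

lemma kform_cong:
  assumes "\<And>a b. a \<in> I \<Longrightarrow> b \<in> I \<Longrightarrow> K a b = L a b" "\<And>a. a \<in> I \<Longrightarrow> x a = y a"
  shows "kform I K x = kform I L y"
  unfolding kform_def using assms by (intro sum.cong) auto

lemma kpsd_cong:
  assumes "\<And>a b. a \<in> I \<Longrightarrow> b \<in> I \<Longrightarrow> K a b = L a b"
  shows "kpsd I K = kpsd I L"
proof -
  have "kform I K x = kform I L x" for x using assms by (intro kform_cong) auto
  moreover have "(\<forall>a\<in>I. \<forall>b\<in>I. K b a = cnj (K a b)) \<longleftrightarrow> (\<forall>a\<in>I. \<forall>b\<in>I. L b a = cnj (L a b))"
    using assms by metis
  ultimately show ?thesis unfolding kpsd_def by presburger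
qed

lemma kform_insert:
  assumes "finite I" "i \<notin> I"
  shows "kform (insert i I) K x = cnj (x i) * K i i * x i + (\<Sum>b\<in>I. cnj (x i) * K i b * x b)
    + (\<Sum>a\<in>I. cnj (x a) * K a i * x i) + kform I K x"
  using assms unfolding kform_def by (simp add: sum.distrib algebra_simps)

lemma kform_insert_hermitian:
  assumes "finite I" "i \<notin> I" "\<And>b. b \<in> I \<Longrightarrow> K b i = cnj (K i b)"
  shows "Re (kform (insert i I) K x) = (cmod (x i))\<^sup>2 * Re (K i i)
    + 2 * Re (cnj (x i) * (\<Sum>b\<in>I. K i b * x b)) + Re (kform I K x)"
proof -
  have "(\<Sum>a\<in>I. cnj (x a) * K a i * x i) = cnj (cnj (x i) * (\<Sum>b\<in>I. K i b * x b))"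
    using assms(3) by (simp add: sum_distrib_left algebra_simps)
  moreover have "Re (cnj (x i) * K i i * x i) = (cmod (x i))\<^sup>2 * Re (K i i)"
    unfolding cmod_power2 by (simp add: algebra_simps power2_eq_square)
  moreover have "(\<Sum>b\<in>I. cnj (x i) * K i b * x b) = cnj (x i) * (\<Sum>b\<in>I. K i b * x b)"
    by (simp add: sum_distrib_left algebra_simps)
  ultimately show ?thesis unfolding kform_insert[OF assms(1,2), of K x]
    by (simp only: plus_complex.sel cnj.sel)
qed

text \<open>A principal submatrix is tested by extending vectors on \<open>J\<close> by
  zero.\<close>

lemma kpsd_subset:
  assumes "finite I" "J \<subseteq> I" "kpsd I K"
  shows "kpsd J K"
proof -
  have "kform J K x = kform I K (\<lambda>a. if a \<in> J then x a else 0)" for x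
    unfolding kform_def
    by (intro sum.mono_neutral_cong_left[OF assms(1,2)])
       (auto intro!: sum.neutral sum.mono_neutral_cong_left[OF assms(1,2)])
  then show ?thesis using assms(2) kpsd_hermitian[OF assms(3)] kpsd_form_nonneg[OF assms(3)]
    by (intro kpsdI) (metis subsetD, metis)
qed

lemma kform_single:
  assumes "finite I" "i \<in> I"
  shows "kform I K (\<lambda>a. if a = i then c else 0) = cnj c * K i i * c"
  unfolding kform_def
  by (subst sum.remove[OF assms], subst sum.neutral, simp, subst sum.remove[OF assms], subst sum.neutral) auto

lemma kpsd_diag_nonneg:
  assumes "finite I" "i \<in> I" "kpsd I K"
  shows "0 \<le> Re (K i i)" "K i i = of_real (Re (K i i))"
proof -
  show "0 \<le> Re (K i i)"
    using kpsd_form_nonneg[OF assms(3), of "\<lambda>a. if a = i then 1 else 0"] kform_single[OF assms(1,2), of K 1]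
    by simp
  show "K i i = of_real (Re (K i i))"
    using arg_cong[OF kpsd_hermitian[OF assms(3,2,2)], of Im] by (simp add: complex_eq_iff)
qed

text \<open>When \<open>K i i = 0\<close>, the form on the two coordinates i and a is affine in the
  entry at i, so it can stay nonnegative only if the off-diagonal entry vanishes.\<close>

lemma kpsd_zero_row:
  assumes "finite I" "i \<in> I" "a \<in> I" "kpsd I K" "K i i = 0"
  shows "K i a = 0"
proof (cases "a = i")
  case False
  have J: "kpsd {i, a} K" using kpsd_subset[OF assms(1) _ assms(4)] assms by auto
  have key: "0 \<le> 2 * Re (cnj t * K i a) + Re (K a a)" for t
  proof -
    have *: "kform {a} K (\<lambda>b. if b = i then t else 1) = K a a"
      using False by (simp add: kform_def)
    have "0 \<le> Re (kform {i, a} K (\<lambda>b. if b = i then t else 1))"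
      by (rule kpsd_form_nonneg[OF J])
    also have "\<dots> = 2 * Re (cnj t * K i a) + Re (K a a)"
      using kform_insert_hermitian[of "{a}" i K "\<lambda>b. if b = i then t else 1"] False assms * 
        kpsd_hermitian[OF assms(4), of i a] by simp
    finally show ?thesis .
  qed
  show ?thesis
  proof (rule ccontr)
    assume nz: "K i a \<noteq> 0"
    \<comment> \<open>Chosen so that the affine term becomes \<open>- 2 * (Re (K a a) + 1)\<close>,
      which outweighs \<open>Re (K a a)\<close>.\<close>
    define s where "s = (Re (K a a) + 1) / (cmod (K i a))\<^sup>2"
    have "Re (cnj (- of_real s * K i a) * K i a) = - s * (cmod (K i a))\<^sup>2"
      by (simp add: cmod_def power2_eq_square algebra_simps)
    also have "\<dots> = - (Re (K a a) + 1)" using nz by (simp add: s_def)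
    finally show False using key[of "- of_real s * K i a"] kpsd_diag_nonneg(1)[OF assms(1,3,4)] by linarith
  qed
qed (use assms in simp)

text \<open>The form of the Schur complement at x is the form of \<open>K\<close> at x extended by
  \<open>- u / d\<close> in coordinate i, the value that minimises the form over this
  coordinate.\<close>

lemma kpsd_schur_complement:
  assumes "finite I" "i \<notin> I" "kpsd (insert i I) K" "K i i \<noteq> 0"
  shows "kpsd I (\<lambda>a b. K a b - K a i * K i b / K i i)"
  unfolding kpsd_def
proof (intro conjI ballI allI)
  define d where "d = Re (K i i)"
  have d1: "K i i = of_real d" unfolding d_def
    by (rule kpsd_diag_nonneg(2)[of "insert i I" i K]) (use assms in auto)
  moreover have "0 \<le> d" unfolding d_def
    by (rule kpsd_diag_nonneg(1)[of "insert i I" i K]) (use assms in auto)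
  ultimately have d: "K i i = of_real d" "d > 0" using assms(4) by auto
  have herm: "K b a = cnj (K a b)" if "a \<in> insert i I" "b \<in> insert i I" for a b
    using kpsd_hermitian[OF assms(3) that] .
  show "K b a - K b i * K i a / K i i = cnj (K a b - K a i * K i b / K i i)"
    if "a \<in> I" "b \<in> I" for a b
    using that herm[of a b] herm[of a i] herm[of b i] d by simp
  have h: "K b i = cnj (K i b)" if "b \<in> I" for b by (rule herm) (use that in auto)
  fix x :: "'a \<Rightarrow> complex"
  define u where "u = (\<Sum>b\<in>I. K i b * x b)"
  define y where "y = (\<lambda>b. if b = i then - u / d else x b)"
  have u: "(\<Sum>a\<in>I. cnj (x a) * K a i) = cnj u"
    unfolding u_def cnj_sum using herm[of i] by (intro sum.cong) auto
  have "kform I (\<lambda>a b. K a b - K a i * K i b / K i i) x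
      = kform I K x - (\<Sum>a\<in>I. cnj (x a) * K a i) * u / d"
    unfolding kform_def u_def sum_product d
    by (simp add: algebra_simps sum_subtractf sum_divide_distrib)
  then have e1: "Re (kform I (\<lambda>a b. K a b - K a i * K i b / K i i) x) = Re (kform I K x) - (cmod u)\<^sup>2 / d"
    unfolding u by (simp add: complex_norm_square[symmetric] mult.commute[of "cnj u"] del: of_real_power)
  have yi: "y i = - u / d" by (simp add: y_def)
  have "y b = x b" if "b \<in> I" for b using that assms(2) by (auto simp: y_def)
  then have e2: "(\<Sum>b\<in>I. K i b * y b) = u" "kform I K y = kform I K x"
    unfolding u_def by (auto intro!: sum.cong kform_cong)
  have "Re (kform (insert i I) K y) = (cmod (y i))\<^sup>2 * d + 2 * Re (cnj (y i) * u) + Re (kform I K x)"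
    using kform_insert_hermitian[OF assms(1,2), of K y, OF h] unfolding e2 d_def by simp
  also have "(cmod (y i))\<^sup>2 * d = (cmod u)\<^sup>2 / d"
    using d(2) unfolding yi by (simp add: norm_divide power2_eq_square)
  also have "Re (cnj (y i) * u) = - (cmod u)\<^sup>2 / d"
    unfolding yi cmod_power2 using d(2) by (simp add: field_simps power2_eq_square)
  finally show "0 \<le> Re (kform I (\<lambda>a b. K a b - K a i * K i b / K i i) x)"
    unfolding e1 using kpsd_form_nonneg[OF assms(3), of y] by simp
qed

text \<open>Split off one rank-one kernel at a time, as in the Cholesky factorisation.\<close>

lemma kpsd_inner_nonneg:
  assumes "finite I" "kpsd I K" "kpsd I L"
  shows "0 \<le> Re (\<Sum>a\<in>I. \<Sum>b\<in>I. cnj (K a b) * L a b)"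
  using assms
proof (induction I arbitrary: K rule: finite_induct)
  case (insert i I)
  have fin: "finite (insert i I)" using insert by simp
  have L: "kpsd I L" using kpsd_subset[OF fin _ insert.prems(2)] by blast
  show ?case
  proof (cases "K i i = 0")
    case True
    have z: "K i a = 0" "K a i = 0" if "a \<in> insert i I" for a
      using kpsd_zero_row[OF fin _ that insert.prems(1) True] kpsd_hermitian[OF insert.prems(1), of i a] that by auto
    have "kpsd I K" using kpsd_subset[OF fin _ insert.prems(1)] by blast
    from insert.IH[OF this L] show ?thesis using insert.hyps z by simp
  next
    case False
    define d where "d = Re (K i i)"
    have "K i i = of_real d" unfolding d_def
      by (rule kpsd_diag_nonneg(2)[OF fin _ insert.prems(1)]) simp
    moreover have "0 \<le> d" unfolding d_def
      by (rule kpsd_diag_nonneg(1)[OF fin _ insert.prems(1)]) simp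
    ultimately have d: "K i i = of_real d" "d > 0" using False by auto
    define K' where "K' = (\<lambda>a b. K a b - K a i * K i b / K i i)"
    have K': "kpsd I K'" unfolding K'_def
      by (rule kpsd_schur_complement[OF insert.hyps insert.prems(1) False])
    have z: "K' i a = 0" "K' a i = 0" for a using False by (simp_all add: K'_def)
    define u where "u = (\<lambda>a. K a i)"
    \<comment> \<open>Pairing \<open>L\<close> with the rank-one part gives the form of
      \<open>L\<close> at the column u, which is nonnegative. The remainder \<open>K'\<close>
      vanishes in row and column i, so the induction hypothesis applies on \<open>I\<close>.\<close>
    have split: "cnj (K a b) * L a b = cnj (K' a b) * L a b + (cnj (u a) * L a b * u b) / d"
      if "a \<in> insert i I" "b \<in> insert i I" for a b
      using kpsd_hermitian[OF insert.prems(1), of i b] that d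
      by (simp add: K'_def u_def field_simps)
    have "(\<Sum>a\<in>insert i I. \<Sum>b\<in>insert i I. cnj (K a b) * L a b)
      = (\<Sum>a\<in>insert i I. \<Sum>b\<in>insert i I. cnj (K' a b) * L a b + (cnj (u a) * L a b * u b) / d)"
      using split by (intro sum.cong) auto
    also have "\<dots> = (\<Sum>a\<in>insert i I. \<Sum>b\<in>insert i I. cnj (K' a b) * L a b) + kform (insert i I) L u / d"
      unfolding kform_def sum.distrib sum_divide_distrib[symmetric] by simp
    also have "(\<Sum>a\<in>insert i I. \<Sum>b\<in>insert i I. cnj (K' a b) * L a b) = (\<Sum>a\<in>I. \<Sum>b\<in>I. cnj (K' a b) * L a b)"
      using insert.hyps z by simp
    finally have "Re (\<Sum>a\<in>insert i I. \<Sum>b\<in>insert i I. cnj (K a b) * L a b)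
      = Re (\<Sum>a\<in>I. \<Sum>b\<in>I. cnj (K' a b) * L a b) + Re (kform (insert i I) L u) / d" by simp
    then show ?thesis using insert.IH[OF K' L] kpsd_form_nonneg[OF insert.prems(2), of u] d(2) by simp
  qed
qed simp

lemma kpsd_rank_one: "finite I \<Longrightarrow> kpsd I (\<lambda>a b. v a * cnj (v b))"
proof -
  assume "finite I"
  have "kform I (\<lambda>a b. v a * cnj (v b)) x = (\<Sum>a\<in>I. cnj (x a) * v a) * cnj (\<Sum>a\<in>I. cnj (x a) * v a)" for x
    unfolding kform_def cnj_sum sum_product by (intro sum.cong) (auto simp: algebra_simps)
  then have "Re (kform I (\<lambda>a b. v a * cnj (v b)) x) \<ge> 0" for x
    by (metis (no_types, lifting) Re_complex_of_real complex_norm_square zero_le_power2)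
  then show ?thesis by (intro kpsdI) auto
qed

lemma kform_scale: "kform I (\<lambda>a b. c * K a b) x = c * kform I K x"
  unfolding kform_def by (simp add: sum_distrib_left algebra_simps)

lemma kform_add: "kform I (\<lambda>a b. K a b + L a b) x = kform I K x + kform I L x"
  unfolding kform_def by (simp add: sum.distrib algebra_simps)

lemma kpsd_scale:
  assumes "kpsd I K" "0 \<le> c"
  shows "kpsd I (\<lambda>a b. of_real c * K a b)"
proof (rule kpsdI)
  show "of_real c * K b a = cnj (of_real c * K a b)" if "a \<in> I" "b \<in> I" for a b
    unfolding complex_cnj_mult complex_cnj_complex_of_real kpsd_hermitian[OF assms(1) that] ..
  show "0 \<le> Re (kform I (\<lambda>a b. of_real c * K a b) x)" for x
    using assms by (simp add: kform_scale kpsd_form_nonneg)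
qed

lemma kpsd_add:
  assumes "kpsd I K" "kpsd I L"
  shows "kpsd I (\<lambda>a b. K a b + L a b)"
proof (rule kpsdI)
  show "K b a + L b a = cnj (K a b + L a b)" if "a \<in> I" "b \<in> I" for a b
    unfolding complex_cnj_add kpsd_hermitian[OF assms(1) that] kpsd_hermitian[OF assms(2) that] ..
  show "0 \<le> Re (kform I (\<lambda>a b. K a b + L a b) x)" for x
    using assms by (simp add: kform_add kpsd_form_nonneg)
qed


section \<open>A penalty method producing dual multipliers\<close>

text \<open>Tychonoff for function types. It provides the compact search set of the penalty method
  and, later, convergent subsequences of coefficient families.\<close>

lemma compact_coordinatewise:
  fixes S :: "'a \<Rightarrow> 'b::topological_space set"
  assumes "\<And>i. compact (S i)"
  shows "compact {f. \<forall>i. f i \<in> S i}"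
proof -
  have "compactin (product_topology (\<lambda>i. euclidean) UNIV) (PiE UNIV S)"
    using assms by (auto simp: compactin_PiE)
  moreover have "PiE UNIV S = {f. \<forall>i. f i \<in> S i}" by auto
  ultimately show ?thesis by (simp add: euclidean_product_topology)
qed

text \<open>The one-sided first-order condition at a minimum: a quadratic polynomial without
  constant term that is nonnegative on (0, 1] has a nonnegative slope at 0.\<close>

lemma nonneg_slope:
  fixes A B :: real
  assumes "\<And>t. 0 < t \<Longrightarrow> t \<le> 1 \<Longrightarrow> 0 \<le> 2 * t * A + t\<^sup>2 * B"
  shows "0 \<le> A"
proof (rule ccontr)
  assume "\<not> 0 \<le> A"
  \<comment> \<open>Small enough that \<open>t * B \<le> - A\<close>, hence
    \<open>2 * A + t * B \<le> A < 0\<close>.\<close>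
  define t where "t = min 1 (- A / (\<bar>B\<bar> + 1))"
  have t: "0 < t" "t \<le> 1" using \<open>\<not> 0 \<le> A\<close> by (auto simp: t_def divide_neg_pos)
  have "t * B \<le> t * (\<bar>B\<bar> + 1)" using t by (intro mult_left_mono) auto
  also have "\<dots> \<le> - A"
  proof -
    have "t \<le> - A / (\<bar>B\<bar> + 1)" by (simp add: t_def)
    then show ?thesis by (subst (asm) pos_le_divide_eq) auto
  qed
  finally have "t * (2 * A + t * B) < 0" using t \<open>\<not> 0 \<le> A\<close> by (intro mult_pos_neg) auto
  then show False using assms[OF t] by (simp add: algebra_simps power2_eq_square)
qed

lemma cmod_affine_square:
  "(cmod (r + of_real t * (r' - r)))\<^sup>2
    = (cmod r)\<^sup>2 + 2 * t * Re (cnj r * (r' - r)) + t\<^sup>2 * (cmod (r' - r))\<^sup>2"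
  unfolding cmod_power2 by (simp add: algebra_simps power2_eq_square)

text \<open>The gradient inequality of the convex function |.|^2. It turns first-order optimality
  into a global lower bound.\<close>

lemma cmod_square_ge: "(cmod r')\<^sup>2 \<ge> (cmod r)\<^sup>2 + 2 * Re (cnj r * (r' - r))"
proof -
  have "(cmod r')\<^sup>2 = (cmod r)\<^sup>2 + 2 * Re (cnj r * (r' - r)) + (cmod (r' - r))\<^sup>2"
    using cmod_affine_square[of r 1 r'] by simp
  then show ?thesis by simp
qed

lemma closed_kpsd: "closed {Y :: 'i \<Rightarrow> 'i \<Rightarrow> complex. kpsd I Y}"
proof -
  have c: "continuous_on UNIV (\<lambda>Y :: 'i \<Rightarrow> 'i \<Rightarrow> complex. Y a b)" for a b
    by (rule continuous_on_product_then_coordinatewise[OF continuous_on_product_coordinates])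
  have "{Y :: 'i \<Rightarrow> 'i \<Rightarrow> complex. kpsd I Y}
    = (\<Inter>a\<in>I. \<Inter>b\<in>I. {Y. Y b a = cnj (Y a b)}) \<inter> (\<Inter>x. {Y. 0 \<le> Re (kform I Y x)})"
    unfolding kpsd_def by blast
  moreover have "closed {Y :: 'i \<Rightarrow> 'i \<Rightarrow> complex. Y b a = cnj (Y a b)}" for a b
    by (intro closed_Collect_eq c continuous_intros)
  moreover have "closed {Y :: 'i \<Rightarrow> 'i \<Rightarrow> complex. 0 \<le> Re (kform I Y x)}" for x
    unfolding kform_def by (intro closed_Collect_le c continuous_intros)
  ultimately show ?thesis by (simp add: closed_INT closed_Int)
qed

text \<open>Minimise the objective plus \<open>\<mu>\<close> times the squared distance of \<open>M x\<close> to the cone of positive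
  semidefinite kernels. At a minimiser the scaled residual \<open>2 \<mu> (Y - M x)\<close> is a feasible multiplier
  whose dual value is at least the objective, so no constraint qualification is needed.\<close>

lemma penalty_multiplier:
  fixes r :: "'s \<Rightarrow> ('v \<Rightarrow> complex) \<Rightarrow> complex" and M :: "'i \<Rightarrow> 'i \<Rightarrow> ('v \<Rightarrow> complex) \<Rightarrow> complex"
    and J :: "'v set" and \<mu> \<delta> R :: real
  defines "X \<equiv> {x. \<forall>v. v \<notin> J \<longrightarrow> x v = 0}"
  assumes fin: "finite S" "finite I"
    and r_affine: "\<And>s x x' t. s \<in> S \<Longrightarrow>
      r s (\<lambda>v. x v + of_real t * (x' v - x v)) = r s x + of_real t * (r s x' - r s x)"
    and M_affine: "\<And>a b x x' t. a \<in> I \<Longrightarrow> b \<in> I \<Longrightarrow>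
      M a b (\<lambda>v. x v + of_real t * (x' v - x v)) = M a b x + of_real t * (M a b x' - M a b x)"
    and r_cont: "\<And>s. s \<in> S \<Longrightarrow> continuous_on UNIV (r s)"
    and M_cont: "\<And>a b. a \<in> I \<Longrightarrow> b \<in> I \<Longrightarrow> continuous_on UNIV (M a b)"
    and M_herm: "\<And>a b x. a \<in> I \<Longrightarrow> b \<in> I \<Longrightarrow> M b a x = cnj (M a b x)"
    and base: "kpsd I (\<lambda>a b. M a b (\<lambda>_. 0))"
    and lam: "\<mu> > 0" "\<delta> \<ge> 0" "(\<Sum>s\<in>S. (cmod (r s (\<lambda>_. 0)))\<^sup>2) \<le> \<mu> * \<delta>\<^sup>2"
    and coercive: "\<And>x Y v. x \<in> X \<Longrightarrow> kpsd I Y \<Longrightarrow>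
      (\<And>a b. a \<in> I \<Longrightarrow> b \<in> I \<Longrightarrow> cmod (M a b x - Y a b) \<le> \<delta>) \<Longrightarrow> cmod (x v) \<le> R"
  shows "\<exists>x\<in>X. \<exists>Y z. kpsd I Y \<and> kpsd I z \<and> (\<forall>a\<in>I. \<forall>b\<in>I. cmod (M a b x - Y a b) \<le> \<delta>) \<and>
    (\<forall>x'\<in>X. (\<Sum>s\<in>S. (cmod (r s x))\<^sup>2)
       \<le> (\<Sum>s\<in>S. (cmod (r s x'))\<^sup>2) - Re (\<Sum>a\<in>I. \<Sum>b\<in>I. cnj (z a b) * M a b x'))"
proof -
  define \<Phi> where "\<Phi> = (\<lambda>(x, Y). (\<Sum>s\<in>S. (cmod (r s x))\<^sup>2)
    + \<mu> * (\<Sum>a\<in>I. \<Sum>b\<in>I. (cmod (M a b x - Y a b))\<^sup>2))"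
  define \<gamma>0 where "\<gamma>0 = (\<Sum>s\<in>S. (cmod (r s (\<lambda>_. 0)))\<^sup>2)"
  \<comment> \<open>A point no worse than the base point (0, M 0) pays at most
    \<open>\<mu> * \<delta>\<^sup>2\<close> for all residuals together, hence for each single
    one.\<close>
  have dist: "cmod (M a b x - Y a b) \<le> \<delta>" if "\<Phi> (x, Y) \<le> \<gamma>0" "a \<in> I" "b \<in> I" for x Y a b
  proof -
    have "(cmod (M a b x - Y a b))\<^sup>2 \<le> (\<Sum>b\<in>I. (cmod (M a b x - Y a b))\<^sup>2)"
      using that fin by (intro member_le_sum) auto
    also have "\<dots> \<le> (\<Sum>a\<in>I. \<Sum>b\<in>I. (cmod (M a b x - Y a b))\<^sup>2)"
      using that fin by (intro member_le_sum[where f = "\<lambda>a. \<Sum>b\<in>I. (cmod (M a b x - Y a b))\<^sup>2"]) (auto intro: sum_nonneg)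
    finally have "\<mu> * (cmod (M a b x - Y a b))\<^sup>2 \<le> \<mu> * (\<Sum>a\<in>I. \<Sum>b\<in>I. (cmod (M a b x - Y a b))\<^sup>2)"
      using lam(1) by (intro mult_left_mono) auto
    also have "\<dots> \<le> \<Phi> (x, Y)" unfolding \<Phi>_def by (simp add: sum_nonneg)
    also have "\<dots> \<le> \<mu> * \<delta>\<^sup>2" using that lam(3) unfolding \<gamma>0_def by linarith
    finally have "\<mu> * (cmod (M a b x - Y a b))\<^sup>2 \<le> \<mu> * \<delta>\<^sup>2" .
    then show ?thesis using lam by (simp add: power2_le_iff_abs_le)
  qed
  define KX where "KX = {x :: 'v \<Rightarrow> complex. \<forall>v. x v \<in> (if v \<in> J then cball 0 R else {0})}"
  have cKX: "compact KX" unfolding KX_def by (intro compact_coordinatewise) auto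
  have "\<exists>B. \<forall>x\<in>KX. cmod (M a b x) \<le> B" if "a \<in> I" "b \<in> I" for a b
  proof -
    have "bounded (M a b ` KX)" using M_cont[OF that] cKX
      by (meson compact_continuous_image compact_imp_bounded continuous_on_subset subset_UNIV)
    then show ?thesis unfolding bounded_iff by auto
  qed
  then obtain B where B: "\<And>a b x. a \<in> I \<Longrightarrow> b \<in> I \<Longrightarrow> x \<in> KX \<Longrightarrow> cmod (M a b x) \<le> B a b" by metis
  \<comment> \<open>Entries off \<open>I\<close> are pinned to 0: they enter neither the objective
    nor the cone, and left free they would destroy compactness.\<close>
  define KY where "KY = {Y :: 'i \<Rightarrow> 'i \<Rightarrow> complex. \<forall>a. Y a \<in>
     {y. \<forall>b. y b \<in> (if a \<in> I \<and> b \<in> I then cball 0 (B a b + \<delta>) else {0})}}"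
  have cKY: "compact KY" unfolding KY_def by (intro compact_coordinatewise) auto
  define C where "C = (KX \<times> KY) \<inter> (UNIV \<times> {Y. kpsd I Y})"
  have cC: "compact C" unfolding C_def
    by (intro compact_Int_closed compact_Times cKX cKY closed_Times closed_kpsd closed_UNIV)
  have inC: "(x, Y) \<in> C"
    if "x \<in> X" "kpsd I Y" "\<Phi> (x, Y) \<le> \<gamma>0" "\<And>a b. a \<notin> I \<or> b \<notin> I \<Longrightarrow> Y a b = 0" for x Y
  proof -
    have d: "cmod (M a b x - Y a b) \<le> \<delta>" if "a \<in> I" "b \<in> I" for a b
      using dist \<open>\<Phi> (x, Y) \<le> \<gamma>0\<close> that by blast
    have "cmod (x v) \<le> R" for v using coercive[OF that(1,2) d] by blast
    then have x: "x \<in> KX" using that(1) by (auto simp: KX_def X_def)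
    have "cmod (Y a b) \<le> B a b + \<delta>" if "a \<in> I" "b \<in> I" for a b
    proof -
      have "cmod (Y a b) \<le> cmod (M a b x) + cmod (M a b x - Y a b)"
        by (metis norm_triangle_sub norm_minus_commute add.commute)
      then show ?thesis using d[OF that] B[OF that x] by linarith
    qed
    then have "Y \<in> KY" using that(4) by (auto simp: KY_def)
    then show ?thesis using x that by (simp add: C_def)
  qed
  define Y0 where "Y0 = (\<lambda>a b. if a \<in> I \<and> b \<in> I then M a b (\<lambda>_. 0) else 0)"
  have \<Phi>0: "\<Phi> (\<lambda>_. 0, Y0) = \<gamma>0" by (simp add: \<Phi>_def Y0_def \<gamma>0_def)
  have Y0: "kpsd I Y0" using base kpsd_cong[of I Y0 "\<lambda>a b. M a b (\<lambda>_. 0)"] by (simp add: Y0_def)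
  have base_in: "(\<lambda>_. 0, Y0) \<in> C"
    by (rule inC) (use Y0 \<Phi>0 in \<open>auto simp: X_def Y0_def\<close>)
  have c: "continuous_on UNIV (\<lambda>Y :: 'i \<Rightarrow> 'i \<Rightarrow> complex. Y a b)" for a b
    by (rule continuous_on_product_then_coordinatewise[OF continuous_on_product_coordinates])
  have c1: "continuous_on UNIV (\<lambda>p :: ('v \<Rightarrow> complex) \<times> ('i \<Rightarrow> 'i \<Rightarrow> complex). r s (fst p))" if "s \<in> S" for s
    by (rule continuous_on_compose2[OF r_cont[OF that]]) (auto intro: continuous_intros)
  have c2: "continuous_on UNIV (\<lambda>p :: ('v \<Rightarrow> complex) \<times> ('i \<Rightarrow> 'i \<Rightarrow> complex). M a b (fst p))"
    if "a \<in> I" "b \<in> I" for a b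
    by (rule continuous_on_compose2[OF M_cont[OF that]]) (auto intro: continuous_intros)
  have c3: "continuous_on UNIV (\<lambda>p :: ('v \<Rightarrow> complex) \<times> ('i \<Rightarrow> 'i \<Rightarrow> complex). snd p a b)" for a b
    by (rule continuous_on_compose2[OF c]) (auto intro: continuous_intros)
  have "continuous_on C \<Phi>"
  proof (rule continuous_on_subset)
    show "continuous_on UNIV \<Phi>" unfolding \<Phi>_def case_prod_beta
      by (intro continuous_intros c1 c2 c3)
  qed simp
  from continuous_attains_inf[OF cC _ this] base_in
  obtain x Y where xY: "(x, Y) \<in> C" and min: "\<And>p. p \<in> C \<Longrightarrow> \<Phi> (x, Y) \<le> \<Phi> p" by fastforce
  have le0: "\<Phi> (x, Y) \<le> \<gamma>0" using min[OF base_in] \<Phi>0 by simp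
  have Y: "kpsd I Y" and xX: "x \<in> X" using xY by (auto simp: C_def KX_def X_def split: if_splits)
  \<comment> \<open>The minimum over the compact set is global: a competitor below the base value
    lies in \<open>C\<close> once its entries off \<open>I\<close> are erased, and any other
    competitor exceeds the base value.\<close>
  have glob: "\<Phi> (x, Y) \<le> \<Phi> (x', Y')" if "x' \<in> X" "kpsd I Y'" for x' Y'
  proof (cases "\<Phi> (x', Y') \<le> \<gamma>0")
    case True
    define Y'' where "Y'' = (\<lambda>a b. if a \<in> I \<and> b \<in> I then Y' a b else 0)"
    have *: "\<Phi> (x', Y'') = \<Phi> (x', Y')" by (simp add: \<Phi>_def Y''_def)
    have "kpsd I Y''" using that(2) kpsd_cong[of I Y'' Y'] by (simp add: Y''_def)
    then have "(x', Y'') \<in> C" using that True * by (intro inC) (auto simp: Y''_def)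
    then show ?thesis using min * by fastforce
  qed (use le0 in linarith)
  define e where "e = (\<lambda>a b. M a b x - Y a b)"
  \<comment> \<open>Optimality along the segment to a competitor. By affinity the penalised
    objective is a quadratic polynomial in t, whose slope at 0 is nonnegative.\<close>
  have opt: "0 \<le> (\<Sum>s\<in>S. Re (cnj (r s x) * (r s x' - r s x)))
      + \<mu> * (\<Sum>a\<in>I. \<Sum>b\<in>I. Re (cnj (e a b) * ((M a b x' - Y' a b) - e a b)))"
    (is "0 \<le> ?A") if x': "x' \<in> X" and Y': "kpsd I Y'" for x' Y'
  proof (rule nonneg_slope)
    fix t :: real assume t: "0 < t" "t \<le> 1"
    let ?xt = "\<lambda>v. x v + of_real t * (x' v - x v)"
    let ?Yt = "\<lambda>a b. of_real (1 - t) * Y a b + of_real t * Y' a b"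
    have "?xt \<in> X" using xX x' by (simp add: X_def)
    moreover have "kpsd I ?Yt" using t by (intro kpsd_add kpsd_scale Y Y') auto
    ultimately have "\<Phi> (x, Y) \<le> \<Phi> (?xt, ?Yt)" by (rule glob)
    also have "\<Phi> (?xt, ?Yt) = (\<Sum>s\<in>S. (cmod (r s x + of_real t * (r s x' - r s x)))\<^sup>2)
      + \<mu> * (\<Sum>a\<in>I. \<Sum>b\<in>I. (cmod (e a b + of_real t * ((M a b x' - Y' a b) - e a b)))\<^sup>2)"
    proof -
      have "M a b ?xt - ?Yt a b = e a b + of_real t * ((M a b x' - Y' a b) - e a b)"
        if "a \<in> I" "b \<in> I" for a b
        unfolding M_affine[OF that] by (simp add: e_def algebra_simps)
      then show ?thesis unfolding \<Phi>_def case_prod_conv using r_affine by simp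
    qed
    also have "\<dots> = \<Phi> (x, Y) + 2 * t * ?A + t\<^sup>2 * ((\<Sum>s\<in>S. (cmod (r s x' - r s x))\<^sup>2)
      + \<mu> * (\<Sum>a\<in>I. \<Sum>b\<in>I. (cmod ((M a b x' - Y' a b) - e a b))\<^sup>2))"
      unfolding cmod_affine_square \<Phi>_def case_prod_conv sum.distrib
        sum_distrib_left[symmetric]
      by (simp add: algebra_simps e_def)
    finally show "0 \<le> 2 * t * ?A + t\<^sup>2 * ((\<Sum>s\<in>S. (cmod (r s x' - r s x))\<^sup>2)
      + \<mu> * (\<Sum>a\<in>I. \<Sum>b\<in>I. (cmod ((M a b x' - Y' a b) - e a b))\<^sup>2))" by linarith
  qed
  define z where "z = (\<lambda>a b. of_real (2 * \<mu>) * (- e a b))"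
  have main: "(\<Sum>s\<in>S. (cmod (r s x))\<^sup>2) \<le> (\<Sum>s\<in>S. (cmod (r s x'))\<^sup>2)
       - Re (\<Sum>a\<in>I. \<Sum>b\<in>I. cnj (z a b) * M a b x') + Re (\<Sum>a\<in>I. \<Sum>b\<in>I. cnj (z a b) * Y' a b)"
    if x': "x' \<in> X" and Y': "kpsd I Y'" for x' Y'
  proof -
    have "(\<Sum>s\<in>S. (cmod (r s x))\<^sup>2) + 2 * (\<Sum>s\<in>S. Re (cnj (r s x) * (r s x' - r s x))) \<le> (\<Sum>s\<in>S. (cmod (r s x'))\<^sup>2)"
      unfolding sum_distrib_left sum.distrib[symmetric] by (intro sum_mono cmod_square_ge)
    \<comment> \<open>Only the nonpositive terms - |e|^2 are dropped here.\<close>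
    moreover have "(\<Sum>a\<in>I. \<Sum>b\<in>I. Re (cnj (e a b) * ((M a b x' - Y' a b) - e a b)))
      \<le> (\<Sum>a\<in>I. \<Sum>b\<in>I. Re (cnj (e a b) * (M a b x' - Y' a b)))"
      by (intro sum_mono) (simp add: algebra_simps)
    then have "2 * \<mu> * (\<Sum>a\<in>I. \<Sum>b\<in>I. Re (cnj (e a b) * ((M a b x' - Y' a b) - e a b)))
      \<le> 2 * \<mu> * (\<Sum>a\<in>I. \<Sum>b\<in>I. Re (cnj (e a b) * (M a b x' - Y' a b)))"
      using lam by (intro mult_left_mono) auto
    moreover have "2 * \<mu> * (\<Sum>a\<in>I. \<Sum>b\<in>I. Re (cnj (e a b) * (M a b x' - Y' a b)))
       = - Re (\<Sum>a\<in>I. \<Sum>b\<in>I. cnj (z a b) * M a b x') + Re (\<Sum>a\<in>I. \<Sum>b\<in>I. cnj (z a b) * Y' a b)"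
      unfolding Re_sum sum_distrib_left sum_negf[symmetric] sum.distrib[symmetric]
      by (intro sum.cong) (auto simp: z_def algebra_simps)
    ultimately show ?thesis using opt[OF x' Y'] by (simp add: algebra_simps)
  qed
  have "kpsd I z"
  proof (rule kpsdI)
    show "z b a = cnj (z a b)" if "a \<in> I" "b \<in> I" for a b
      using M_herm[OF that, of x] kpsd_hermitian[OF Y that] by (simp add: z_def e_def)
    fix v :: "'i \<Rightarrow> complex"
    define q where "q = Re (kform I z v)"
    define w where "w = Re (\<Sum>a\<in>I. \<Sum>b\<in>I. cnj (z a b) * M a b x)"
    \<comment> \<open>The cone elements s v v^H serve as competitors \<open>Y'\<close>. The
      resulting bound \<open>w \<le> s * q\<close> for all \<open>s \<ge> 0\<close> is possible only
      if q is nonnegative.\<close>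
    have q: "Re (\<Sum>a\<in>I. \<Sum>b\<in>I. cnj (z a b) * (of_real s * (v a * cnj (v b)))) = s * q" for s
      unfolding q_def kform_def Re_sum sum_distrib_left
      by (intro sum.cong) (auto simp: algebra_simps)
    have w: "w \<le> s * q" if "s \<ge> 0" for s
      using main[OF xX kpsd_scale[OF kpsd_rank_one[OF fin(2), of v] that]] unfolding q w_def by simp
    show "0 \<le> q"
    proof (rule ccontr)
      assume "\<not> 0 \<le> q"
      moreover have "w \<le> (\<bar>w\<bar> + 1) / (- q) * q"
        using \<open>\<not> 0 \<le> q\<close> by (intro w divide_nonneg_nonneg) auto
      ultimately have "w \<le> - (\<bar>w\<bar> + 1)" by (simp add: minus_divide_left[symmetric])
      then show False by linarith
    qed
  qed
  moreover have "\<forall>x'\<in>X. (\<Sum>s\<in>S. (cmod (r s x))\<^sup>2)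
       \<le> (\<Sum>s\<in>S. (cmod (r s x'))\<^sup>2) - Re (\<Sum>a\<in>I. \<Sum>b\<in>I. cnj (z a b) * M a b x')"
    using main[where Y' = "\<lambda>_ _. 0"] by (simp add: kpsd_def kform_def)
  ultimately show ?thesis using xX Y dist[OF le0] by blast
qed


section \<open>Expansions in powers of \<open>1/q\<close>\<close>

text \<open>A relation between a sequence and a function, so that operations on functions become
  operations on sequences; the description operator in \<open>markov_entry\<close> is evaluated
  through uniqueness.\<close>

definition has_markov :: "(nat \<Rightarrow> complex) \<Rightarrow> (complex \<Rightarrow> complex) \<Rightarrow> bool" where
  "has_markov c f \<longleftrightarrow> (\<forall>q\<in>outer_disc. (\<lambda>k. c k / q ^ k) sums f q)"

lemma outer_disc_cis: "1 < \<rho> \<Longrightarrow> of_real \<rho> * cis \<Omega> \<in> outer_disc"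
  by (simp add: outer_disc_def norm_mult)

text \<open>In the variable z = 1/q this is absolute convergence of a power series inside its disc
  of convergence. The auxiliary x lies midway between \<open>cmod z\<close> and 1.\<close>

lemma has_markov_summable_norm:
  assumes "has_markov c f" "cmod z < 1"
  shows "summable (\<lambda>k. cmod (c k * z ^ k))"
proof -
  define x where "x = complex_of_real ((1 + cmod z) / 2)"
  have "cmod x = (1 + cmod z) / 2" unfolding x_def norm_of_real by simp
  then have x: "cmod z < cmod x" "cmod x < 1" using assms(2) by auto
  then have "x \<noteq> 0" by force
  then have "1 / x \<in> outer_disc" using x by (simp add: outer_disc_def norm_divide)
  then have "(\<lambda>k. c k / (1 / x) ^ k) sums f (1 / x)" using assms(1) unfolding has_markov_def by blast
  then have "summable (\<lambda>k. c k * x ^ k)" by (simp add: sums_iff power_one_over)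
  then show ?thesis using powser_insidea x(1) by blast
qed

lemma has_markov_suminf:
  assumes "has_markov c f" "q \<in> outer_disc"
  shows "f q = (\<Sum>k. c k / q ^ k)" "summable (\<lambda>k. cmod (c k / q ^ k))"
proof -
  show "f q = (\<Sum>k. c k / q ^ k)" using assms unfolding has_markov_def by (auto simp: sums_iff)
  have "cmod (1 / q) < 1" using assms(2) by (simp add: outer_disc_def norm_divide divide_less_eq)
  from has_markov_summable_norm[OF assms(1) this]
  show "summable (\<lambda>k. cmod (c k / q ^ k))" by (simp add: power_one_over)
qed

lemma has_markov_cong:
  assumes "has_markov c f" "\<And>q. q \<in> outer_disc \<Longrightarrow> f q = g q"
  shows "has_markov c g"
  using assms unfolding has_markov_def by auto

lemma has_markov_diff:
  "has_markov c f \<Longrightarrow> has_markov d g \<Longrightarrow> has_markov (\<lambda>k. c k - d k) (\<lambda>q. f q - g q)"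
  unfolding has_markov_def by (auto simp: diff_divide_distrib intro!: sums_diff)

lemma has_markov_zero: "has_markov (\<lambda>_. 0) (\<lambda>_. 0)"
  unfolding has_markov_def by simp

lemma has_markov_sum:
  assumes "\<And>i. i \<in> I \<Longrightarrow> has_markov (c i) (f i)"
  shows "has_markov (\<lambda>k. \<Sum>i\<in>I. c i k) (\<lambda>q. \<Sum>i\<in>I. f i q)"
  using assms unfolding has_markov_def by (auto simp: sum_divide_distrib intro!: sums_sum)

definition conv :: "(nat \<Rightarrow> complex) \<Rightarrow> (nat \<Rightarrow> complex) \<Rightarrow> nat \<Rightarrow> complex" where
  "conv c d k = (\<Sum>i\<le>k. c i * d (k - i))"

lemma has_markov_mult:
  assumes "has_markov c f" "has_markov d g"
  shows "has_markov (conv c d) (\<lambda>q. f q * g q)"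
  unfolding has_markov_def
proof
  fix q assume q: "q \<in> outer_disc"
  then have nz: "q \<noteq> 0" by (auto simp: outer_disc_def)
  have "(\<lambda>k. \<Sum>i\<le>k. (c i / q ^ i) * (d (k - i) / q ^ (k - i))) sums (f q * g q)"
    using Cauchy_product_sums[OF has_markov_suminf(2)[OF assms(1) q] has_markov_suminf(2)[OF assms(2) q]]
    unfolding has_markov_suminf(1)[OF assms(1) q] has_markov_suminf(1)[OF assms(2) q] .
  moreover have "(\<Sum>i\<le>k. (c i / q ^ i) * (d (k - i) / q ^ (k - i))) = conv c d k / q ^ k" for k
    unfolding conv_def sum_divide_distrib
    by (intro sum.cong) (auto simp: power_add[symmetric])
  ultimately show "(\<lambda>k. conv c d k / q ^ k) sums (f q * g q)" by simp
qed

lemma has_markov_finite: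
  "has_markov (\<lambda>k. if k \<le> n then c k else 0) (\<lambda>q. \<Sum>k\<le>n. c k / q ^ k)"
  unfolding has_markov_def
proof
  fix q :: complex
  have "(\<lambda>k. (if k \<le> n then c k else 0) / q ^ k) sums (\<Sum>k\<le>n. (if k \<le> n then c k else 0) / q ^ k)"
    by (rule sums_finite) auto
  then show "(\<lambda>k. (if k \<le> n then c k else 0) / q ^ k) sums (\<Sum>k\<le>n. c k / q ^ k)" by simp
qed

text \<open>Under z = 1/q the point at infinity becomes an isolated singularity at 0, removable
  because the function is bounded. The Taylor series of the extension is the expansion in
  1/q.\<close>

lemma has_markov_exists:
  assumes "f analytic_on outer_disc" "\<And>q. q \<in> outer_disc \<Longrightarrow> cmod (f q) \<le> B"
  shows "\<exists>c. has_markov c f"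
proof -
  define g where "g = (\<lambda>z. f (1 / z))"
  have out: "1 / z \<in> outer_disc" if "z \<in> ball 0 1 - {0}" for z
    using that by (auto simp: outer_disc_def norm_divide less_divide_eq)
  have "f holomorphic_on outer_disc" by (rule analytic_imp_holomorphic[OF assms(1)])
  then have "g holomorphic_on ball 0 1 - {0}" unfolding g_def
    by (intro holomorphic_on_compose_gen[of "\<lambda>z. 1 / z" _ f outer_disc, unfolded o_def])
       (use out in \<open>force intro!: holomorphic_intros\<close>)+
  moreover have "eventually (\<lambda>z. cmod (g z) \<le> B) (at 0)"
    unfolding eventually_at by (rule exI[of _ 1]) (use out assms(2) in \<open>auto simp: g_def\<close>)
  ultimately obtain h where h: "h holomorphic_on ball 0 1" "\<And>z. z \<in> ball 0 1 - {0} \<Longrightarrow> h z = g z"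
    using holomorphic_on_extend_bounded[of g "ball 0 1" 0] by auto
  define c where "c = (\<lambda>n. (deriv ^^ n) h 0 / fact n)"
  have "has_markov c f" unfolding has_markov_def
  proof
    fix q assume q: "q \<in> outer_disc"
    then have z: "1 / q \<in> ball 0 1 - {0}" by (auto simp: outer_disc_def norm_divide divide_less_eq)
    have "(\<lambda>n. c n * (1 / q - 0) ^ n) sums h (1 / q)"
      unfolding c_def by (rule holomorphic_power_series[OF h(1)]) (use z in auto)
    then show "(\<lambda>k. c k / q ^ k) sums f q"
      using h(2)[OF z] by (simp add: g_def power_one_over)
  qed
  then show ?thesis by blast
qed

lemma has_markov_analytic:
  assumes "has_markov c f"
  shows "f analytic_on outer_disc"
proof -
  define h where "h = (\<lambda>z. \<Sum>k. c k * z ^ k)"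
  have "h holomorphic_on ball 0 1"
  proof (rule power_series_holomorphic)
    fix w :: complex assume "w \<in> ball 0 1"
    then have "summable (\<lambda>k. c k * w ^ k)"
      using has_markov_summable_norm[OF assms, of w] by (auto intro: summable_norm_cancel)
    then show "(\<lambda>n. c n * (w - 0) ^ n) sums h w" unfolding h_def by (simp add: summable_sums)
  qed
  then have "(\<lambda>q. h (1 / q)) holomorphic_on outer_disc"
    by (intro holomorphic_on_compose_gen[of "\<lambda>z. 1 / z" _ h "ball 0 1", unfolded o_def])
       (auto intro!: holomorphic_intros simp: outer_disc_def norm_divide divide_less_eq)
  moreover have "h (1 / q) = f q" if "q \<in> outer_disc" for q
    using has_markov_suminf(1)[OF assms that] by (simp add: h_def power_one_over)
  ultimately have "f holomorphic_on outer_disc" by (rule holomorphic_transform)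
  moreover have "open outer_disc" unfolding outer_disc_def
    by (intro open_Collect_less continuous_intros)
  ultimately show ?thesis by (simp add: analytic_on_open)
qed

subsection \<open>Fourier coefficients on circles\<close>

lemma has_integral_cis:
  "((\<lambda>\<Omega>. cis (of_int n * \<Omega>)) has_integral (if n = 0 then of_real (2 * pi) else 0)) {-pi..pi}"
proof (cases "n = 0")
  case True
  then show ?thesis using has_integral_const_real[of "1 :: complex" "-pi" pi]
    by (simp add: scaleR_conv_of_real)
next
  case False
  define F where "F = (\<lambda>x. cis (of_int n * x) / (\<i> * of_int n))"
  have F: "(F has_vector_derivative cis (of_int n * x)) (at x within {-pi..pi})" for x
    unfolding F_def using False
    by (auto intro!: derivative_eq_intros has_vector_derivative_real_field simp: cis_conv_exp) (simp add: ac_simps)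
  have "((\<lambda>\<Omega>. cis (of_int n * \<Omega>)) has_integral (F pi - F (- pi))) {-pi..pi}"
    by (rule fundamental_theorem_of_calculus[OF _ F]) auto
  moreover have "cis (of_int n * pi) = cis (of_int n * (- pi))"
    by (simp add: complex_eq_iff sin_zero_iff_int2)
  then have "F pi = F (- pi)" unfolding F_def by simp
  ultimately show ?thesis using False by simp
qed

lemma circle_term: "\<rho> > 0 \<Longrightarrow> c / (of_real \<rho> * cis \<Omega>) ^ k = (c / of_real \<rho> ^ k) * cis (of_int (- int k) * \<Omega>)"
proof -
  have "inverse (cis \<Omega> ^ k) = cis (of_int (- int k) * \<Omega>)"
    unfolding Complex.DeMoivre cis_inverse by simp
  then show ?thesis by (simp add: power_mult_distrib divide_inverse)
qed

lemma has_markov_uniform_circle: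
  assumes "has_markov c f" "1 < \<rho>"
  shows "uniform_limit {-pi..pi} (\<lambda>N \<Omega>. \<Sum>k<N. c k / (of_real \<rho> * cis \<Omega>) ^ k)
    (\<lambda>\<Omega>. f (of_real \<rho> * cis \<Omega>)) sequentially"
proof -
  have "cmod (of_real (1 / \<rho>)) < 1" using assms(2) by (simp add: norm_divide)
  from has_markov_summable_norm[OF assms(1) this]
  have s: "summable (\<lambda>k. cmod (c k) / \<rho> ^ k)"
    using assms(2) by (simp add: norm_mult norm_power norm_divide power_one_over)
  have "uniform_limit {-pi..pi} (\<lambda>N \<Omega>. \<Sum>k<N. c k / (of_real \<rho> * cis \<Omega>) ^ k)
    (\<lambda>\<Omega>. \<Sum>k. c k / (of_real \<rho> * cis \<Omega>) ^ k) sequentially"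
    by (rule Weierstrass_m_test[OF _ s]) (use assms(2) in \<open>simp add: norm_divide norm_power norm_mult\<close>)
  then show ?thesis
    using has_markov_suminf(1)[OF assms(1) outer_disc_cis[OF assms(2)]] by simp
qed

lemma has_markov_continuous_circle:
  assumes "has_markov c f" "1 < \<rho>"
  shows "continuous_on A (\<lambda>\<Omega>. f (of_real \<rho> * cis \<Omega>))"
proof -
  have "continuous_on outer_disc f"
    using has_markov_analytic[OF assms(1)] analytic_imp_holomorphic holomorphic_on_imp_continuous_on by blast
  then show ?thesis
    by (rule continuous_on_compose2) (use outer_disc_cis[OF assms(2)] in \<open>auto intro!: continuous_intros\<close>)
qed

text \<open>Uniform convergence on the circle allows termwise integration, and the integrals of the
  partial sums are constant as soon as they contain the index n. For negative n no term survives,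
  since only nonnegative powers of 1/q occur.\<close>

lemma has_markov_fourier:
  assumes "has_markov c f" "1 < \<rho>"
  shows "((\<lambda>\<Omega>. f (of_real \<rho> * cis \<Omega>) * cis (of_int n * \<Omega>)) has_integral
    (if 0 \<le> n then of_real (2 * pi) * c (nat n) / of_real \<rho> ^ nat n else 0)) {-pi..pi}"
proof -
  let ?s = "\<lambda>N \<Omega>. \<Sum>k<N. c k / (of_real \<rho> * cis \<Omega>) ^ k"
  have "uniform_limit {-pi..pi} (\<lambda>N \<Omega>. ?s N \<Omega> * cis (of_int n * \<Omega>))
      (\<lambda>\<Omega>. f (of_real \<rho> * cis \<Omega>) * cis (of_int n * \<Omega>)) sequentially"
    by (intro uniform_lim_mult has_markov_uniform_circle[OF assms] uniform_limit_const)
       (auto intro!: compact_imp_bounded compact_continuous_image has_markov_continuous_circle[OF assms]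
          continuous_intros)
  moreover have "continuous_on {-pi..pi} (\<lambda>\<Omega>. ?s N \<Omega> * cis (of_int n * \<Omega>))" for N
    using assms(2) by (intro continuous_intros) auto
  ultimately obtain I J where IJ: "\<And>N. ((\<lambda>\<Omega>. ?s N \<Omega> * cis (of_int n * \<Omega>)) has_integral I N) {-pi..pi}"
    "((\<lambda>\<Omega>. f (of_real \<rho> * cis \<Omega>) * cis (of_int n * \<Omega>)) has_integral J) {-pi..pi}" "I \<longlonglongrightarrow> J"
    by (rule uniform_limit_integral) auto
  define K where "K = (if 0 \<le> n then of_real (2 * pi) * c (nat n) / of_real \<rho> ^ nat n else 0)"
  have "I N = K" if N: "nat n < N" for N
  proof -
    have "((\<lambda>\<Omega>. \<Sum>k<N. (c k / of_real \<rho> ^ k) * cis (of_int (n - int k) * \<Omega>)) has_integral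
      (\<Sum>k<N. (c k / of_real \<rho> ^ k) * (if n - int k = 0 then of_real (2 * pi) else 0))) {-pi..pi}"
      by (intro has_integral_sum has_integral_mult_right has_integral_cis) auto
    moreover have "?s N \<Omega> * cis (of_int n * \<Omega>) = (\<Sum>k<N. (c k / of_real \<rho> ^ k) * cis (of_int (n - int k) * \<Omega>))" for \<Omega>
      unfolding sum_distrib_right using assms(2)
      by (intro sum.cong refl, subst circle_term) (auto simp: cis_mult algebra_simps)
    moreover have "(\<Sum>k<N. (c k / of_real \<rho> ^ k) * (if n - int k = 0 then of_real (2 * pi) else 0)) = K"
    proof (cases "0 \<le> n")
      case True
      then have "(n - int k = 0) = (k = nat n)" for k by auto
      then show ?thesis using True N by (simp add: K_def if_distrib sum.delta cong: if_cong)
    qed (auto simp: K_def intro!: sum.neutral)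
    ultimately have "((\<lambda>\<Omega>. ?s N \<Omega> * cis (of_int n * \<Omega>)) has_integral K) {-pi..pi}" by (simp only:)
    then show ?thesis by (rule has_integral_unique[OF IJ(1)])
  qed
  then have "I \<longlonglongrightarrow> K" by (intro tendsto_eventually eventually_sequentiallyI[of "Suc (nat n)"]) auto
  then have "J = K" using IJ(3) LIMSEQ_unique by blast
  then show ?thesis using IJ(2) unfolding K_def by blast
qed

lemma has_markov_unique:
  assumes "has_markov c f" "has_markov d f"
  shows "c = d"
proof
  fix k
  have "of_real (2 * pi) * c k / of_real 2 ^ k = of_real (2 * pi) * d k / of_real 2 ^ k"
    using has_integral_unique[OF has_markov_fourier[OF assms(1), of 2 "int k"] has_markov_fourier[OF assms(2), of 2 "int k"]]
    by simp
  then show "c k = d k" by simp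
qed

lemma markov_entry_eq: "has_markov c f \<Longrightarrow> markov_entry f = c"
  unfolding markov_entry_def has_markov_def[symmetric]
  by (rule the_equality) (auto intro: has_markov_unique)

lemma markov_eqI:
  assumes "\<And>i j. i < nr \<Longrightarrow> j < nc \<Longrightarrow> has_markov (c i j) (\<lambda>q. S q $$ (i, j))" "i < nr" "j < nc"
  shows "markov nr nc S k $$ (i, j) = c i j k"
  using assms markov_entry_eq[OF assms(1)] by (simp add: markov_def)

text \<open>Only the conjugated factor is replaced by partial sums; the Fourier coefficients of the
  other factor then give the partial sums of squares.\<close>

lemma has_markov_parseval:
  assumes "has_markov c f" "1 < \<rho>"
  shows "(\<lambda>k. (cmod (c k))\<^sup>2 / (\<rho> ^ k)\<^sup>2) sums
      (1 / (2 * pi) * integral {-pi..pi} (\<lambda>\<Omega>. (cmod (f (of_real \<rho> * cis \<Omega>)))\<^sup>2))"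
    and "(\<lambda>\<Omega>. (cmod (f (of_real \<rho> * cis \<Omega>)))\<^sup>2) integrable_on {-pi..pi}"
proof -
  let ?f = "\<lambda>\<Omega>. f (of_real \<rho> * cis \<Omega>)"
  let ?s = "\<lambda>N \<Omega>. \<Sum>k<N. c k / (of_real \<rho> * cis \<Omega>) ^ k"
  have bl: "uniform_limit {-pi..pi} (\<lambda>N \<Omega>. cnj (?s N \<Omega>)) (\<lambda>\<Omega>. cnj (?f \<Omega>)) sequentially"
    by (rule bounded_linear.uniform_limit[OF bounded_linear_cnj has_markov_uniform_circle[OF assms]])
  have "uniform_limit {-pi..pi} (\<lambda>N \<Omega>. ?f \<Omega> * cnj (?s N \<Omega>)) (\<lambda>\<Omega>. ?f \<Omega> * cnj (?f \<Omega>)) sequentially"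
    by (intro uniform_lim_mult bl uniform_limit_const)
       (auto intro!: compact_imp_bounded compact_continuous_image has_markov_continuous_circle[OF assms]
          continuous_intros)
  moreover have "continuous_on {-pi..pi} (\<lambda>\<Omega>. ?f \<Omega> * cnj (?s N \<Omega>))" for N
    using assms(2) by (intro continuous_intros has_markov_continuous_circle[OF assms]) auto
  ultimately obtain I J where IJ: "\<And>N. ((\<lambda>\<Omega>. ?f \<Omega> * cnj (?s N \<Omega>)) has_integral I N) {-pi..pi}"
    "((\<lambda>\<Omega>. ?f \<Omega> * cnj (?f \<Omega>)) has_integral J) {-pi..pi}" "I \<longlonglongrightarrow> J"
    by (rule uniform_limit_integral) auto
  have I: "I N = of_real (2 * pi * (\<Sum>k<N. (cmod (c k))\<^sup>2 / (\<rho> ^ k)\<^sup>2))" for N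
  proof -
    have "((\<lambda>\<Omega>. \<Sum>k<N. cnj (c k) / of_real \<rho> ^ k * (?f \<Omega> * cis (of_int (int k) * \<Omega>))) has_integral
      (\<Sum>k<N. cnj (c k) / of_real \<rho> ^ k * (if 0 \<le> int k then of_real (2 * pi) * c (nat (int k)) / of_real \<rho> ^ nat (int k) else 0))) {-pi..pi}"
      by (intro has_integral_sum has_integral_mult_right has_markov_fourier[OF assms]) auto
    moreover have "(\<Sum>k<N. cnj (c k) / of_real \<rho> ^ k * (?f \<Omega> * cis (of_int (int k) * \<Omega>))) = ?f \<Omega> * cnj (?s N \<Omega>)" for \<Omega>
      unfolding sum_distrib_left cnj_sum using assms(2)
      by (intro sum.cong refl, subst circle_term) (auto simp: cis_cnj[symmetric])
    moreover have "(\<Sum>k<N. cnj (c k) / of_real \<rho> ^ k * (if 0 \<le> int k then of_real (2 * pi) * c (nat (int k)) / of_real \<rho> ^ nat (int k) else 0))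
      = of_real (2 * pi * (\<Sum>k<N. (cmod (c k))\<^sup>2 / (\<rho> ^ k)\<^sup>2))"
    proof -
      have "cnj (c k) / of_real \<rho> ^ k * (if 0 \<le> int k then of_real (2 * pi) * c (nat (int k)) / of_real \<rho> ^ nat (int k) else 0)
        = of_real (2 * pi * ((cmod (c k))\<^sup>2 / (\<rho> ^ k)\<^sup>2))" for k
      proof -
        have "cnj (c k) * c k = of_real ((cmod (c k))\<^sup>2)"
          using complex_norm_square[of "c k"] by (simp add: mult.commute)
        then show ?thesis by (simp add: power2_eq_square mult_ac)
      qed
      then show ?thesis by (simp only: sum_distrib_left of_real_sum)
    qed
    ultimately have "((\<lambda>\<Omega>. ?f \<Omega> * cnj (?s N \<Omega>)) has_integral
      of_real (2 * pi * (\<Sum>k<N. (cmod (c k))\<^sup>2 / (\<rho> ^ k)\<^sup>2))) {-pi..pi}" by (simp only:)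
    then show ?thesis by (rule has_integral_unique[OF IJ(1)])
  qed
  have "((\<lambda>\<Omega>. Re (?f \<Omega> * cnj (?f \<Omega>))) has_integral Re J) {-pi..pi}"
    by (rule has_integral_Re[OF IJ(2)])
  then have J: "((\<lambda>\<Omega>. (cmod (?f \<Omega>))\<^sup>2) has_integral Re J) {-pi..pi}"
    by (simp add: complex_norm_square[symmetric] del: of_real_power)
  have "(\<lambda>N. Re (I N)) \<longlonglongrightarrow> Re J" by (rule tendsto_Re[OF IJ(3)])
  then have "(\<lambda>N. 1 / (2 * pi) * (2 * pi * (\<Sum>k<N. (cmod (c k))\<^sup>2 / (\<rho> ^ k)\<^sup>2))) \<longlonglongrightarrow> 1 / (2 * pi) * Re J"
    unfolding I Re_complex_of_real by (intro tendsto_mult tendsto_const)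
  then show "(\<lambda>k. (cmod (c k))\<^sup>2 / (\<rho> ^ k)\<^sup>2) sums
      (1 / (2 * pi) * integral {-pi..pi} (\<lambda>\<Omega>. (cmod (?f \<Omega>))\<^sup>2))"
    using integral_unique[OF J] unfolding sums_def by simp
  show "(\<lambda>\<Omega>. (cmod (?f \<Omega>))\<^sup>2) integrable_on {-pi..pi}" using J by blast
qed


section \<open>Block Toeplitz kernels\<close>

text \<open>Block indices run from 0 to n inclusive: n + 1 blocks of size \<open>M\<close>, in
  agreement with the size \<open>n * M + M\<close> of the matrix inequality.\<close>

definition idx :: "nat \<Rightarrow> nat \<Rightarrow> (nat \<times> nat) set" where
  "idx n M = {..n} \<times> {..<M}"

text \<open>The lower triangular block Toeplitz matrix of a causal sequence. It is not Hermitian, so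
  positivity always refers to the real part of its form.\<close>

definition toep :: "(nat \<Rightarrow> nat \<Rightarrow> nat \<Rightarrow> complex) \<Rightarrow> nat \<times> nat \<Rightarrow> nat \<times> nat \<Rightarrow> complex" where
  "toep v a b = (if fst b \<le> fst a then v (fst a - fst b) (snd a) (snd b) else 0)"

lemma finite_idx [simp]: "finite (idx n M)"
  by (simp add: idx_def)

lemma kform_toep:
  "kform (idx n M) (toep v) x = (\<Sum>p<M. \<Sum>q<M. \<Sum>i\<le>n. \<Sum>j\<le>n.
     cnj (x (i, p)) * (if j \<le> i then v (i - j) p q else 0) * x (j, q))"
proof -
  have "kform (idx n M) (toep v) x = (\<Sum>i\<le>n. \<Sum>p<M. \<Sum>j\<le>n. \<Sum>q<M.
     cnj (x (i, p)) * (if j \<le> i then v (i - j) p q else 0) * x (j, q))"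
    unfolding kform_def idx_def sum.cartesian_product' toep_def by (simp cong: if_cong)
  also have "\<dots> = (\<Sum>p<M. \<Sum>i\<le>n. \<Sum>q<M. \<Sum>j\<le>n.
     cnj (x (i, p)) * (if j \<le> i then v (i - j) p q else 0) * x (j, q))"
    by (subst sum.swap) (intro sum.cong refl sum.swap)
  also have "\<dots> = (\<Sum>p<M. \<Sum>q<M. \<Sum>i\<le>n. \<Sum>j\<le>n.
     cnj (x (i, p)) * (if j \<le> i then v (i - j) p q else 0) * x (j, q))"
    by (intro sum.cong refl sum.swap)
  finally show ?thesis .
qed

lemma kform_bound:
  assumes "\<And>p q. p < M \<Longrightarrow> q < M \<Longrightarrow> cmod (K p q) \<le> B" "\<And>p. p < M \<Longrightarrow> cmod (y p) \<le> C" "0 \<le> C"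
  shows "cmod (kform {..<M} K y) \<le> real M * (real M * (C * B * C))"
proof -
  have "cmod (cnj (y p) * K p q * y q) \<le> C * B * C" if "p < M" "q < M" for p q
    unfolding norm_mult complex_mod_cnj using assms that
    by (intro mult_mono mult_nonneg_nonneg) (auto intro: order_trans[OF norm_ge_zero])
  then have "cmod (\<Sum>q<M. cnj (y p) * K p q * y q) \<le> real M * (C * B * C)" if "p < M" for p
    using sum_norm_bound[of "{..<M}" "\<lambda>q. cnj (y p) * K p q * y q" "C * B * C"] that by auto
  then show ?thesis unfolding kform_def
    using sum_norm_bound[of "{..<M}" "\<lambda>p. \<Sum>q<M. cnj (y p) * K p q * y q" "real M * (C * B * C)"] by auto
qed

text \<open>Let y be the trigonometric polynomial with coefficients x. On the circle of radius r > 1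
  the form of f at y has as its mean \<open>H r\<close>, the Toeplitz form with coefficients v_k /
  r^k, which tends to the form in question as r tends to 1. Boundedness of f supplies the dominating
  constant.\<close>

lemma toep_nonneg_of_boundary:
  assumes mk: "\<And>p q. p < M \<Longrightarrow> q < M \<Longrightarrow> has_markov (\<lambda>k. v k p q) (f p q)"
    and bd: "\<And>p q z. p < M \<Longrightarrow> q < M \<Longrightarrow> z \<in> outer_disc \<Longrightarrow> cmod (f p q z) \<le> B"
    and ae: "AE \<Omega> in lebesgue_on {-pi..pi}. \<exists>L.
      (\<forall>p<M. \<forall>q<M. ((\<lambda>r. f p q (of_real r * cis \<Omega>)) \<longlongrightarrow> L p q) (at_right 1)) \<and>
      (\<forall>y. 0 \<le> Re (kform {..<M} L y))"
  shows "0 \<le> Re (kform (idx n M) (toep v) x)"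
proof -
  define y where "y = (\<lambda>\<Omega> p. \<Sum>i\<le>n. x (i, p) * cis (- (real i * \<Omega>)))"
  define h where "h = (\<lambda>r \<Omega>. Re (kform {..<M} (\<lambda>p q. f p q (of_real r * cis \<Omega>)) (y \<Omega>)))"
  define H where "H = (\<lambda>r. Re (\<Sum>p<M. \<Sum>q<M. \<Sum>i\<le>n. \<Sum>j\<le>n.
     cnj (x (i, p)) * (if j \<le> i then v (i - j) p q / of_real r ^ (i - j) else 0) * x (j, q)))"
  have hH: "(h r has_integral 2 * pi * H r) {-pi..pi}" if r: "1 < r" for r
  proof -
    have "((\<lambda>\<Omega>. \<Sum>p<M. \<Sum>q<M. \<Sum>i\<le>n. \<Sum>j\<le>n. cnj (x (i, p)) * x (j, q) *
        (f p q (of_real r * cis \<Omega>) * cis (of_int (int i - int j) * \<Omega>))) has_integral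
      (\<Sum>p<M. \<Sum>q<M. \<Sum>i\<le>n. \<Sum>j\<le>n. cnj (x (i, p)) * x (j, q) *
        (if 0 \<le> int i - int j then of_real (2 * pi) * v (nat (int i - int j)) p q / of_real r ^ nat (int i - int j) else 0))) {-pi..pi}"
      by (intro has_integral_sum has_integral_mult_right has_markov_fourier mk r) auto
    moreover have "(\<Sum>p<M. \<Sum>q<M. \<Sum>i\<le>n. \<Sum>j\<le>n. cnj (x (i, p)) * x (j, q) *
        (f p q (of_real r * cis \<Omega>) * cis (of_int (int i - int j) * \<Omega>)))
        = kform {..<M} (\<lambda>p q. f p q (of_real r * cis \<Omega>)) (y \<Omega>)" for \<Omega>
    proof -
      have c: "cis (of_int (int i - int j) * \<Omega>) = cnj (cis (- (real i * \<Omega>))) * cis (- (real j * \<Omega>))" for i j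
        by (simp add: cis_cnj cis_mult algebra_simps)
      have "cnj (y \<Omega> p) * F * y \<Omega> q = (\<Sum>i\<le>n. \<Sum>j\<le>n. cnj (x (i, p)) * x (j, q) *
          (F * cis (of_int (int i - int j) * \<Omega>)))" for p q F
      proof -
        have "cnj (y \<Omega> p) * F * y \<Omega> q = F * (cnj (y \<Omega> p) * y \<Omega> q)" by simp
        also have "\<dots> = (\<Sum>i\<le>n. \<Sum>j\<le>n. F * (cnj (x (i, p) * cis (- (real i * \<Omega>))) * (x (j, q) * cis (- (real j * \<Omega>)))))"
          unfolding y_def cnj_sum sum_product unfolding sum_distrib_left ..
        finally show ?thesis unfolding c by (simp add: mult_ac)
      qed
      then show ?thesis unfolding kform_def by simp
    qed
    moreover have "(\<Sum>p<M. \<Sum>q<M. \<Sum>i\<le>n. \<Sum>j\<le>n. cnj (x (i, p)) * x (j, q) *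
        (if 0 \<le> int i - int j then of_real (2 * pi) * v (nat (int i - int j)) p q / of_real r ^ nat (int i - int j) else 0))
       = of_real (2 * pi) * (\<Sum>p<M. \<Sum>q<M. \<Sum>i\<le>n. \<Sum>j\<le>n.
     cnj (x (i, p)) * (if j \<le> i then v (i - j) p q / of_real r ^ (i - j) else 0) * x (j, q))"
      unfolding sum_distrib_left by (intro sum.cong refl) (auto simp: nat_diff_distrib)
    ultimately have "((\<lambda>\<Omega>. kform {..<M} (\<lambda>p q. f p q (of_real r * cis \<Omega>)) (y \<Omega>)) has_integral
       of_real (2 * pi) * (\<Sum>p<M. \<Sum>q<M. \<Sum>i\<le>n. \<Sum>j\<le>n.
     cnj (x (i, p)) * (if j \<le> i then v (i - j) p q / of_real r ^ (i - j) else 0) * x (j, q))) {-pi..pi}"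
      by (simp only:)
    from has_integral_Re[OF this] show ?thesis unfolding h_def H_def by (simp add: Re_complex_of_real)
  qed
  define \<rho> where "\<rho> = (\<lambda>m. 1 + 1 / real (Suc m))"
  have \<rho>: "1 < \<rho> m" for m by (simp add: \<rho>_def)
  have \<rho>_lim: "\<rho> \<longlonglongrightarrow> 1" unfolding \<rho>_def
    using tendsto_add[OF tendsto_const LIMSEQ_Suc[OF lim_1_over_n], of 1] by simp
  have \<rho>_at: "filterlim \<rho> (at_right 1) sequentially"
    unfolding filterlim_at using \<rho>_lim \<rho> by (auto simp: less_imp_neq[symmetric])
  \<comment> \<open>Nonnegativity is given on the unit circle alone, not on the circles of radius
    \<open>\<rho> m\<close>. The negative part tends to 0 almost everywhere, so its integral, a
    lower bound for \<open>2 * pi * H (\<rho> m)\<close>, tends to 0.\<close>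
  define g where "g = (\<lambda>m \<Omega>. min (h (\<rho> m) \<Omega>) 0)"
  have y_cont: "continuous_on A (\<lambda>\<Omega>. y \<Omega> p)" for A p
    unfolding y_def by (intro continuous_intros)
  have h_cont: "continuous_on {-pi..pi} (h (\<rho> m))" for m
    unfolding h_def kform_def
    by (intro continuous_intros y_cont has_markov_continuous_circle[OF mk \<rho>]) auto
  have g_cont: "continuous_on {-pi..pi} (g m)" for m
    unfolding g_def by (intro continuous_intros h_cont)
  define C where "C = (\<Sum>a\<in>idx n M. cmod (x a))"
  have y_bd: "cmod (y \<Omega> p) \<le> C" if "p < M" for \<Omega> p
  proof -
    have "cmod (y \<Omega> p) \<le> (\<Sum>i\<le>n. cmod (x (i, p)))"
      unfolding y_def by (rule sum_norm_le) (simp add: norm_mult)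
    also have "\<dots> = (\<Sum>a\<in>(\<lambda>i. (i, p)) ` {..n}. cmod (x a))"
      by (subst sum.reindex) (auto simp: inj_on_def)
    also have "\<dots> \<le> C" unfolding C_def by (rule sum_mono2) (use that in \<open>auto simp: idx_def\<close>)
    finally show ?thesis .
  qed
  have C: "0 \<le> C" unfolding C_def by (simp add: sum_nonneg)
  define W where "W = real M * (real M * (C * B * C))"
  have h_bd: "\<bar>h (\<rho> m) \<Omega>\<bar> \<le> W" for m \<Omega>
    unfolding h_def W_def
    by (rule order_trans[OF abs_Re_le_cmod kform_bound]) (use bd y_bd C outer_disc_cis[OF \<rho>] in auto)
  have g_lim: "AE \<Omega> in lebesgue_on {-pi..pi}. (\<lambda>m. g m \<Omega>) \<longlonglongrightarrow> 0"
    using ae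
  proof eventually_elim
    case (elim \<Omega>)
    then obtain L where L: "\<And>p q. p < M \<Longrightarrow> q < M \<Longrightarrow> ((\<lambda>r. f p q (of_real r * cis \<Omega>)) \<longlongrightarrow> L p q) (at_right 1)"
      "\<And>y. 0 \<le> Re (kform {..<M} L y)" by blast
    have "(\<lambda>m. f p q (of_real (\<rho> m) * cis \<Omega>)) \<longlonglongrightarrow> L p q" if "p < M" "q < M" for p q
      using filterlim_compose[OF L(1)[OF that] \<rho>_at] .
    then have "(\<lambda>m. h (\<rho> m) \<Omega>) \<longlonglongrightarrow> Re (kform {..<M} L (y \<Omega>))"
      unfolding h_def kform_def by (intro tendsto_intros) auto
    then have "(\<lambda>m. g m \<Omega>) \<longlonglongrightarrow> min (Re (kform {..<M} L (y \<Omega>))) 0"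
      unfolding g_def by (intro tendsto_min tendsto_const)
    then show ?case using L(2)[of "y \<Omega>"] by (simp add: min_def split: if_splits)
  qed
  have g_meas: "g m \<in> borel_measurable (lebesgue_on {-pi..pi})" for m
    by (rule continuous_imp_measurable_on_sets_lebesgue[OF g_cont]) auto
  have W_int: "integrable (lebesgue_on {-pi..pi}) (\<lambda>_. W)" by (simp add: integrable_const_ivl)
  have g_bd: "AE \<Omega> in lebesgue_on {-pi..pi}. norm (g m \<Omega>) \<le> W" for m
  proof (rule AE_I2)
    have "0 \<le> W" using h_bd[of m 0] abs_ge_zero order_trans by blast
    then show "norm (g m \<Omega>) \<le> W" for \<Omega>
      using h_bd[of m \<Omega>] by (simp add: g_def min_def abs_le_iff)
  qed
  have lim: "(\<lambda>m. integral\<^sup>L (lebesgue_on {-pi..pi}) (g m)) \<longlonglongrightarrow> integral\<^sup>L (lebesgue_on {-pi..pi}) (\<lambda>_. 0)"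
    by (rule integral_dominated_convergence[OF _ g_meas W_int g_lim g_bd]) simp
  have int: "integrable (lebesgue_on {-pi..pi}) (g m)" for m
    by (rule integrable_dominated_convergence2[OF _ g_meas W_int g_lim g_bd]) simp
  have g_le: "integral\<^sup>L (lebesgue_on {-pi..pi}) (g m) \<le> 2 * pi * H (\<rho> m)" for m
  proof -
    have "integral\<^sup>L (lebesgue_on {-pi..pi}) (g m) = integral {-pi..pi} (g m)"
      by (rule lebesgue_integral_eq_integral[OF int]) auto
    also have "\<dots> \<le> integral {-pi..pi} (h (\<rho> m))"
      by (intro integral_le integrable_continuous_real g_cont h_cont) (auto simp: g_def)
    also have "\<dots> = 2 * pi * H (\<rho> m)" using hH[OF \<rho>] by (rule integral_unique)
    finally show ?thesis .
  qed
  have H_lim: "(\<lambda>m. 2 * pi * H (\<rho> m)) \<longlonglongrightarrow> 2 * pi * Re (kform (idx n M) (toep v) x)"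
  proof -
    have "(\<lambda>m. (if j \<le> i then v (i - j) p q / of_real (\<rho> m) ^ (i - j) else 0)) \<longlonglongrightarrow>
      (if j \<le> i then v (i - j) p q else 0)" for i j p q
    proof -
      have "(\<lambda>m. v (i - j) p q / of_real (\<rho> m) ^ (i - j)) \<longlonglongrightarrow> v (i - j) p q / of_real 1 ^ (i - j)"
        by (intro tendsto_intros \<rho>_lim) simp
      then show ?thesis by simp
    qed
    then show ?thesis unfolding H_def kform_toep by (intro tendsto_intros)
  qed
  have "0 \<le> 2 * pi * Re (kform (idx n M) (toep v) x)"
    using LIMSEQ_le[OF lim H_lim] g_le by simp
  then show ?thesis using pi_gt_zero by (simp add: zero_le_mult_iff not_le[symmetric])
qed

text \<open>Evaluate the Toeplitz form at the geometric vectors \<open>x\<^sub>i = (cnj z)\<^sup>i y\<close> with \<open>z = 1/q\<close>: the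
  partial sums form a Cauchy product with limit \<open>f(q) / (1 - |z|\<^sup>2)\<close>.\<close>

lemma interior_nonneg_of_toep:
  assumes mk: "\<And>p q. p < M \<Longrightarrow> q < M \<Longrightarrow> has_markov (\<lambda>k. v k p q) (f p q)"
    and pos: "\<And>n x. 0 \<le> Re (kform (idx n M) (toep v) x)"
    and s: "s \<in> outer_disc"
  shows "0 \<le> Re (kform {..<M} (\<lambda>p q. f p q s) y)"
proof -
  define z where "z = 1 / s"
  have z: "cmod z < 1" using s by (simp add: z_def outer_disc_def norm_divide divide_less_eq)
  define w where "w = z * cnj z"
  have w: "w = of_real ((cmod z)\<^sup>2)" unfolding w_def by (rule complex_norm_square[symmetric])
  have z2: "(cmod z)\<^sup>2 < 1" using z by (simp add: power_less_one_iff)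
  then have wn: "cmod w < 1" unfolding w norm_of_real by simp
  define c where "c = 1 / (1 - (cmod z)\<^sup>2)"
  have c: "c > 0" using z2 by (simp add: c_def)
  have geo: "summable (\<lambda>j. cmod (w ^ j))" "(\<Sum>j. w ^ j) = of_real c"
    using wn by (auto simp: norm_power suminf_geometric c_def w)
  have T: "(\<lambda>n. \<Sum>i\<le>n. \<Sum>j\<le>i. w ^ j * (v (i - j) p q * z ^ (i - j))) \<longlonglongrightarrow> of_real c * f p q s"
    if "p < M" "q < M" for p q
  proof -
    have "(\<lambda>i. \<Sum>j\<le>i. w ^ j * (v (i - j) p q / s ^ (i - j))) sums (of_real c * f p q s)"
      using Cauchy_product_sums[OF geo(1) has_markov_suminf(2)[OF mk[OF that] s]]
      by (simp only: geo(2) has_markov_suminf(1)[OF mk[OF that] s])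
    then show ?thesis unfolding sums_def_le by (simp add: z_def power_one_over)
  qed
  define x where "x = (\<lambda>(i, p). cnj z ^ i * y p)"
  have row: "(\<Sum>j\<le>n. cnj (x (i, p)) * (if j \<le> i then v (i - j) p q else 0) * x (j, q))
      = (\<Sum>j\<le>i. cnj (y p) * y q * (w ^ j * (v (i - j) p q * z ^ (i - j))))"
    if "i \<in> {..n}" for n p q i
  proof -
    have "(\<Sum>j\<le>n. cnj (x (i, p)) * (if j \<le> i then v (i - j) p q else 0) * x (j, q))
      = (\<Sum>j\<le>i. cnj (x (i, p)) * (if j \<le> i then v (i - j) p q else 0) * x (j, q))"
      using that by (intro sum.mono_neutral_right) auto
    also have "\<dots> = (\<Sum>j\<le>i. cnj (y p) * y q * (w ^ j * (v (i - j) p q * z ^ (i - j))))"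
    proof (intro sum.cong refl)
      fix j assume "j \<in> {..i}"
      then have "z ^ i = z ^ j * z ^ (i - j)" by (simp add: power_add[symmetric])
      then show "cnj (x (i, p)) * (if j \<le> i then v (i - j) p q else 0) * x (j, q)
        = cnj (y p) * y q * (w ^ j * (v (i - j) p q * z ^ (i - j)))"
        using \<open>j \<in> {..i}\<close> by (simp add: x_def w_def power_mult_distrib mult_ac)
    qed
    finally show ?thesis .
  qed
  have "kform (idx n M) (toep v) x = (\<Sum>p<M. \<Sum>q<M. cnj (y p) * y q *
      (\<Sum>i\<le>n. \<Sum>j\<le>i. w ^ j * (v (i - j) p q * z ^ (i - j))))" for n
    unfolding kform_toep sum_distrib_left
    by (rule sum.cong[OF refl], rule sum.cong[OF refl], rule sum.cong[OF refl], rule row)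
  then have "(\<lambda>n. kform (idx n M) (toep v) x) \<longlonglongrightarrow> (\<Sum>p<M. \<Sum>q<M. cnj (y p) * y q * (of_real c * f p q s))"
    using T by (auto intro!: tendsto_intros)
  also have "(\<Sum>p<M. \<Sum>q<M. cnj (y p) * y q * (of_real c * f p q s)) = of_real c * kform {..<M} (\<lambda>p q. f p q s) y"
    unfolding kform_def sum_distrib_left by (simp add: mult_ac)
  finally have "(\<lambda>n. Re (kform (idx n M) (toep v) x)) \<longlonglongrightarrow> Re (of_real c * kform {..<M} (\<lambda>p q. f p q s) y)"
    by (rule tendsto_Re)
  then have "0 \<le> Re (of_real c * kform {..<M} (\<lambda>p q. f p q s) y)"
    by (rule LIMSEQ_le_const) (use pos in auto)
  then show ?thesis using c by (simp add: zero_le_mult_iff)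
qed


section \<open>Matrices and kernels\<close>

lemma mat_adjoint_dim [simp]: "dim_row (mat_adjoint A) = dim_col A" "dim_col (mat_adjoint A) = dim_row A"
  by (simp_all add: mat_adjoint_def)

lemma mat_adjoint_carrier [simp]: "A \<in> carrier_mat n m \<Longrightarrow> mat_adjoint A \<in> carrier_mat m n"
  by (rule carrier_matI) auto

lemma mat_adjoint_index [simp]:
  fixes A :: "complex mat"
  shows "i < dim_col A \<Longrightarrow> j < dim_row A \<Longrightarrow> mat_adjoint A $$ (i, j) = cnj (A $$ (j, i))"
  by (simp add: mat_adjoint_def mat_of_rows_def conjugate_vec_def)

lemma psd_iff_kpsd:
  assumes "M \<in> carrier_mat N N"
  shows "psd M \<longleftrightarrow> kpsd {..<N} (\<lambda>i j. M $$ (i, j))"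
proof -
  have d: "dim_row M = N" "dim_col M = N" using assms by auto
  have herm: "mat_adjoint M = M \<longleftrightarrow> (\<forall>a\<in>{..<N}. \<forall>b\<in>{..<N}. M $$ (b, a) = cnj (M $$ (a, b)))"
  proof
    assume h: "mat_adjoint M = M"
    show "\<forall>a\<in>{..<N}. \<forall>b\<in>{..<N}. M $$ (b, a) = cnj (M $$ (a, b))"
    proof (intro ballI)
      fix a b assume "a \<in> {..<N}" "b \<in> {..<N}"
      then show "M $$ (b, a) = cnj (M $$ (a, b))"
        using mat_adjoint_index[of b M a] d unfolding h by simp
    qed
  next
    assume "\<forall>a\<in>{..<N}. \<forall>b\<in>{..<N}. M $$ (b, a) = cnj (M $$ (a, b))"
    then have "cnj (M $$ (j, i)) = M $$ (i, j)" if "i < N" "j < N" for i j using that by (metis lessThan_iff)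
    then show "mat_adjoint M = M" using d by (intro eq_matI) simp_all
  qed
  have form: "(M *\<^sub>v v) \<bullet>c v = kform {..<N} (\<lambda>i j. M $$ (i, j)) (\<lambda>i. v $ i)" if "v \<in> carrier_vec N" for v
    using that d unfolding scalar_prod_def kform_def
    by (auto simp: scalar_prod_def sum_distrib_right sum_distrib_left lessThan_atLeast0 mult_ac intro!: sum.cong)
  have "(\<forall>v \<in> carrier_vec N. 0 \<le> Re ((M *\<^sub>v v) \<bullet>c v)) \<longleftrightarrow> (\<forall>x. 0 \<le> Re (kform {..<N} (\<lambda>i j. M $$ (i, j)) x))"
  proof (intro iffI allI ballI)
    fix x assume *: "\<forall>v \<in> carrier_vec N. 0 \<le> Re ((M *\<^sub>v v) \<bullet>c v)"
    have "kform {..<N} (\<lambda>i j. M $$ (i, j)) (\<lambda>i. vec N x $ i) = kform {..<N} (\<lambda>i j. M $$ (i, j)) x"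
      by (intro kform_cong) auto
    then show "0 \<le> Re (kform {..<N} (\<lambda>i j. M $$ (i, j)) x)" using * form[of "vec N x"] by (metis vec_carrier)
  qed (use form in auto)
  then show ?thesis unfolding psd_def kpsd_def herm d by simp
qed

lemma kform_add_adjoint:
  assumes "finite I"
  shows "kform I (\<lambda>i j. K i j + cnj (K j i)) x = of_real (2 * Re (kform I K x))"
proof -
  have "kform I (\<lambda>i j. cnj (K j i)) x = cnj (kform I K x)"
    unfolding kform_def cnj_sum by (subst sum.swap) (simp add: mult_ac)
  then show ?thesis unfolding kform_add by (simp add: complex_eq_iff)
qed

lemma kpsd_add_adjoint:
  assumes "finite I"
  shows "kpsd I (\<lambda>i j. K i j + cnj (K j i)) \<longleftrightarrow> (\<forall>x. 0 \<le> Re (kform I K x))"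
  unfolding kpsd_def kform_add_adjoint[OF assms] by simp

lemma herm_le_zero_add_adjoint:
  assumes "L \<in> carrier_mat N N"
  shows "0\<^sub>m N N \<preceq>\<^sub>H L + mat_adjoint L \<longleftrightarrow> (\<forall>x. 0 \<le> Re (kform {..<N} (\<lambda>i j. L $$ (i, j)) x))"
proof -
  have "kpsd {..<N} (\<lambda>i j. (L + mat_adjoint L - 0\<^sub>m N N) $$ (i, j))
    = kpsd {..<N} (\<lambda>i j. L $$ (i, j) + cnj (L $$ (j, i)))"
    by (rule kpsd_cong) (use assms in auto)
  moreover have "L + mat_adjoint L - 0\<^sub>m N N \<in> carrier_mat N N" using assms by auto
  ultimately show ?thesis unfolding herm_le_def by (simp add: psd_iff_kpsd kpsd_add_adjoint)
qed

lemma trace_adjoint_mult: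
  assumes "M \<in> carrier_mat nr nc"
  shows "Re (mat_trace (mat_adjoint M * M)) = (\<Sum>i<nr. \<Sum>j<nc. (cmod (M $$ (i, j)))\<^sup>2)"
proof -
  have d: "dim_row M = nr" "dim_col M = nc" using assms by auto
  have "mat_trace (mat_adjoint M * M) = (\<Sum>j<nc. \<Sum>i<nr. cnj (M $$ (i, j)) * M $$ (i, j))"
    unfolding mat_trace_def using d by (simp add: scalar_prod_def lessThan_atLeast0)
  also have "\<dots> = (\<Sum>i<nr. \<Sum>j<nc. of_real ((cmod (M $$ (i, j)))\<^sup>2))"
    by (subst sum.swap) (simp add: complex_norm_square mult.commute del: of_real_power)
  finally show ?thesis by simp
qed

section \<open>The two forms of the passivity constraint\<close>

text \<open>Vectors and matrices are functions of which only the first m coordinates count.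
  Identities obtained from an inverse hold only there, which is why they are applied through
  \<open>ip_cong\<close>.\<close>

definition ip :: "nat \<Rightarrow> (nat \<Rightarrow> complex) \<Rightarrow> (nat \<Rightarrow> complex) \<Rightarrow> complex" where
  "ip m a b = (\<Sum>p<m. cnj (a p) * b p)"

definition mv :: "nat \<Rightarrow> (nat \<Rightarrow> nat \<Rightarrow> complex) \<Rightarrow> (nat \<Rightarrow> complex) \<Rightarrow> nat \<Rightarrow> complex" where
  "mv m K b p = (\<Sum>q<m. K p q * b q)"

lemma ip_add: "ip m (\<lambda>p. a p + b p) c = ip m a c + ip m b c" "ip m c (\<lambda>p. a p + b p) = ip m c a + ip m c b"
  by (simp_all add: ip_def algebra_simps sum.distrib)

lemma ip_diff: "ip m (\<lambda>p. a p - b p) c = ip m a c - ip m b c" "ip m c (\<lambda>p. a p - b p) = ip m c a - ip m c b"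
  by (simp_all add: ip_def algebra_simps sum_subtractf)

lemma ip_uminus: "ip m (\<lambda>p. - a p) c = - ip m a c" "ip m c (\<lambda>p. - a p) = - ip m c a"
  by (simp_all add: ip_def sum_negf)

lemma mv_add: "mv m K (\<lambda>p. a p + b p) = (\<lambda>p. mv m K a p + mv m K b p)"
  by (simp add: fun_eq_iff mv_def algebra_simps sum.distrib)

lemma mv_diff: "mv m K (\<lambda>p. a p - b p) = (\<lambda>p. mv m K a p - mv m K b p)"
  by (simp add: fun_eq_iff mv_def algebra_simps sum_subtractf)

lemma mv_uminus: "mv m K (\<lambda>p. - a p) = (\<lambda>p. - mv m K a p)"
  by (simp add: fun_eq_iff mv_def sum_negf)

lemma ip_commute: "ip m a b = cnj (ip m b a)"
  by (simp add: ip_def mult.commute)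

lemma ip_cong: "(\<And>p. p < m \<Longrightarrow> a p = a' p) \<Longrightarrow> (\<And>p. p < m \<Longrightarrow> b p = b' p) \<Longrightarrow> ip m a b = ip m a' b'"
  by (simp add: ip_def)

lemma ip_adjoint: "ip m (mv m (\<lambda>p q. cnj (K q p)) a) b = ip m a (mv m K b)"
  unfolding ip_def mv_def cnj_sum sum_distrib_left sum_distrib_right
  by (subst sum.swap) (simp add: mult_ac)

lemma kform_eq_ip: "kform {..<m} K a = ip m a (mv m K a)"
  by (simp add: kform_def ip_def mv_def sum_distrib_left mult.assoc)

lemma mv_inverse:
  assumes "\<And>p q. p < m \<Longrightarrow> q < m \<Longrightarrow> (\<Sum>k<m. G p k * H k q) = (if p = q then 1 else 0)" "p < m"
  shows "mv m G (mv m H a) p = a p"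
proof -
  have "mv m G (mv m H a) p = (\<Sum>q<m. (\<Sum>k<m. G p k * H k q) * a q)"
    unfolding mv_def sum_distrib_left sum_distrib_right by (subst sum.swap) (simp add: mult_ac)
  also have "\<dots> = (\<Sum>q<m. (if p = q then 1 else 0) * a q)" using assms by simp
  finally show ?thesis using assms(2) by (simp add: if_distrib[of "\<lambda>x. x * _"] sum.delta cong: if_cong)
qed

text \<open>The real part of the quadratic form of \<open>[Q 0; Q F]\<close> at the stacked vector
  (a, b), written out by blocks.\<close>

definition pass_form :: "nat \<Rightarrow> (nat \<Rightarrow> nat \<Rightarrow> complex) \<Rightarrow> (nat \<Rightarrow> nat \<Rightarrow> complex) \<Rightarrow>
    (nat \<Rightarrow> complex) \<Rightarrow> (nat \<Rightarrow> complex) \<Rightarrow> real" where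
  "pass_form m Q F a b = Re (ip m a (mv m Q a) + ip m b (mv m Q a) + ip m b (mv m F b))"

text \<open>With \<open>G = F + F\<^sup>H\<close>, both forms say that an operator is a contraction for the inner product
  \<open>\<langle>a, G b\<rangle>\<close>: the form for \<open>Q\<close> concerns \<open>I - G\<^sup>-\<^sup>1 Q\<close>, the form for \<open>Q\<^sup>H\<close> its adjoint.\<close>

lemma pass_form_adjoint:
  assumes H: "\<And>p q. p < m \<Longrightarrow> q < m \<Longrightarrow> (\<Sum>k<m. (F p k + cnj (F k p)) * H k q) = (if p = q then 1 else 0)"
    and pos: "\<And>a b. 0 \<le> pass_form m Q F a b"
  shows "0 \<le> pass_form m (\<lambda>p q. cnj (Q q p)) F a b"
proof -
  define G where "G = (\<lambda>p k. F p k + cnj (F k p))"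
  define Qh where "Qh = (\<lambda>p q. cnj (Q q p))"
  \<comment> \<open>\<open>H\<close> inverts \<open>G\<close>. Let T = I - H Q and let T' = I - H
    Q^H be its adjoint for the inner product of \<open>G\<close>. Then c = T' a, f = a - T c, and e
    is the displacement of b from the minimiser -g of the form. The proof is the identity |a|^2 -
    |T' a|^2 = |a - T c|^2 + (|c|^2 - |T c|^2) in the norm of \<open>G\<close>; the last bracket is
    twice the given form at (c, d), where d minimises the form over its second argument.\<close>
  define g where "g = mv m H (mv m Qh a)"
  define e where "e = (\<lambda>p. b p + g p)"
  define c where "c = (\<lambda>p. a p - g p)"
  define d where "d = (\<lambda>p. - mv m H (mv m Q c) p)"
  define f where "f = (\<lambda>p. g p - d p)"
  have G_F: "Re (ip m x (mv m F x)) = Re (ip m x (mv m G x)) / 2" for x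
    using kform_add_adjoint[of "{..<m}" F x] unfolding kform_eq_ip G_def[symmetric] by simp
  have G_sym: "ip m x (mv m G y) = ip m (mv m G x) y" for x y
    using ip_adjoint[of m G x y] unfolding G_def by (simp add: add.commute)
  have inv: "mv m G (mv m H x) p = x p" if "p < m" for x p
    using mv_inverse[of m G H] H that unfolding G_def by blast
  have Gg: "ip m x (mv m G g) = ip m x (mv m Qh a)" for x
    unfolding g_def by (rule ip_cong) (auto simp: inv)
  have Gd: "ip m x (mv m G d) = - ip m x (mv m Q c)" for x
    unfolding d_def mv_uminus ip_uminus by (intro arg_cong[of _ _ uminus] ip_cong) (auto simp: inv)
  have G_pos: "0 \<le> Re (ip m x (mv m G x))" for x
    using pos[of "\<lambda>_. 0" x] G_F[of x] by (simp add: pass_form_def ip_def mv_def)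
  have Q_adj: "ip m x (mv m Qh y) = ip m (mv m Q x) y" for x y
    using ip_adjoint[of m Qh x y] by (simp add: Qh_def)
  have sym: "Re (ip m x y) = Re (ip m y x)" for x y by (subst ip_commute) simp
  have e: "Re (ip m e (mv m G e)) = Re (ip m b (mv m G b)) + 2 * Re (ip m b (mv m Qh a)) + Re (ip m g (mv m Qh a))"
    unfolding e_def mv_add ip_add Gg using sym[of "mv m G g" b] Gg[of b] G_sym[of g b] by simp
  have f: "Re (ip m f (mv m G f)) = Re (ip m g (mv m Qh a)) - 2 * Re (ip m d (mv m Qh a)) - Re (ip m d (mv m Q c))"
    unfolding f_def mv_diff ip_diff Gg Gd using sym[of "mv m G d" g] Gd[of g] Gg[of d] G_sym[of d g] by simp
  have d1: "Re (ip m d (mv m Qh a)) = - Re (ip m g (mv m Q c))"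
    using G_sym[of d g] sym[of "mv m G d" g] Gg[of d] Gd[of g] by simp
  have V: "pass_form m Q F c d = Re (ip m c (mv m Q c)) + Re (ip m d (mv m Q c)) - Re (ip m d (mv m Q c)) / 2"
    unfolding pass_form_def plus_complex.sel G_F Gd by simp
  have ga: "Re (ip m g (mv m Qh a)) = Re (ip m a (mv m Q g))"
    unfolding Q_adj by (rule sym)
  have aa: "Re (ip m a (mv m Qh a)) = Re (ip m a (mv m Q a))"
    unfolding Q_adj by (rule sym)
  have cc: "Re (ip m c (mv m Q c)) + Re (ip m g (mv m Q c)) = Re (ip m a (mv m Q a)) - Re (ip m a (mv m Q g))"
    unfolding c_def mv_diff ip_diff by simp
  have "pass_form m Qh F a b = Re (ip m a (mv m Q a)) + Re (ip m b (mv m Qh a)) + Re (ip m b (mv m G b)) / 2"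
    unfolding pass_form_def plus_complex.sel G_F aa ..
  also have "\<dots> = Re (ip m e (mv m G e)) / 2 + Re (ip m f (mv m G f)) / 2 + pass_form m Q F c d"
    unfolding e f V using d1 cc ga by (simp add: field_simps)
  also have "\<dots> \<ge> 0" using G_pos pos by (intro add_nonneg_nonneg) auto
  finally show ?thesis unfolding Qh_def .
qed

text \<open>\<open>Vk\<close> is \<open>[Q 0; Q F]\<close>, the matrix of the dual problem;
  \<open>Uk\<close> below is \<open>[Q Q; 0 F]\<close>, the matrix of the synthesis constraint.
  Indices from m on refer to the second block.\<close>

definition Vk :: "nat \<Rightarrow> (nat \<Rightarrow> nat \<Rightarrow> complex) \<Rightarrow> (nat \<Rightarrow> nat \<Rightarrow> complex) \<Rightarrow> nat \<Rightarrow> nat \<Rightarrow> complex" where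
  "Vk m Q F p q = (if q < m then Q (if p < m then p else p - m) q
     else if p < m then 0 else F (p - m) (q - m))"

definition Uk :: "nat \<Rightarrow> (nat \<Rightarrow> nat \<Rightarrow> complex) \<Rightarrow> (nat \<Rightarrow> nat \<Rightarrow> complex) \<Rightarrow> nat \<Rightarrow> nat \<Rightarrow> complex" where
  "Uk m Q F p q = (if p < m then Q p (if q < m then q else q - m)
     else if q < m then 0 else F (p - m) (q - m))"

lemma sum_lessThan_double: "(\<Sum>p<2 * m. g p) = (\<Sum>p<m. g p) + (\<Sum>p<m. g (p + m :: nat))"
  for g :: "nat \<Rightarrow> complex"
proof -
  have "(\<Sum>p<m + m. g p) = (\<Sum>p<m. g p) + (\<Sum>p<m. g (p + m))"
    by (simp add: lessThan_atLeast0 sum.atLeastLessThan_concat[of 0 m "m + m" g, symmetric]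
        sum.shift_bounds_nat_ivl[of g 0 m m, simplified])
  then show ?thesis by (simp add: mult_2)
qed

lemma kform_Vk: "Re (kform {..<2 * m} (Vk m Q F) x) = pass_form m Q F x (\<lambda>p. x (p + m))"
  unfolding kform_def sum_lessThan_double pass_form_def ip_def mv_def
  by (simp add: Vk_def sum.distrib sum_distrib_left mult.assoc)

text \<open>Inside a real part each term in \<open>Q\<close> may be conjugated, which moves
  \<open>Q\<close> to the other argument as its adjoint.\<close>

lemma kform_Uk: "Re (kform {..<2 * m} (Uk m Q F) x) = pass_form m (\<lambda>p q. cnj (Q q p)) F x (\<lambda>p. x (p + m))"
proof -
  have "kform {..<2 * m} (Uk m Q F) x = ip m x (mv m Q x) + ip m x (mv m Q (\<lambda>p. x (p + m)))
      + ip m (\<lambda>p. x (p + m)) (mv m F (\<lambda>p. x (p + m)))"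
    unfolding kform_def sum_lessThan_double ip_def mv_def
    by (simp add: Uk_def sum.distrib sum_distrib_left mult.assoc)
  moreover have "Re (ip m y (mv m Q x)) = Re (ip m x (mv m (\<lambda>p q. cnj (Q q p)) y))" for x y
    using ip_adjoint[of m Q y x] ip_commute[of m x "mv m (\<lambda>p q. cnj (Q q p)) y"] by simp
  ultimately show ?thesis by (simp add: pass_form_def)
qed

lemma pass_form_nonneg_iff_Vk:
  "(\<forall>x. 0 \<le> Re (kform {..<2 * m} (Vk m Q F) x)) \<longleftrightarrow> (\<forall>a b. 0 \<le> pass_form m Q F a b)"
proof (intro iffI allI)
  fix a b :: "nat \<Rightarrow> complex" assume *: "\<forall>x. 0 \<le> Re (kform {..<2 * m} (Vk m Q F) x)"
  define x where "x = (\<lambda>p. if p < m then a p else b (p - m))"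
  have "pass_form m Q F x (\<lambda>p. x (p + m)) = pass_form m Q F a b"
    by (simp add: pass_form_def x_def ip_def mv_def)
  then show "0 \<le> pass_form m Q F a b" using * kform_Vk by metis
qed (simp add: kform_Vk)

lemma pass_form_nonneg_iff_Uk:
  "(\<forall>x. 0 \<le> Re (kform {..<2 * m} (Uk m Q F) x)) \<longleftrightarrow> (\<forall>a b. 0 \<le> pass_form m (\<lambda>p q. cnj (Q q p)) F a b)"
proof (intro iffI allI)
  fix a b :: "nat \<Rightarrow> complex" assume *: "\<forall>x. 0 \<le> Re (kform {..<2 * m} (Uk m Q F) x)"
  define x where "x = (\<lambda>p. if p < m then a p else b (p - m))"
  have "pass_form m (\<lambda>p q. cnj (Q q p)) F x (\<lambda>p. x (p + m)) = pass_form m (\<lambda>p q. cnj (Q q p)) F a b"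
    by (simp add: pass_form_def x_def ip_def mv_def)
  then show "0 \<le> pass_form m (\<lambda>p q. cnj (Q q p)) F a b" using * kform_Uk by metis
qed (simp add: kform_Uk)

text \<open>Taking adjoints is an involution, so the implication of \<open>pass_form_adjoint\<close>
  gives both directions.\<close>

lemma Uk_nonneg_iff_Vk_nonneg:
  assumes H: "\<And>p q. p < m \<Longrightarrow> q < m \<Longrightarrow> (\<Sum>k<m. (F p k + cnj (F k p)) * H k q) = (if p = q then 1 else 0)"
  shows "(\<forall>x. 0 \<le> Re (kform {..<2 * m} (Uk m Q F) x)) \<longleftrightarrow> (\<forall>x. 0 \<le> Re (kform {..<2 * m} (Vk m Q F) x))"
  unfolding pass_form_nonneg_iff_Uk pass_form_nonneg_iff_Vk
  using pass_form_adjoint[OF H, of Q] pass_form_adjoint[OF H, of "\<lambda>p q. cnj (Q q p)"] by auto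


section \<open>The matrix inequality and its multipliers\<close>

text \<open>Side by side, \<Phi> and \<Gamma> form one matrix [0 I] that shifts by a block: its
  column \<alpha> has its only one in row \<open>\<alpha> - M\<close>. Each of the four products in
  the matrix inequality is therefore a piece of \<open>S\<close> moved down and to the right by one
  block.\<close>

lemma index_adjoint_shift_mult:
  fixes A S B :: "complex mat"
  assumes dims: "A \<in> carrier_mat N r" "S \<in> carrier_mat N N" "B \<in> carrier_mat N c"
    and ab: "a < r" "b < c" "\<alpha> < N + M" "\<beta> < N + M"
    and A: "\<And>i. i < N \<Longrightarrow> A $$ (i, a) = (if \<alpha> = i + M then 1 else 0)"
    and B: "\<And>i. i < N \<Longrightarrow> B $$ (i, b) = (if \<beta> = i + M then 1 else 0)"
  shows "(mat_adjoint A * S * B) $$ (a, b) = (if M \<le> \<alpha> \<and> M \<le> \<beta> then S $$ (\<alpha> - M, \<beta> - M) else 0)"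
proof -
  have AS: "(mat_adjoint A * S) $$ (a, k) = (if M \<le> \<alpha> then S $$ (\<alpha> - M, k) else 0)" if "k < N" for k
  proof -
    have "(mat_adjoint A * S) $$ (a, k) = (\<Sum>i<N. cnj (A $$ (i, a)) * S $$ (i, k))"
      using dims ab that by (simp add: scalar_prod_def lessThan_atLeast0)
    also have "\<dots> = (\<Sum>i<N. if i = \<alpha> - M then (if M \<le> \<alpha> then S $$ (i, k) else 0) else 0)"
      by (intro sum.cong refl) (use ab in \<open>auto simp: A\<close>)
    also have "\<dots> = (if M \<le> \<alpha> then S $$ (\<alpha> - M, k) else 0)" using ab by (auto simp: sum.delta)
    finally show ?thesis .
  qed
  have "(mat_adjoint A * S * B) $$ (a, b) = (\<Sum>k<N. (mat_adjoint A * S) $$ (a, k) * B $$ (k, b))"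
    using dims ab by (simp add: scalar_prod_def lessThan_atLeast0)
  also have "\<dots> = (\<Sum>k<N. if k = \<beta> - M then (if M \<le> \<alpha> \<and> M \<le> \<beta> then S $$ (\<alpha> - M, k) else 0) else 0)"
    by (intro sum.cong refl) (use ab in \<open>auto simp: AS B\<close>)
  also have "\<dots> = (if M \<le> \<alpha> \<and> M \<le> \<beta> then S $$ (\<alpha> - M, \<beta> - M) else 0)" using ab by (auto simp: sum.delta)
  finally show ?thesis .
qed

lemma op6_Phi_carrier: "0 < n \<Longrightarrow> op6_Phi M n \<in> carrier_mat (n * M) (n * M)"
proof -
  assume "0 < n"
  then obtain k where "n = Suc k" by (cases n) auto
  then show ?thesis by (auto simp: op6_Phi_def)
qed

lemma op6_Phi_index:
  assumes "0 < n" "i < n * M" "j < n * M"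
  shows "op6_Phi M n $$ (i, j) = (if j = i + M then 1 else 0)"
proof -
  obtain k where "n = Suc k" using assms by (cases n) auto
  then show ?thesis using assms by (auto simp: op6_Phi_def index_mat_four_block)
qed

lemma op6_Gamma_carrier: "0 < n \<Longrightarrow> op6_Gamma M n \<in> carrier_mat (n * M) M"
proof -
  assume "0 < n"
  then obtain k where "n = Suc k" by (cases n) auto
  then show ?thesis by (auto simp: op6_Gamma_def append_rows_def)
qed

lemma op6_Gamma_index:
  assumes "0 < n" "i < n * M" "j < M"
  shows "op6_Gamma M n $$ (i, j) = (if n * M + j = i + M then 1 else 0)"
proof -
  obtain k where "n = Suc k" using assms by (cases n) auto
  then show ?thesis using assms by (auto simp: op6_Gamma_def append_rows_def index_mat_four_block)
qed

text \<open>The last block row and column of the matrix inequality, the only place where the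
  multipliers enter.\<close>

definition lmi_last :: "nat \<Rightarrow> nat \<Rightarrow> complex mat \<Rightarrow> complex mat \<Rightarrow> nat \<Rightarrow> nat \<Rightarrow> complex" where
  "lmi_last M n X23 X33 a b = (if a < n * M then (if b < n * M then 0 else X23 $$ (a, b - n * M))
     else if b < n * M then cnj (X23 $$ (b, a - n * M)) else X33 $$ (a - n * M, b - n * M))"

lemma op6_lmi_carrier:
  assumes "0 < n" "X23 \<in> carrier_mat (n * M) M" "X33 \<in> carrier_mat M M" "S \<in> carrier_mat (n * M) (n * M)"
  shows "op6_lmi M n X23 X33 S \<in> carrier_mat (n * M + M) (n * M + M)"
  using op6_Phi_carrier[OF assms(1), of M] op6_Gamma_carrier[OF assms(1), of M] assms
  unfolding op6_lmi_def Let_def by (intro four_block_carrier_mat) auto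

text \<open>The four blocks read as one matrix: \<open>S\<close> shifted by one block, minus
  \<open>S\<close> padded with a zero block row and column, minus the border of multipliers.\<close>

lemma op6_lmi_index:
  assumes n: "0 < n" and X: "X23 \<in> carrier_mat (n * M) M" "X33 \<in> carrier_mat M M" "S \<in> carrier_mat (n * M) (n * M)"
    and ab: "a < n * M + M" "b < n * M + M"
  shows "op6_lmi M n X23 X33 S $$ (a, b) = (if M \<le> a \<and> M \<le> b then S $$ (a - M, b - M) else 0)
    - (if a < n * M \<and> b < n * M then S $$ (a, b) else 0) - lmi_last M n X23 X33 a b"
proof -
  note P = op6_Phi_carrier[OF n, of M] and G = op6_Gamma_carrier[OF n, of M]
  have dimP: "dim_row (op6_Phi M n) = n * M" "dim_col (op6_Phi M n) = n * M" using P by auto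
  have dimG: "dim_row (op6_Gamma M n) = n * M" "dim_col (op6_Gamma M n) = M" using G by auto
  have dimX: "dim_row X23 = n * M" "dim_col X23 = M" "dim_row X33 = M" "dim_col X33 = M"
    "dim_row S = n * M" "dim_col S = n * M" using X by auto
  have PP: "(mat_adjoint (op6_Phi M n) * S * op6_Phi M n) $$ (a, b) = (if M \<le> a \<and> M \<le> b then S $$ (a - M, b - M) else 0)"
    if "a < n * M" "b < n * M" for a b
    by (rule index_adjoint_shift_mult[OF P X(3) P]) (use that op6_Phi_index[OF n] in auto)
  have PG: "(mat_adjoint (op6_Phi M n) * S * op6_Gamma M n) $$ (a, b) = (if M \<le> a \<and> M \<le> n * M + b then S $$ (a - M, n * M + b - M) else 0)"
    if "a < n * M" "b < M" for a b
    by (rule index_adjoint_shift_mult[OF P X(3) G]) (use that op6_Phi_index[OF n] op6_Gamma_index[OF n] in auto)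
  have GP: "(mat_adjoint (op6_Gamma M n) * S * op6_Phi M n) $$ (a, b) = (if M \<le> n * M + a \<and> M \<le> b then S $$ (n * M + a - M, b - M) else 0)"
    if "a < M" "b < n * M" for a b
    by (rule index_adjoint_shift_mult[OF G X(3) P]) (use that op6_Phi_index[OF n] op6_Gamma_index[OF n] in auto)
  have GG: "(mat_adjoint (op6_Gamma M n) * S * op6_Gamma M n) $$ (a, b) = (if M \<le> n * M + a \<and> M \<le> n * M + b then S $$ (n * M + a - M, n * M + b - M) else 0)"
    if "a < M" "b < M" for a b
    by (rule index_adjoint_shift_mult[OF G X(3) G]) (use that op6_Gamma_index[OF n] in auto)
  consider "a < n * M" "b < n * M" | "a < n * M" "n * M \<le> b" | "n * M \<le> a" "b < n * M" | "n * M \<le> a" "n * M \<le> b"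
    by linarith
  then show ?thesis
  proof cases
    case 1
    then show ?thesis unfolding op6_lmi_def Let_def lmi_last_def
      using PP[of a b] by (simp add: index_mat_four_block dimP dimG dimX)
  next
    case 2
    then have "b - n * M < M" using ab by auto
    with 2 show ?thesis unfolding op6_lmi_def Let_def lmi_last_def
      using PG[of a "b - n * M"] ab by (simp add: index_mat_four_block dimP dimG dimX)
  next
    case 3
    then have "a - n * M < M" using ab by auto
    with 3 show ?thesis unfolding op6_lmi_def Let_def lmi_last_def
      using GP[of "a - n * M" b] ab by (simp add: index_mat_four_block dimP dimG dimX)
  next
    case 4
    then have "a - n * M < M" "b - n * M < M" using ab by auto
    with 4 show ?thesis unfolding op6_lmi_def Let_def lmi_last_def
      using GG[of "a - n * M" "b - n * M"] ab by (simp add: index_mat_four_block dimP dimG dimX)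
  qed
qed

section \<open>Block diagonals and the elimination of the slack matrix\<close>

definition flat :: "nat \<Rightarrow> nat \<times> nat \<Rightarrow> nat" where
  "flat M a = fst a * M + snd a"

lemma flat_less: "a \<in> idx n M \<Longrightarrow> flat M a < n * M + M"
proof -
  assume "a \<in> idx n M"
  then have "fst a * M \<le> n * M" "snd a < M" by (auto simp: idx_def intro: mult_right_mono)
  then show ?thesis unfolding flat_def by linarith
qed

lemma flat_less_iff: "p < (M :: nat) \<Longrightarrow> i * M + p < n * M \<longleftrightarrow> i < n"
proof
  assume "p < M" "i < n"
  then have "Suc i * M \<le> n * M" by (intro mult_right_mono) auto
  then show "i * M + p < n * M" using \<open>p < M\<close> by simp
next
  assume "i * M + p < n * M"
  then have "i * M < n * M" by linarith
  then show "i < n" by simp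
qed

lemma bij_betw_flat: "bij_betw (flat M) (idx n M) {..<n * M + M}"
  unfolding bij_betw_def
proof
  show "inj_on (flat M) (idx n M)"
  proof (rule inj_onI)
    fix a b assume ab: "a \<in> idx n M" "b \<in> idx n M" "flat M a = flat M b"
    then have s: "snd a < M" "snd b < M" by (auto simp: idx_def)
    have "flat M a div M = fst a" "flat M a mod M = snd a" "flat M b div M = fst b" "flat M b mod M = snd b"
      using s by (auto simp: flat_def)
    then show "a = b" using ab(3) by (metis prod.expand)
  qed
  show "flat M ` idx n M = {..<n * M + M}"
  proof
    show "flat M ` idx n M \<subseteq> {..<n * M + M}" using flat_less by auto
    show "{..<n * M + M} \<subseteq> flat M ` idx n M"
    proof
      fix c assume c: "c \<in> {..<n * M + M}"
      then have "c < Suc n * M" by simp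
      moreover then have "0 < M" by (cases M) auto
      ultimately have "c div M < Suc n" "c mod M < M" by (auto simp: less_mult_imp_div_less)
      then have "(c div M, c mod M) \<in> idx n M" by (auto simp: idx_def)
      moreover have "flat M (c div M, c mod M) = c" by (simp add: flat_def)
      ultimately show "c \<in> flat M ` idx n M" by (metis imageI)
    qed
  qed
qed

lemma kpsd_reindex:
  assumes "bij_betw h I J"
  shows "kpsd I (\<lambda>a b. K (h a) (h b)) \<longleftrightarrow> kpsd J K"
proof -
  have im: "J = h ` I" and inj: "inj_on h I" using assms by (auto simp: bij_betw_def)
  have form: "kform J K x = kform I (\<lambda>a b. K (h a) (h b)) (x \<circ> h)" for x
    unfolding kform_def im by (simp add: sum.reindex[OF inj] o_def)
  have form': "kform I (\<lambda>a b. K (h a) (h b)) x = kform J K (x \<circ> inv_into I h)" for x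
    unfolding form by (intro kform_cong) (use inj in auto)
  show ?thesis
  proof
    assume *: "kpsd I (\<lambda>a b. K (h a) (h b))"
    show "kpsd J K"
    proof (rule kpsdI)
      fix a b assume "a \<in> J" "b \<in> J"
      then show "K b a = cnj (K a b)" using kpsd_hermitian[OF *] unfolding im by blast
    qed (use kpsd_form_nonneg[OF *] form in simp)
  next
    assume *: "kpsd J K"
    show "kpsd I (\<lambda>a b. K (h a) (h b))"
    proof (rule kpsdI)
      fix a b assume "a \<in> I" "b \<in> I"
      then show "K (h b) (h a) = cnj (K (h a) (h b))" using kpsd_hermitian[OF *] unfolding im by blast
    qed (use kpsd_form_nonneg[OF *] form' in simp)
  qed
qed

text \<open>The sum of the blocks of \<open>Z\<close> on the k-th block diagonal above the main one.
  It is the adjoint of the map from coefficient sequences to block Toeplitz matrices, as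
  \<open>trace_Xi_eq_inner\<close> makes precise.\<close>

definition diag_sum :: "nat \<Rightarrow> (nat \<times> nat \<Rightarrow> nat \<times> nat \<Rightarrow> complex) \<Rightarrow> nat \<Rightarrow> nat \<Rightarrow> nat \<Rightarrow> complex" where
  "diag_sum n Z k p q = (\<Sum>j\<le>n - k. Z (j, p) (j + k, q))"

text \<open>\<open>Z\<close> is the negated matrix of the inequality. Along a block diagonal
  \<open>S\<close> occurs as differences of consecutive blocks and telescopes away, which leaves the
  single multiplier block at the border.\<close>

lemma op6_feasible_imp_kernel:
  assumes n: "0 < n" and feas: "(X23, X33, S) \<in> op6_feasible M n"
  shows "\<exists>Z. kpsd (idx n M) Z \<and>
    (\<forall>k\<le>n. \<forall>p<M. \<forall>q<M. Xi_block M n X23 X33 k $$ (p, q) = diag_sum n Z k p q)"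
proof -
  have X: "X23 \<in> carrier_mat (n * M) M" "X33 \<in> carrier_mat M M" "S \<in> carrier_mat (n * M) (n * M)"
    using feas unfolding op6_feasible_def mem_Collect_eq prod.case by blast+
  have le: "op6_lmi M n X23 X33 S \<preceq>\<^sub>H 0\<^sub>m (n * M + M) (n * M + M)"
    using feas unfolding op6_feasible_def mem_Collect_eq prod.case by blast+
  define L where "L = op6_lmi M n X23 X33 S"
  have L: "L \<in> carrier_mat (n * M + M) (n * M + M)" unfolding L_def by (rule op6_lmi_carrier[OF n X])
  then have dL: "dim_row L = n * M + M" "dim_col L = n * M + M" by (rule carrier_matD)+
  define K where "K = (\<lambda>a b. - L $$ (a, b))"
  have "psd (0\<^sub>m (n * M + M) (n * M + M) - L)" using le unfolding herm_le_def L_def .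
  moreover have "0\<^sub>m (n * M + M) (n * M + M) - L \<in> carrier_mat (n * M + M) (n * M + M)" using L by auto
  ultimately have "kpsd {..<n * M + M} (\<lambda>i j. (0\<^sub>m (n * M + M) (n * M + M) - L) $$ (i, j))"
    using psd_iff_kpsd by blast
  then have "kpsd {..<n * M + M} K"
    using kpsd_cong[of "{..<n * M + M}" K "\<lambda>i j. (0\<^sub>m (n * M + M) (n * M + M) - L) $$ (i, j)"] dL
    by (simp add: K_def)
  then have "kpsd (idx n M) (\<lambda>a b. K (flat M a) (flat M b))"
    using kpsd_reindex[OF bij_betw_flat, of n M K] by simp
  moreover have "Xi_block M n X23 X33 k $$ (p, q) = diag_sum n (\<lambda>a b. K (flat M a) (flat M b)) k p q"
    if k: "k \<le> n" and pq: "p < M" "q < M" for k p q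
  proof -
    \<comment> \<open>The value 0 from \<open>n - k\<close> on encodes the padding of
      \<open>S\<close>, so that the telescoping sum ends in \<open>s (n - k) = 0\<close>.\<close>
    define s where "s = (\<lambda>j. if j < n - k then S $$ (j * M + p, (j + k) * M + q) else 0)"
    have Xi: "Xi_block M n X23 X33 k $$ (p, q) = lmi_last M n X23 X33 ((n - k) * M + p) (n * M + q)"
    proof (cases "k = 0")
      case False
      then have "(n - k) * M + p < n * M" using flat_less_iff[OF pq(1)] k n by simp
      then show ?thesis using False pq by (simp add: Xi_block_def lmi_last_def)
    qed (simp add: Xi_block_def lmi_last_def)
    have K: "K (j * M + p) ((j + k) * M + q) = s j - (if j = 0 then 0 else s (j - 1))
       + (if j = n - k then lmi_last M n X23 X33 ((n - k) * M + p) (n * M + q) else 0)" if j: "j \<le> n - k" for j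
    proof -
      have lt: "j * M + p < n * M + M" "(j + k) * M + q < n * M + M"
        using flat_less[of "(j, p)" n M] flat_less[of "(j + k, q)" n M] j k pq by (auto simp: flat_def idx_def)
      have shift: "(if M \<le> j * M + p \<and> M \<le> (j + k) * M + q then S $$ (j * M + p - M, (j + k) * M + q - M) else 0)
        = (if j = 0 then 0 else s (j - 1))"
      proof (cases j)
        case 0
        then show ?thesis using pq by simp
      next
        case (Suc l)
        then show ?thesis using j by (simp add: s_def)
      qed
      have top: "(if j * M + p < n * M \<and> (j + k) * M + q < n * M then S $$ (j * M + p, (j + k) * M + q) else 0) = s j"
        unfolding flat_less_iff[OF pq(1)] flat_less_iff[OF pq(2)] s_def using j k by auto
      have last: "lmi_last M n X23 X33 (j * M + p) ((j + k) * M + q)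
        = (if j = n - k then lmi_last M n X23 X33 ((n - k) * M + p) (n * M + q) else 0)"
      proof (cases "j = n - k")
        case False
        then have "j < n" "j + k < n" using j k by auto
        then show ?thesis using False flat_less_iff[OF pq(1), of j n] flat_less_iff[OF pq(2), of "j + k" n]
          by (simp add: lmi_last_def)
      qed (use k in simp)
      show ?thesis unfolding K_def L_def op6_lmi_index[OF n X lt] shift top last by simp
    qed
    have tel: "(\<Sum>j\<le>N. s j - (if j = 0 then 0 else s (j - 1))) = s N" for N
      by (induction N) auto
    have "diag_sum n (\<lambda>a b. K (flat M a) (flat M b)) k p q = (\<Sum>j\<le>n - k. s j - (if j = 0 then 0 else s (j - 1)))
       + (\<Sum>j\<le>n - k. if j = n - k then lmi_last M n X23 X33 ((n - k) * M + p) (n * M + q) else 0)"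
      unfolding diag_sum_def flat_def sum.distrib[symmetric] fst_conv snd_conv
      by (intro sum.cong refl K) simp
    also have "\<dots> = Xi_block M n X23 X33 k $$ (p, q)" unfolding tel Xi by (simp add: s_def)
    finally show ?thesis by simp
  qed
  ultimately show ?thesis by blast
qed

text \<open>The slack matrix \<open>\<Sigma>\<close> is recovered from the kernel by summing it along block diagonals.\<close>

lemma kernel_imp_op6_feasible:
  assumes n: "0 < n" and Z: "kpsd (idx n M) Z"
  shows "\<exists>X23 X33 S. (X23, X33, S) \<in> op6_feasible M n \<and>
    (\<forall>k\<le>n. \<forall>p<M. \<forall>q<M. Xi_block M n X23 X33 k $$ (p, q) = diag_sum n Z k p q)"
proof -
  \<comment> \<open>Partial sums of \<open>Z\<close> from block (i, j) up its diagonal to the first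
    block row or column. Their consecutive differences are the blocks of \<open>Z\<close>, and on
    reaching column n they equal the full diagonal sums.\<close>
  define s where "s = (\<lambda>i j p q. \<Sum>t\<le>min i j. Z (i - t, p) (j - t, q))"
  define X33 where "X33 = mat M M (\<lambda>(p, q). diag_sum n Z 0 p q)"
  \<comment> \<open>Block row i carries the multiplier of index n - i, because the blocks are
    stacked in decreasing order.\<close>
  define X23 where "X23 = mat (n * M) M (\<lambda>(a, q). diag_sum n Z (n - a div M) (a mod M) q)"
  define S where "S = mat (n * M) (n * M) (\<lambda>(a, b). s (a div M) (b div M) (a mod M) (b mod M))"
  have X: "X23 \<in> carrier_mat (n * M) M" "X33 \<in> carrier_mat M M" "S \<in> carrier_mat (n * M) (n * M)"
    by (auto simp: X23_def X33_def S_def)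
  have herm: "Z (j, q) (i, p) = cnj (Z (i, p) (j, q))" if "i \<le> n" "j \<le> n" "p < M" "q < M" for i j p q
    by (rule kpsd_hermitian[OF Z]) (use that in \<open>auto simp: idx_def\<close>)
  have X23_ix: "X23 $$ (i * M + p, q) = diag_sum n Z (n - i) p q" if "i < n" "p < M" "q < M" for i p q
    using that flat_less_iff[OF that(2), of i n] by (simp add: X23_def)
  have S_ix: "S $$ (i * M + p, j * M + q) = s i j p q" if "i < n" "j < n" "p < M" "q < M" for i j p q
    using that flat_less_iff[OF that(3), of i n] flat_less_iff[OF that(4), of j n] by (simp add: S_def)
  have s_Suc: "s (Suc i) (Suc j) p q = Z (Suc i, p) (Suc j, q) + s i j p q" for i j p q
    unfolding s_def by (simp add: sum.atMost_Suc_shift del: sum.atMost_Suc)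
  have s_0: "s 0 j p q = Z (0, p) (j, q)" "s i 0 p q = Z (i, p) (0, q)" for i j p q
    unfolding s_def by simp_all
  have s_last: "diag_sum n Z (n - i) p q = s i n p q" if "i \<le> n" for i p q
    unfolding diag_sum_def s_def using that
    by (intro sum.reindex_bij_witness[of _ "\<lambda>t. i - t" "\<lambda>t. i - t"]) (auto simp: algebra_simps)
  have s_herm: "s j i q p = cnj (s i j p q)" if "i \<le> n" "j \<le> n" "p < M" "q < M" for i j p q
    unfolding s_def cnj_sum
  proof (rule sum.cong)
    show "{..min j i} = {..min i j}" by (simp add: min.commute)
    show "Z (j - t, q) (i - t, p) = cnj (Z (i - t, p) (j - t, q))" for t
      by (rule herm) (use that in auto)
  qed
  have S_herm: "mat_adjoint S = S"
  proof (rule eq_matI)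
    fix a b assume ab: "a < dim_row S" "b < dim_col S"
    then have ab': "a < n * M" "b < n * M" using X(3) by auto
    moreover then have "0 < M" by (cases M) auto
    ultimately have "a div M < n" "b div M < n" "a mod M < M" "b mod M < M"
      by (auto simp: less_mult_imp_div_less)
    then have "s (b div M) (a div M) (b mod M) (a mod M) = cnj (s (a div M) (b div M) (a mod M) (b mod M))"
      by (intro s_herm) auto
    then show "mat_adjoint S $$ (a, b) = S $$ (a, b)" using ab' by (simp add: S_def)
  qed (simp_all add: S_def)
  have X33_herm: "mat_adjoint X33 = X33"
  proof (rule eq_matI)
    fix p q assume "p < dim_row X33" "q < dim_col X33"
    then have pq: "p < M" "q < M" by (auto simp: X33_def)
    have "diag_sum n Z 0 q p = cnj (diag_sum n Z 0 p q)"
      using s_last[of n q p] s_last[of n p q] s_herm[OF order_refl order_refl pq] by simp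
    then show "mat_adjoint X33 $$ (p, q) = X33 $$ (p, q)" using pq by (simp add: X33_def)
  qed (simp_all add: X33_def)
  have entry: "op6_lmi M n X23 X33 S $$ (flat M a, flat M b) = - Z a b" if ab: "a \<in> idx n M" "b \<in> idx n M" for a b
  proof -
    obtain i p j q where a: "a = (i, p)" and b: "b = (j, q)" by (cases a, cases b)
    then have ij: "i \<le> n" "j \<le> n" and pq: "p < M" "q < M" using ab by (auto simp: idx_def)
    have lt: "i * M + p < n * M + M" "j * M + q < n * M + M"
      using flat_less[OF ab(1)] flat_less[OF ab(2)] by (auto simp: flat_def a b)
    have shift: "(if M \<le> i * M + p \<and> M \<le> j * M + q then S $$ (i * M + p - M, j * M + q - M) else 0) = s i j p q - Z (i, p) (j, q)"
    proof (cases "i = 0 \<or> j = 0")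
      case True
      then show ?thesis using pq s_0 by auto
    next
      case False
      then obtain i' j' where "i = Suc i'" "j = Suc j'" by (cases i; cases j) auto
      then show ?thesis using S_ix[of i' j' p q] ij pq s_Suc[of i' j' p q] by simp
    qed
    have rest: "(if i * M + p < n * M \<and> j * M + q < n * M then S $$ (i * M + p, j * M + q) else 0)
        + lmi_last M n X23 X33 (i * M + p) (j * M + q) = s i j p q"
    proof -
      consider "i < n" "j < n" | "i < n" "j = n" | "i = n" "j < n" | "i = n" "j = n" using ij by linarith
      then show ?thesis
      proof cases
        case 1
        then show ?thesis unfolding lmi_last_def flat_less_iff[OF pq(1)] flat_less_iff[OF pq(2)]
          using S_ix pq by simp
      next
        case 2
        then show ?thesis unfolding lmi_last_def flat_less_iff[OF pq(1)] flat_less_iff[OF pq(2)]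
          using X23_ix[of i p q] s_last[of i p q] pq by simp
      next
        case 3
        then show ?thesis unfolding lmi_last_def flat_less_iff[OF pq(1)] flat_less_iff[OF pq(2)]
          using X23_ix[of j q p] s_last[of j q p] s_herm[of j n q p] pq by simp
      next
        case 4
        then show ?thesis unfolding lmi_last_def flat_less_iff[OF pq(1)] flat_less_iff[OF pq(2)]
          using s_last[of n p q] pq by (simp add: X33_def)
      qed
    qed
    show ?thesis unfolding flat_def a b fst_conv snd_conv op6_lmi_index[OF n X lt] shift
      using rest by (simp add: algebra_simps)
  qed
  define L where "L = op6_lmi M n X23 X33 S"
  have L: "L \<in> carrier_mat (n * M + M) (n * M + M)" unfolding L_def by (rule op6_lmi_carrier[OF n X])
  then have dL: "dim_row L = n * M + M" "dim_col L = n * M + M" by (rule carrier_matD)+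
  have "kpsd (idx n M) (\<lambda>a b. - L $$ (flat M a, flat M b))"
    using Z kpsd_cong[of "idx n M" Z "\<lambda>a b. - L $$ (flat M a, flat M b)"] entry unfolding L_def by simp
  then have "kpsd {..<n * M + M} (\<lambda>a b. - L $$ (a, b))"
    using kpsd_reindex[OF bij_betw_flat, of n M "\<lambda>a b. - L $$ (a, b)"] by simp
  then have "kpsd {..<n * M + M} (\<lambda>i j. (0\<^sub>m (n * M + M) (n * M + M) - L) $$ (i, j))"
    using kpsd_cong[of "{..<n * M + M}" "\<lambda>a b. - L $$ (a, b)" "\<lambda>i j. (0\<^sub>m (n * M + M) (n * M + M) - L) $$ (i, j)"] dL
    by simp
  moreover have "0\<^sub>m (n * M + M) (n * M + M) - L \<in> carrier_mat (n * M + M) (n * M + M)" using L by auto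
  ultimately have "psd (0\<^sub>m (n * M + M) (n * M + M) - L)" using psd_iff_kpsd by blast
  then have "(X23, X33, S) \<in> op6_feasible M n"
    using X S_herm X33_herm by (simp add: op6_feasible_def herm_le_def L_def)
  moreover have "Xi_block M n X23 X33 k $$ (p, q) = diag_sum n Z k p q" if "k \<le> n" "p < M" "q < M" for k p q
    using that n X23_ix[of "n - k" p q] by (cases "k = 0") (auto simp: Xi_block_def X33_def)
  ultimately show ?thesis by blast
qed

section \<open>The trace pairing as an inner product of kernels\<close>

lemma sum_triangle:
  fixes g :: "nat \<Rightarrow> nat \<Rightarrow> complex"
  shows "(\<Sum>k\<le>n. \<Sum>j\<le>n - k. g k j) = (\<Sum>i\<le>n. \<Sum>j\<le>i. g (i - j) j)"
proof -
  have "(\<Sum>k\<le>n. \<Sum>j\<le>n - k. g k j) = (\<Sum>(k, j)\<in>(SIGMA k:{..n}. {..n - k}). g k j)"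
    by (rule sum.Sigma) auto
  also have "\<dots> = (\<Sum>(i, j)\<in>(SIGMA i:{..n}. {..i}). g (i - j) j)"
    by (rule sum.reindex_bij_witness[of _ "\<lambda>(i, j). (i - j, j)" "\<lambda>(k, j). (k + j, j)"]) auto
  also have "\<dots> = (\<Sum>i\<le>n. \<Sum>j\<le>i. g (i - j) j)"
    by (rule sum.Sigma[symmetric]) auto
  finally show ?thesis .
qed

text \<open>The inner product of \<open>Z\<close> with a Toeplitz matrix collects \<open>Z\<close>
  along block diagonals. Hermitian symmetry of \<open>Z\<close> replaces \<open>Z b a\<close> by the
  conjugate of \<open>Z a b\<close>.\<close>

lemma trace_Xi_eq_inner:
  assumes Z: "kpsd (idx n M) Z"
    and V: "\<And>k. k \<le> n \<Longrightarrow> V k \<in> carrier_mat M M" "\<And>k. k \<le> n \<Longrightarrow> X k \<in> carrier_mat M M"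
    and X: "\<And>k p q. k \<le> n \<Longrightarrow> p < M \<Longrightarrow> q < M \<Longrightarrow> X k $$ (p, q) = diag_sum n Z k p q"
    and v: "\<And>k p q. k \<le> n \<Longrightarrow> p < M \<Longrightarrow> q < M \<Longrightarrow> V k $$ (p, q) = v k p q"
  shows "(\<Sum>k\<le>n. mat_trace (V k * X k)) = (\<Sum>a\<in>idx n M. \<Sum>b\<in>idx n M. cnj (Z a b) * toep v a b)"
proof -
  have "(\<Sum>k\<le>n. mat_trace (V k * X k)) = (\<Sum>k\<le>n. \<Sum>p<M. \<Sum>q<M. \<Sum>j\<le>n - k. v k p q * Z (j, q) (j + k, p))"
  proof (intro sum.cong refl)
    fix k assume "k \<in> {..n}"
    then have k: "k \<le> n" by simp
    have d: "dim_row (V k) = M" "dim_col (V k) = M" "dim_row (X k) = M" "dim_col (X k) = M"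
      using V[OF k] by auto
    have "mat_trace (V k * X k) = (\<Sum>p<M. \<Sum>q<M. V k $$ (p, q) * X k $$ (q, p))"
      unfolding mat_trace_def using d by (simp add: scalar_prod_def lessThan_atLeast0)
    then show "mat_trace (V k * X k) = (\<Sum>p<M. \<Sum>q<M. \<Sum>j\<le>n - k. v k p q * Z (j, q) (j + k, p))"
      using k by (simp add: X v diag_sum_def sum_distrib_left)
  qed
  also have "\<dots> = (\<Sum>p<M. \<Sum>k\<le>n. \<Sum>q<M. \<Sum>j\<le>n - k. v k p q * Z (j, q) (j + k, p))"
    by (rule sum.swap)
  also have "\<dots> = (\<Sum>p<M. \<Sum>q<M. \<Sum>k\<le>n. \<Sum>j\<le>n - k. v k p q * Z (j, q) (j + k, p))"
    by (intro sum.cong refl sum.swap)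
  also have "\<dots> = (\<Sum>p<M. \<Sum>q<M. \<Sum>i\<le>n. \<Sum>j\<le>i. v (i - j) p q * Z (j, q) (i, p))"
    unfolding sum_triangle by simp
  also have "\<dots> = (\<Sum>p<M. \<Sum>q<M. \<Sum>i\<le>n. \<Sum>j\<le>n. cnj (Z (i, p) (j, q)) * toep v (i, p) (j, q))"
  proof (rule sum.cong[OF refl], rule sum.cong[OF refl], rule sum.cong[OF refl])
    fix p q i assume *: "p \<in> {..<M}" "q \<in> {..<M}" "i \<in> {..n}"
    have "(\<Sum>j\<le>i. v (i - j) p q * Z (j, q) (i, p)) = (\<Sum>j\<le>i. cnj (Z (i, p) (j, q)) * toep v (i, p) (j, q))"
    proof (rule sum.cong[OF refl])
      fix j assume "j \<in> {..i}"
      then show "v (i - j) p q * Z (j, q) (i, p) = cnj (Z (i, p) (j, q)) * toep v (i, p) (j, q)"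
        using * kpsd_hermitian[OF Z, of "(i, p)" "(j, q)"] by (simp add: idx_def toep_def)
    qed
    also have "\<dots> = (\<Sum>j\<le>n. cnj (Z (i, p) (j, q)) * toep v (i, p) (j, q))"
      by (rule sum.mono_neutral_left) (use * in \<open>auto simp: toep_def\<close>)
    finally show "(\<Sum>j\<le>i. v (i - j) p q * Z (j, q) (i, p)) = (\<Sum>j\<le>n. cnj (Z (i, p) (j, q)) * toep v (i, p) (j, q))" .
  qed
  also have "\<dots> = (\<Sum>p<M. \<Sum>i\<le>n. \<Sum>q<M. \<Sum>j\<le>n. cnj (Z (i, p) (j, q)) * toep v (i, p) (j, q))"
    by (intro sum.cong refl sum.swap)
  also have "\<dots> = (\<Sum>i\<le>n. \<Sum>p<M. \<Sum>q<M. \<Sum>j\<le>n. cnj (Z (i, p) (j, q)) * toep v (i, p) (j, q))"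
    by (rule sum.swap)
  also have "\<dots> = (\<Sum>i\<le>n. \<Sum>p<M. \<Sum>j\<le>n. \<Sum>q<M. cnj (Z (i, p) (j, q)) * toep v (i, p) (j, q))"
    by (intro sum.cong refl sum.swap)
  also have "\<dots> = (\<Sum>a\<in>idx n M. \<Sum>b\<in>idx n M. cnj (Z a b) * toep v a b)"
    unfolding idx_def sum.cartesian_product' by simp
  finally show ?thesis .
qed

text \<open>For Hermitian \<open>Z\<close> the pairing with the adjoint of \<open>T\<close> is the
  conjugate of the pairing with \<open>T\<close>. This accounts for the factor 2 in the dual
  function.\<close>

lemma inner_add_adjoint:
  assumes "kpsd I Z"
  shows "Re (\<Sum>a\<in>I. \<Sum>b\<in>I. cnj (Z a b) * (T a b + cnj (T b a))) = 2 * Re (\<Sum>a\<in>I. \<Sum>b\<in>I. cnj (Z a b) * T a b)"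
proof -
  have "(\<Sum>a\<in>I. \<Sum>b\<in>I. cnj (Z a b) * cnj (T b a)) = (\<Sum>b\<in>I. \<Sum>a\<in>I. cnj (Z a b) * cnj (T b a))"
    by (rule sum.swap)
  also have "\<dots> = (\<Sum>b\<in>I. \<Sum>a\<in>I. cnj (cnj (Z b a) * T b a))"
  proof (intro sum.cong refl)
    fix a b assume "b \<in> I" "a \<in> I"
    then show "cnj (Z a b) * cnj (T b a) = cnj (cnj (Z b a) * T b a)"
      using kpsd_hermitian[OF assms, of a b] by simp
  qed
  also have "\<dots> = cnj (\<Sum>a\<in>I. \<Sum>b\<in>I. cnj (Z a b) * T a b)" unfolding cnj_sum ..
  finally show ?thesis by (simp add: algebra_simps sum.distrib)
qed


lemma sums_partial_le:
  fixes f :: "nat \<Rightarrow> real"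
  assumes "f sums s" "\<And>k. 0 \<le> f k"
  shows "(\<Sum>k\<le>n. f k) \<le> s"
  using assms sum_le_suminf[of f "{..n}"] by (simp add: sums_iff)

section \<open>The squared \<open>\<H>\<^sub>2\<close> norm through the coefficients\<close>

lemma mat_trace_integrand:
  assumes "S q \<in> carrier_mat nr nc"
  shows "(let M = S q in Re (mat_trace (mat_adjoint M * M))) = (\<Sum>i<nr. \<Sum>j<nc. (cmod (S q $$ (i, j)))\<^sup>2)"
  using trace_adjoint_mult[OF assms] by (simp add: Let_def)

lemma exp_Complex: "exp (Complex \<beta> \<Omega>) = of_real (exp \<beta>) * cis \<Omega>"
  by (simp add: exp_eq_polar)

lemma h2_integral:
  assumes mk: "\<And>i j. i < nr \<Longrightarrow> j < nc \<Longrightarrow> has_markov (c i j) (\<lambda>q. S q $$ (i, j))"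
    and car: "\<And>q. q \<in> outer_disc \<Longrightarrow> S q \<in> carrier_mat nr nc" and "0 < \<beta>"
  shows "(\<lambda>k. \<Sum>i<nr. \<Sum>j<nc. (cmod (c i j k))\<^sup>2 / (exp \<beta> ^ k)\<^sup>2) sums (1 / (2 * pi) *
     integral {-pi..pi} (\<lambda>\<Omega>. let M = S (exp (Complex \<beta> \<Omega>)) in Re (mat_trace (mat_adjoint M * M))))"
proof -
  have \<rho>: "1 < exp \<beta>" using assms(3) by simp
  let ?f = "\<lambda>i j \<Omega>. (cmod (S (of_real (exp \<beta>) * cis \<Omega>) $$ (i, j)))\<^sup>2"
  have "integral {-pi..pi} (\<lambda>\<Omega>. let M = S (exp (Complex \<beta> \<Omega>)) in Re (mat_trace (mat_adjoint M * M)))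
    = integral {-pi..pi} (\<lambda>\<Omega>. \<Sum>i<nr. \<Sum>j<nc. ?f i j \<Omega>)"
    unfolding exp_Complex using mat_trace_integrand[of S _ nr nc, OF car[OF outer_disc_cis[OF \<rho>]]] by presburger
  also have "\<dots> = (\<Sum>i<nr. \<Sum>j<nc. integral {-pi..pi} (?f i j))"
    using has_markov_parseval(2)[OF mk \<rho>]
    by (subst integral_sum, simp, intro integrable_sum, auto intro!: sum.cong integral_sum)
  finally have e: "integral {-pi..pi} (\<lambda>\<Omega>. let M = S (exp (Complex \<beta> \<Omega>)) in Re (mat_trace (mat_adjoint M * M)))
    = (\<Sum>i<nr. \<Sum>j<nc. integral {-pi..pi} (?f i j))" .
  have eq: "1 / (2 * pi) * integral {-pi..pi} (\<lambda>\<Omega>. let M = S (exp (Complex \<beta> \<Omega>)) in Re (mat_trace (mat_adjoint M * M)))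
    = (\<Sum>i<nr. \<Sum>j<nc. 1 / (2 * pi) * integral {-pi..pi} (?f i j))"
    by (simp only: e sum_distrib_left)
  show ?thesis unfolding eq
    by (intro sums_sum has_markov_parseval(1)[OF mk \<rho>]) auto
qed

lemma h2_norm_sq_le:
  assumes mk: "\<And>i j. i < nr \<Longrightarrow> j < nc \<Longrightarrow> has_markov (c i j) (\<lambda>q. S q $$ (i, j))"
    and car: "\<And>q. q \<in> outer_disc \<Longrightarrow> S q \<in> carrier_mat nr nc"
    and bd: "\<And>n. (\<Sum>k\<le>n. \<Sum>i<nr. \<Sum>j<nc. (cmod (c i j k))\<^sup>2) \<le> B"
  shows "h2_norm_sq S \<le> ereal B"
  unfolding h2_norm_sq_def
proof (rule SUP_least)
  fix \<beta> :: real assume "\<beta> \<in> {0<..}"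
  then have \<beta>: "0 < \<beta>" by simp
  let ?g = "\<lambda>k. \<Sum>i<nr. \<Sum>j<nc. (cmod (c i j k))\<^sup>2 / (exp \<beta> ^ k)\<^sup>2"
  have "(\<Sum>k\<le>n. ?g k) \<le> B" for n
  proof -
    have "(cmod (c i j k))\<^sup>2 / (exp \<beta> ^ k)\<^sup>2 \<le> (cmod (c i j k))\<^sup>2" for i j k
    proof -
      have "1 \<le> (exp \<beta> ^ k)\<^sup>2" using \<beta> by (simp add: one_le_power)
      then show ?thesis by (simp add: divide_le_eq mult_le_cancel_left1)
    qed
    then have "(\<Sum>k\<le>n. ?g k) \<le> (\<Sum>k\<le>n. \<Sum>i<nr. \<Sum>j<nc. (cmod (c i j k))\<^sup>2)" by (intro sum_mono)
    then show ?thesis using bd[of n] by linarith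
  qed
  moreover have lim: "(\<lambda>n. \<Sum>k\<le>n. ?g k) \<longlonglongrightarrow> 1 / (2 * pi) *
     integral {-pi..pi} (\<lambda>\<Omega>. let M = S (exp (Complex \<beta> \<Omega>)) in Re (mat_trace (mat_adjoint M * M)))"
    using h2_integral[OF mk car \<beta>] unfolding sums_def_le .
  ultimately show "ereal (1 / (2 * pi) *
     integral {-pi..pi} (\<lambda>\<Omega>. let M = S (exp (Complex \<beta> \<Omega>)) in Re (mat_trace (mat_adjoint M * M)))) \<le> ereal B"
    unfolding ereal_less_eq by (intro LIMSEQ_le_const2[OF lim]) auto
qed

text \<open>Truncating before the radius tends to 1 keeps the limit a finite sum. Together with
  \<open>h2_norm_sq_le\<close> this identifies the squared norm with the sum of squares of the
  coefficients, through bounds on partial sums.\<close>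

lemma h2_norm_sq_ge:
  assumes mk: "\<And>i j. i < nr \<Longrightarrow> j < nc \<Longrightarrow> has_markov (c i j) (\<lambda>q. S q $$ (i, j))"
    and car: "\<And>q. q \<in> outer_disc \<Longrightarrow> S q \<in> carrier_mat nr nc"
  shows "ereal (\<Sum>k\<le>n. \<Sum>i<nr. \<Sum>j<nc. (cmod (c i j k))\<^sup>2) \<le> h2_norm_sq S"
proof -
  define g where "g = (\<lambda>\<beta> k. \<Sum>i<nr. \<Sum>j<nc. (cmod (c i j k))\<^sup>2 / (exp \<beta> ^ k)\<^sup>2 :: real)"
  have "ereal (\<Sum>k\<le>n. g \<beta> k) \<le> h2_norm_sq S" if \<beta>: "0 < \<beta>" for \<beta>
  proof -
    have "(\<Sum>k\<le>n. g \<beta> k) \<le> 1 / (2 * pi) *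
       integral {-pi..pi} (\<lambda>\<Omega>. let M = S (exp (Complex \<beta> \<Omega>)) in Re (mat_trace (mat_adjoint M * M)))"
      unfolding g_def by (rule sums_partial_le[OF h2_integral[OF mk car \<beta>]]) (auto intro!: sum_nonneg)
    then have "ereal (\<Sum>k\<le>n. g \<beta> k) \<le> ereal (1 / (2 * pi) *
       integral {-pi..pi} (\<lambda>\<Omega>. let M = S (exp (Complex \<beta> \<Omega>)) in Re (mat_trace (mat_adjoint M * M))))" by simp
    also have "\<dots> \<le> h2_norm_sq S" unfolding h2_norm_sq_def using \<beta> by (intro SUP_upper) simp
    finally show ?thesis .
  qed
  moreover have "((\<lambda>\<beta>. ereal (\<Sum>k\<le>n. g \<beta> k)) \<longlongrightarrow> ereal (\<Sum>k\<le>n. g 0 k)) (at_right 0)"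
    unfolding g_def lim_ereal by (intro tendsto_intros) auto
  ultimately have "ereal (\<Sum>k\<le>n. g 0 k) \<le> h2_norm_sq S"
    by (intro tendsto_upperbound[of "\<lambda>\<beta>. ereal (\<Sum>k\<le>n. g \<beta> k)" _ "at_right 0"])
       (auto simp: eventually_at_right_less eventually_mono[OF eventually_at_right_less])
  then show ?thesis by (simp add: g_def)
qed

text \<open>Parseval on circles of radius \<rho> > 1 turns a pointwise bound into a bound on
  coefficients, and \<rho> then tends to 1. It makes coefficients of bounded functions square
  summable and later estimates how the closed loop reacts to a change of \<open>Q\<close>.\<close>

lemma has_markov_bessel:
  assumes f: "has_markov c f" and g: "\<And>p. p \<in> I \<Longrightarrow> has_markov (d p) (g p)" and I: "finite I"
    and bd: "\<And>q. q \<in> outer_disc \<Longrightarrow> (cmod (f q))\<^sup>2 \<le> C * (\<Sum>p\<in>I. (cmod (g p q))\<^sup>2)" and C: "0 \<le> C"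
    and s: "\<And>p. p \<in> I \<Longrightarrow> summable (\<lambda>k. (cmod (d p k))\<^sup>2)"
  shows "(\<Sum>k\<le>n. (cmod (c k))\<^sup>2) \<le> C * (\<Sum>p\<in>I. \<Sum>k. (cmod (d p k))\<^sup>2)"
proof -
  define D where "D = C * (\<Sum>p\<in>I. \<Sum>k. (cmod (d p k))\<^sup>2)"
  have "(\<Sum>k\<le>n. (cmod (c k))\<^sup>2 / (\<rho> ^ k)\<^sup>2) \<le> D" if \<rho>: "1 < \<rho>" for \<rho> :: real
  proof -
    let ?I = "\<lambda>f. integral {-pi..pi} (\<lambda>\<Omega>. (cmod (f (of_real \<rho> * cis \<Omega>)))\<^sup>2)"
    have "(\<Sum>k\<le>n. (cmod (c k))\<^sup>2 / (\<rho> ^ k)\<^sup>2) \<le> 1 / (2 * pi) * ?I f"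
      by (rule sums_partial_le[OF has_markov_parseval(1)[OF f \<rho>]]) simp
    also have "\<dots> \<le> 1 / (2 * pi) * integral {-pi..pi} (\<lambda>\<Omega>. C * (\<Sum>p\<in>I. (cmod (g p (of_real \<rho> * cis \<Omega>)))\<^sup>2))"
      by (intro mult_left_mono integral_le has_markov_parseval(2)[OF f \<rho>] integrable_on_mult_right integrable_sum I
          has_markov_parseval(2)[OF g \<rho>] bd outer_disc_cis[OF \<rho>]) auto
    also have "\<dots> = C * (\<Sum>p\<in>I. 1 / (2 * pi) * ?I (g p))"
      by (subst integral_mult_right, subst integral_sum[OF I has_markov_parseval(2)[OF g \<rho>]])
         (auto simp: sum_distrib_left mult_ac)
    also have "\<dots> \<le> D" unfolding D_def
    proof (intro mult_left_mono sum_mono C)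
      fix p assume p: "p \<in> I"
      have "(cmod (d p k))\<^sup>2 / (\<rho> ^ k)\<^sup>2 \<le> (cmod (d p k))\<^sup>2" for k
      proof -
        have "1 \<le> (\<rho> ^ k)\<^sup>2" using \<rho> by (simp add: one_le_power)
        then show ?thesis by (simp add: divide_le_eq mult_le_cancel_left1)
      qed
      then show "1 / (2 * pi) * ?I (g p) \<le> (\<Sum>k. (cmod (d p k))\<^sup>2)"
        by (rule sums_le[OF _ has_markov_parseval(1)[OF g[OF p] \<rho>] summable_sums[OF s[OF p]]])
    qed
    finally show ?thesis .
  qed
  moreover have "((\<lambda>\<rho>. \<Sum>k\<le>n. (cmod (c k))\<^sup>2 / (\<rho> ^ k)\<^sup>2) \<longlongrightarrow> (\<Sum>k\<le>n. (cmod (c k))\<^sup>2 / (1 ^ k)\<^sup>2)) (at_right 1)"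
    by (intro tendsto_intros) auto
  ultimately have "(\<Sum>k\<le>n. (cmod (c k))\<^sup>2 / (1 ^ k)\<^sup>2) \<le> D"
    by (intro tendsto_upperbound[of "\<lambda>\<rho>. \<Sum>k\<le>n. (cmod (c k))\<^sup>2 / (\<rho> ^ k)\<^sup>2" _ "at_right 1"])
       (auto simp: eventually_at_right_less eventually_mono[OF eventually_at_right_less])
  then show ?thesis by (simp add: D_def)
qed

lemma has_markov_bounded_l2:
  assumes f: "has_markov c f" and bd: "\<And>q. q \<in> outer_disc \<Longrightarrow> cmod (f q) \<le> B"
  shows "(\<Sum>k\<le>n. (cmod (c k))\<^sup>2) \<le> B\<^sup>2" "summable (\<lambda>k. (cmod (c k))\<^sup>2)"
proof -
  \<comment> \<open>The coefficients of the constant function 1, with which a bounded function is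
    compared.\<close>
  define d where "d = (\<lambda>k::nat. if k \<le> 0 then 1 else 0 :: complex)"
  have d: "has_markov d (\<lambda>_. 1)"
    using has_markov_finite[of 0 "\<lambda>_. 1"] by (simp add: d_def)
  have ds: "(\<lambda>k. (cmod (d k))\<^sup>2) sums 1"
    using sums_finite[of "{0 :: nat}" "\<lambda>k. (cmod (d k))\<^sup>2"] by (simp add: d_def)
  have "0 \<le> B" using order_trans[OF norm_ge_zero bd[of 2]] by (simp add: outer_disc_def)
  have le: "(\<Sum>k\<le>n. (cmod (c k))\<^sup>2) \<le> B\<^sup>2" for n
    using has_markov_bessel[of c f "{()}" "\<lambda>_. d" "\<lambda>_ _. 1" "B\<^sup>2" n] f d ds bd \<open>0 \<le> B\<close>
    by (simp add: sums_iff power_mono)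
  then show "(\<Sum>k\<le>n. (cmod (c k))\<^sup>2) \<le> B\<^sup>2" .
  have "(\<Sum>k<n. (cmod (c k))\<^sup>2) \<le> B\<^sup>2" for n
    using le[of "n - 1"] by (cases n) (auto simp: lessThan_Suc_atMost)
  then show "summable (\<lambda>k. (cmod (c k))\<^sup>2)"
    by (intro bounded_imp_summable[of _ "B\<^sup>2"]) (auto intro: order_trans[OF _ le])
qed


section \<open>The plant on the exterior of the disc\<close>

definition cayley :: "real \<Rightarrow> complex \<Rightarrow> complex" where
  "cayley \<tau> q = 1 / (2 * of_real \<tau>) * ((q - 1) / (q + 1))"

lemma outer_disc_plus_one: "q \<in> outer_disc \<Longrightarrow> q + 1 \<noteq> 0"
proof
  assume "q \<in> outer_disc" "q + 1 = 0"
  then have "q = - 1" by (simp add: eq_neg_iff_add_eq_0)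
  then show False using \<open>q \<in> outer_disc\<close> by (simp add: outer_disc_def)
qed

lemma cayley_in_right_half_plane:
  assumes "0 < \<tau>" "q \<in> outer_disc"
  shows "cayley \<tau> q \<in> right_half_plane"
proof -
  have nz: "q + 1 \<noteq> 0" using outer_disc_plus_one[OF assms(2)] .
  have "(q - 1) / (q + 1) = (q - 1) * cnj (q + 1) / of_real ((cmod (q + 1))\<^sup>2)"
    by (rule complex_div_cnj[unfolded of_real_power[symmetric]])
  then have "Re ((q - 1) / (q + 1)) = Re ((q - 1) * cnj (q + 1)) / (cmod (q + 1))\<^sup>2"
    by (simp only: Re_divide_of_real)
  also have "Re ((q - 1) * cnj (q + 1)) = (cmod q)\<^sup>2 - 1"
    unfolding cmod_power2 by (simp add: algebra_simps power2_eq_square)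
  finally have "Re ((q - 1) / (q + 1)) = ((cmod q)\<^sup>2 - 1) / (cmod (q + 1))\<^sup>2" .
  moreover have "1 < (cmod q)\<^sup>2" using assms(2) by (simp add: outer_disc_def)
  ultimately have "0 < Re ((q - 1) / (q + 1))" using nz by simp
  moreover have "cayley \<tau> q = of_real (1 / (2 * \<tau>)) * ((q - 1) / (q + 1))"
    unfolding cayley_def by simp
  then have "Re (cayley \<tau> q) = 1 / (2 * \<tau>) * Re ((q - 1) / (q + 1))"
    by (simp only: times_complex.sel Re_complex_of_real Im_complex_of_real mult_zero_left diff_zero)
  ultimately show ?thesis using assms(1) by (simp only: right_half_plane_def mem_Collect_eq) simp
qed

text \<open>In the variable s the filter is a polynomial of degree one, so its growth at infinity is
  matched by the decay of a strictly proper transfer matrix.\<close>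

lemma one_over_one_plus:
  assumes "0 < \<tau>" "q \<in> outer_disc"
  shows "1 / (1 + q) = (1 - 2 * of_real \<tau> * cayley \<tau> q) / 2"
proof -
  have "2 * of_real \<tau> * cayley \<tau> q = (q - 1) / (q + 1)" using assms(1) by (simp add: cayley_def)
  then show ?thesis using outer_disc_plus_one[OF assms(2)] by (simp add: field_simps)
qed

lemma open_outer_disc: "open outer_disc"
  unfolding outer_disc_def by (intro open_Collect_less continuous_intros)

lemma bilinear_H_inf:
  assumes S: "S \<in> H_inf right_half_plane nr nc" and \<tau>: "0 < \<tau>"
  shows "bilinear \<tau> S \<in> H_inf outer_disc nr nc"
proof -
  have eq: "bilinear \<tau> S q = S (cayley \<tau> q)" for q by (simp add: bilinear_def cayley_def)
  have an: "(\<lambda>s. S s $$ (i, j)) holomorphic_on right_half_plane" if "i < nr" "j < nc" for i j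
    using S that analytic_imp_holomorphic by (auto simp: H_inf_def mat_analytic_on_def)
  have "(\<lambda>q. S (cayley \<tau> q) $$ (i, j)) analytic_on outer_disc" if "i < nr" "j < nc" for i j
  proof -
    have "(\<lambda>q. S (cayley \<tau> q) $$ (i, j)) holomorphic_on outer_disc"
      by (rule holomorphic_on_compose_gen[OF _ an[OF that], unfolded o_def])
         (use cayley_in_right_half_plane[OF \<tau>] outer_disc_plus_one \<tau> in
           \<open>auto simp: cayley_def[abs_def] intro!: holomorphic_intros\<close>)
    then show ?thesis using open_outer_disc analytic_on_open by blast
  qed
  then show ?thesis
    using S cayley_in_right_half_plane[OF \<tau>] unfolding H_inf_def mat_analytic_on_def eq by (auto 4 4)
qed

lemma H_inf_has_markov:
  assumes "S \<in> H_inf X nr nc" "X = outer_disc" "i < nr" "j < nc"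
  shows "has_markov (markov_entry (\<lambda>q. S q $$ (i, j))) (\<lambda>q. S q $$ (i, j))"
proof -
  obtain c where "has_markov c (\<lambda>q. S q $$ (i, j))"
    using assms has_markov_exists[of "\<lambda>q. S q $$ (i, j)"] unfolding H_inf_def mat_analytic_on_def by blast
  then show ?thesis using markov_entry_eq by blast
qed

lemma H_inf_bound:
  assumes "S \<in> H_inf X nr nc"
  obtains B where "0 \<le> B" "\<And>q i j. q \<in> X \<Longrightarrow> i < nr \<Longrightarrow> j < nc \<Longrightarrow> cmod (S q $$ (i, j)) \<le> B"
proof -
  obtain B where B: "\<And>q i j. q \<in> X \<Longrightarrow> i < nr \<Longrightarrow> j < nc \<Longrightarrow> cmod (S q $$ (i, j)) \<le> B"
    using assms unfolding H_inf_def by blast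
  show ?thesis by (rule that[of "max 0 B"]) (use B in \<open>auto simp: le_max_iff_disj\<close>)
qed

lemma H_inf_carrier: "S \<in> H_inf X nr nc \<Longrightarrow> q \<in> X \<Longrightarrow> S q \<in> carrier_mat nr nc"
  unfolding H_inf_def mat_analytic_on_def by blast

subsection \<open>Decay of a strictly proper transfer matrix\<close>

lemma mat_entry_bound:
  fixes A :: "complex mat"
  obtains a where "0 \<le> a" "\<And>i j. i < n \<Longrightarrow> j < n' \<Longrightarrow> cmod (A $$ (i, j)) \<le> a"
proof (rule that[of "\<Sum>i<n. \<Sum>j<n'. cmod (A $$ (i, j))"])
  fix i j assume "i < n" "j < n'"
  then have "cmod (A $$ (i, j)) \<le> (\<Sum>j<n'. cmod (A $$ (i, j)))" by (intro member_le_sum) auto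
  also have "\<dots> \<le> (\<Sum>i<n. \<Sum>j<n'. cmod (A $$ (i, j)))"
    using \<open>i < n\<close> by (intro member_le_sum[of i "{..<n}" "\<lambda>i. \<Sum>j<n'. cmod (A $$ (i, j))"]) (auto intro: sum_nonneg)
  finally show "cmod (A $$ (i, j)) \<le> (\<Sum>i<n. \<Sum>j<n'. cmod (A $$ (i, j)))" .
qed (simp add: sum_nonneg)

text \<open>At a coordinate of maximal modulus M the equation gives |s| M <= \<delta> + n a M, and n
  a is at most |s| / 2.\<close>

lemma sup_vec_bound:
  fixes x :: "nat \<Rightarrow> complex"
  assumes a: "\<And>i j. i < n \<Longrightarrow> j < n \<Longrightarrow> cmod (A i j) \<le> a" "0 \<le> a"
    and eq: "\<And>i. i < n \<Longrightarrow> s * x i = d i + (\<Sum>j<n. A i j * x j)"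
    and d: "\<And>i. i < n \<Longrightarrow> cmod (d i) \<le> \<delta>" and s: "2 * real n * a + 1 \<le> cmod s" and i: "i < n"
  shows "cmod (x i) \<le> 2 * \<delta> / cmod s"
proof -
  define M where "M = Max ((\<lambda>i. cmod (x i)) ` {..<n})"
  have ne: "(\<lambda>i. cmod (x i)) ` {..<n} \<noteq> {}" using i by auto
  have le: "cmod (x j) \<le> M" if "j < n" for j unfolding M_def using that by (intro Max_ge) auto
  obtain k where k: "k < n" "cmod (x k) = M" using Max_in[OF _ ne] unfolding M_def by auto
  have M: "0 \<le> M" using k by (metis norm_ge_zero)
  have "cmod s * M = cmod (d k + (\<Sum>j<n. A k j * x j))" using eq[OF k(1)] k(2) by (metis norm_mult)
  also have "\<dots> \<le> cmod (d k) + cmod (\<Sum>j<n. A k j * x j)" by (rule norm_triangle_ineq)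
  also have "cmod (\<Sum>j<n. A k j * x j) \<le> of_nat (card {..<n}) * (a * M)"
    using a le k M by (intro sum_norm_bound) (auto simp: norm_mult intro!: mult_mono)
  also have "of_nat (card {..<n}) * (a * M) = (2 * real n * a) * M / 2" by simp
  also have "\<dots> \<le> cmod s * M / 2" using s M by (intro divide_right_mono mult_right_mono) auto
  finally have "cmod s * M \<le> 2 * \<delta>" using d[OF k(1)] by linarith
  moreover have "0 < cmod s" using s mult_nonneg_nonneg[of "2 * real n" a] a(2) by linarith
  ultimately have "M \<le> 2 * \<delta> / cmod s" by (simp add: field_simps)
  then show ?thesis using le[OF i] by linarith
qed

text \<open>\<open>sup_vec_bound\<close> is used twice: with zero right-hand side it excludes kernel
  vectors of s I - A, and with unit vectors on the right it bounds the columns of the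
  inverse.\<close>

lemma resolvent_bound:
  fixes A :: "complex mat"
  assumes A: "A \<in> carrier_mat n n"
  obtains R where "0 < R" "\<And>s. R \<le> cmod s \<Longrightarrow>
    \<exists>X. mat_inverse (s \<cdot>\<^sub>m 1\<^sub>m n - A) = Some X \<and> X \<in> carrier_mat n n \<and> (\<forall>i<n. \<forall>j<n. cmod (X $$ (i, j)) \<le> 2 / cmod s)"
proof -
  obtain a where a: "0 \<le> a" "\<And>i j. i < n \<Longrightarrow> j < n \<Longrightarrow> cmod (A $$ (i, j)) \<le> a"
    using mat_entry_bound[of n n A] by blast
  define R where "R = 2 * real n * a + 1"
  have "0 < R" using a(1) by (simp add: R_def add_nonneg_pos)
  moreover have "\<exists>X. mat_inverse (s \<cdot>\<^sub>m 1\<^sub>m n - A) = Some X \<and> X \<in> carrier_mat n n \<and> (\<forall>i<n. \<forall>j<n. cmod (X $$ (i, j)) \<le> 2 / cmod s)"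
    if s: "R \<le> cmod s" for s
  proof -
    define N where "N = s \<cdot>\<^sub>m 1\<^sub>m n - A"
    have N: "N \<in> carrier_mat n n" using A by (auto simp: N_def)
    have Nv: "(\<Sum>j<n. N $$ (i, j) * x j) = s * x i - (\<Sum>j<n. A $$ (i, j) * x j)" if "i < n" for i x
    proof -
      have "(\<Sum>j<n. N $$ (i, j) * x j) = (\<Sum>j<n. (if j = i then s * x i else 0) - A $$ (i, j) * x j)"
        using A that by (intro sum.cong) (auto simp: N_def algebra_simps)
      then show ?thesis using that by (simp add: sum_subtractf)
    qed
    have "det N \<noteq> 0"
    proof
      assume "det N = 0"
      then obtain v where v: "v \<in> carrier_vec n" "v \<noteq> 0\<^sub>v n" "N *\<^sub>v v = 0\<^sub>v n"
        using det_0_iff_vec_prod_zero_field[OF N] by blast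
      have "s * v $ i = 0 + (\<Sum>j<n. A $$ (i, j) * v $ j)" if i: "i < n" for i
      proof -
        have "(N *\<^sub>v v) $ i = (\<Sum>j<n. N $$ (i, j) * v $ j)"
          using N v(1) i by (simp add: scalar_prod_def lessThan_atLeast0)
        then show ?thesis using Nv[OF i, of "\<lambda>j. v $ j"] v(3) i by simp
      qed
      then have "cmod (v $ i) \<le> 2 * 0 / cmod s" if "i < n" for i
        by (intro sup_vec_bound[of n "\<lambda>i j. A $$ (i, j)" a s "\<lambda>j. v $ j" "\<lambda>_. 0"])
           (use a s that in \<open>auto simp: R_def\<close>)
      then have "v = 0\<^sub>v n" using v(1) by (intro eq_vecI) auto
      then show False using v(2) by simp
    qed
    then obtain X where X: "mat_inverse N = Some X"
      using mat_inverse(1)[OF N, where b = "()"] det_non_zero_imp_unit[OF N, where b = "()"] by (cases "mat_inverse N") auto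
    have NX: "N * X = 1\<^sub>m n" "X \<in> carrier_mat n n" using mat_inverse(2)[OF N X] by auto
    have "cmod (X $$ (i, j)) \<le> 2 * 1 / cmod s" if ij: "i < n" "j < n" for i j
    proof (rule sup_vec_bound[of n "\<lambda>i j. A $$ (i, j)" a s "\<lambda>i. X $$ (i, j)" "\<lambda>i. if i = j then 1 else 0"])
      fix k assume k: "k < n"
      have "(N * X) $$ (k, j) = (\<Sum>l<n. N $$ (k, l) * X $$ (l, j))"
        using N NX(2) k ij by (simp add: scalar_prod_def lessThan_atLeast0)
      then show "s * X $$ (k, j) = (if k = j then 1 else 0) + (\<Sum>l<n. A $$ (k, l) * X $$ (l, j))"
        using Nv[OF k, of "\<lambda>l. X $$ (l, j)"] NX(1) k ij by simp
    qed (use a s ij in \<open>auto simp: R_def\<close>)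
    then show ?thesis using X NX(2) unfolding N_def by auto
  qed
  ultimately show ?thesis using that by blast
qed

lemma strictly_proper_bound:
  assumes A: "A \<in> carrier_mat n n" and B: "B \<in> carrier_mat n nc" and C: "C \<in> carrier_mat nr n"
  obtains R K where "0 < R" "0 \<le> K" "\<And>s i j. R \<le> cmod s \<Longrightarrow> i < nr \<Longrightarrow> j < nc \<Longrightarrow>
    cmod (s * transfer A B C (0\<^sub>m nr nc) s $$ (i, j)) \<le> K"
proof -
  obtain R where R: "0 < R" "\<And>s. R \<le> cmod s \<Longrightarrow>
    \<exists>X. mat_inverse (s \<cdot>\<^sub>m 1\<^sub>m n - A) = Some X \<and> X \<in> carrier_mat n n \<and> (\<forall>i<n. \<forall>j<n. cmod (X $$ (i, j)) \<le> 2 / cmod s)"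
    using resolvent_bound[OF A] by blast
  obtain b where b: "0 \<le> b" "\<And>i j. i < n \<Longrightarrow> j < nc \<Longrightarrow> cmod (B $$ (i, j)) \<le> b"
    using mat_entry_bound[of n nc B] by blast
  obtain c where c: "0 \<le> c" "\<And>i j. i < nr \<Longrightarrow> j < n \<Longrightarrow> cmod (C $$ (i, j)) \<le> c"
    using mat_entry_bound[of nr n C] by blast
  define K where "K = real n * (real n * (c * 2) * b)"
  have "cmod (s * transfer A B C (0\<^sub>m nr nc) s $$ (i, j)) \<le> K" if s: "R \<le> cmod s" and ij: "i < nr" "j < nc" for s i j
  proof -
    obtain X where X: "mat_inverse (s \<cdot>\<^sub>m 1\<^sub>m n - A) = Some X" "X \<in> carrier_mat n n"
      "\<And>i j. i < n \<Longrightarrow> j < n \<Longrightarrow> cmod (X $$ (i, j)) \<le> 2 / cmod s" using R(2)[OF s] by blast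
    have s0: "0 < cmod s" using R(1) s by linarith
    have tr: "transfer A B C (0\<^sub>m nr nc) s = C * X * B + 0\<^sub>m nr nc"
      using A X(1) by (simp add: transfer_def)
    have CX: "cmod ((C * X) $$ (i, l)) \<le> real n * (c * (2 / cmod s))" if l: "l < n" for l
    proof -
      have "(C * X) $$ (i, l) = (\<Sum>k<n. C $$ (i, k) * X $$ (k, l))"
        using C X(2) ij l by (simp add: scalar_prod_def lessThan_atLeast0)
      moreover have "cmod (\<Sum>k<n. C $$ (i, k) * X $$ (k, l)) \<le> of_nat (card {..<n}) * (c * (2 / cmod s))"
      proof (rule sum_norm_bound)
        fix k assume "k \<in> {..<n}"
        then show "cmod (C $$ (i, k) * X $$ (k, l)) \<le> c * (2 / cmod s)"
          unfolding norm_mult using c(1) ij l by (intro mult_mono c(2) X(3)) auto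
      qed
      ultimately show ?thesis by simp
    qed
    have prod: "(Y * B + 0\<^sub>m nr nc) $$ (i, j) = (\<Sum>l<n. Y $$ (i, l) * B $$ (l, j))" if "Y \<in> carrier_mat nr n" for Y
      using that B ij by (simp add: scalar_prod_def lessThan_atLeast0)
    have "transfer A B C (0\<^sub>m nr nc) s $$ (i, j) = (\<Sum>l<n. (C * X) $$ (i, l) * B $$ (l, j))"
      unfolding tr by (rule prod) (rule mult_carrier_mat[OF C X(2)])
    moreover have "cmod (\<Sum>l<n. (C * X) $$ (i, l) * B $$ (l, j)) \<le> of_nat (card {..<n}) * (real n * (c * (2 / cmod s)) * b)"
    proof (rule sum_norm_bound)
      fix l assume "l \<in> {..<n}"
      then show "cmod ((C * X) $$ (i, l) * B $$ (l, j)) \<le> real n * (c * (2 / cmod s)) * b"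
        unfolding norm_mult using c(1) s0 ij by (intro mult_mono CX b(2)) auto
    qed
    ultimately have "cmod (transfer A B C (0\<^sub>m nr nc) s $$ (i, j)) \<le> real n * (real n * (c * (2 / cmod s)) * b)"
      by simp
    then have "cmod s * cmod (transfer A B C (0\<^sub>m nr nc) s $$ (i, j)) \<le> cmod s * (real n * (real n * (c * (2 / cmod s)) * b))"
      by (intro mult_left_mono) auto
    also have "\<dots> = K" using s0 by (simp add: K_def)
    finally show ?thesis by (simp add: norm_mult)
  qed
  moreover have "0 \<le> K" using b c by (simp add: K_def)
  ultimately show ?thesis using that R(1) by blast
qed

text \<open>The filter is unbounded only near q = -1, that is, for large s. Where |s| is at least
  \<open>R\<close>, boundedness of s times the transfer matrix compensates it; for smaller |s| the
  filter itself is bounded. The final bound is the sum of the two cases.\<close>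

lemma filtered_H_inf:
  assumes A: "A \<in> carrier_mat n n" and B: "B \<in> carrier_mat n nc" and C: "C \<in> carrier_mat nr n"
    and \<tau>: "0 < \<tau>" and S: "transfer A B C (0\<^sub>m nr nc) \<in> H_inf right_half_plane nr nc"
  shows "(\<lambda>q. (1 / (1 + q)) \<cdot>\<^sub>m bilinear \<tau> (transfer A B C (0\<^sub>m nr nc)) q) \<in> H_inf outer_disc nr nc"
proof -
  define T where "T = transfer A B C (0\<^sub>m nr nc)"
  have T: "bilinear \<tau> T \<in> H_inf outer_disc nr nc" unfolding T_def by (rule bilinear_H_inf[OF S \<tau>])
  have ix: "((1 / (1 + q)) \<cdot>\<^sub>m bilinear \<tau> T q) $$ (i, j) = 1 / (1 + q) * bilinear \<tau> T q $$ (i, j)"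
    if "q \<in> outer_disc" "i < nr" "j < nc" for q i j
    using H_inf_carrier[OF T that(1)] that by simp
  obtain Bd where Bd: "0 \<le> Bd" "\<And>s i j. s \<in> right_half_plane \<Longrightarrow> i < nr \<Longrightarrow> j < nc \<Longrightarrow> cmod (T s $$ (i, j)) \<le> Bd"
    using H_inf_bound[OF S] unfolding T_def by blast
  obtain R K where RK: "0 < R" "0 \<le> K" "\<And>s i j. R \<le> cmod s \<Longrightarrow> i < nr \<Longrightarrow> j < nc \<Longrightarrow> cmod (s * T s $$ (i, j)) \<le> K"
    using strictly_proper_bound[OF A B C] unfolding T_def by blast
  have bd: "cmod (1 / (1 + q) * bilinear \<tau> T q $$ (i, j)) \<le> (1 + 2 * \<tau> * R) / 2 * Bd + (Bd + 2 * \<tau> * K) / 2"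
    if q: "q \<in> outer_disc" and ij: "i < nr" "j < nc" for q i j
  proof -
    define s where "s = cayley \<tau> q"
    have s: "s \<in> right_half_plane" unfolding s_def by (rule cayley_in_right_half_plane[OF \<tau> q])
    have e: "1 / (1 + q) * bilinear \<tau> T q $$ (i, j) = (1 - 2 * of_real \<tau> * s) / 2 * T s $$ (i, j)"
      unfolding one_over_one_plus[OF \<tau> q] s_def by (simp add: bilinear_def cayley_def)
    show ?thesis
    proof (cases "R \<le> cmod s")
      case True
      have "(1 - 2 * of_real \<tau> * s) / 2 * T s $$ (i, j) = (T s $$ (i, j) - 2 * of_real \<tau> * (s * T s $$ (i, j))) / 2"
        by (simp add: field_simps)
      then have "cmod ((1 - 2 * of_real \<tau> * s) / 2 * T s $$ (i, j)) = cmod (T s $$ (i, j) - 2 * of_real \<tau> * (s * T s $$ (i, j))) / 2"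
        by (simp add: norm_divide)
      also have "\<dots> \<le> (cmod (T s $$ (i, j)) + cmod (2 * of_real \<tau> * (s * T s $$ (i, j)))) / 2"
        by (intro divide_right_mono norm_triangle_ineq4) simp
      also have "cmod (2 * of_real \<tau> * (s * T s $$ (i, j))) = 2 * \<tau> * cmod (s * T s $$ (i, j))"
        using \<tau> by (simp only: norm_mult norm_of_real) simp
      also have "(cmod (T s $$ (i, j)) + 2 * \<tau> * cmod (s * T s $$ (i, j))) / 2 \<le> (Bd + 2 * \<tau> * K) / 2"
        using \<tau> Bd(2)[OF s ij] RK(3)[OF True ij] by (intro divide_right_mono add_mono mult_left_mono) auto
      finally show ?thesis unfolding e using RK(1) Bd(1) \<tau> by (simp add: add_increasing)
    next
      case False
      have "cmod (1 - 2 * of_real \<tau> * s) \<le> cmod 1 + cmod (2 * of_real \<tau> * s)" by (rule norm_triangle_ineq4)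
      also have "\<dots> = 1 + 2 * \<tau> * cmod s" using \<tau> by (simp add: norm_mult)
      also have "\<dots> \<le> 1 + 2 * \<tau> * R" using False \<tau> by simp
      finally have "cmod ((1 - 2 * of_real \<tau> * s) / 2 * T s $$ (i, j)) \<le> (1 + 2 * \<tau> * R) / 2 * Bd"
        unfolding norm_mult norm_divide using Bd(2)[OF s ij] RK(1) \<tau> by (intro mult_mono) auto
      then show ?thesis unfolding e using RK(2) Bd(1) \<tau> by (simp add: add_increasing2)
    qed
  qed
  have an: "(\<lambda>q. ((1 / (1 + q)) \<cdot>\<^sub>m bilinear \<tau> T q) $$ (i, j)) analytic_on outer_disc" if ij: "i < nr" "j < nc" for i j
  proof -
    have "(\<lambda>q. bilinear \<tau> T q $$ (i, j)) holomorphic_on outer_disc"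
      using T ij analytic_imp_holomorphic by (auto simp: H_inf_def mat_analytic_on_def)
    then have "(\<lambda>q. 1 / (1 + q) * bilinear \<tau> T q $$ (i, j)) holomorphic_on outer_disc"
      using outer_disc_plus_one by (intro holomorphic_intros) (auto simp: add.commute)
    then have "(\<lambda>q. ((1 / (1 + q)) \<cdot>\<^sub>m bilinear \<tau> T q) $$ (i, j)) holomorphic_on outer_disc"
      by (rule holomorphic_transform) (use ix ij in auto)
    then show ?thesis using open_outer_disc analytic_on_open by blast
  qed
  have car: "(1 / (1 + q)) \<cdot>\<^sub>m bilinear \<tau> T q \<in> carrier_mat nr nc" if "q \<in> outer_disc" for q
    using H_inf_carrier[OF T that] by simp
  have "(\<lambda>q. (1 / (1 + q)) \<cdot>\<^sub>m bilinear \<tau> T q) \<in> H_inf outer_disc nr nc"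
    unfolding H_inf_def mat_analytic_on_def mem_Collect_eq
    using an car bd ix by (intro conjI exI[of _ "(1 + 2 * \<tau> * R) / 2 * Bd + (Bd + 2 * \<tau> * K) / 2"]) auto
  then show ?thesis unfolding T_def .
qed

lemma plant_class_H_inf:
  assumes P: "P \<in> plant_class" and \<tau>: "0 < \<tau>"
  shows "P_fz P \<tau> \<in> H_inf outer_disc (n_z P) (n_w P)" "P_fy P \<tau> \<in> H_inf outer_disc (n_u P) (n_w P)"
    "P_uz P \<tau> \<in> H_inf outer_disc (n_z P) (n_u P)" "P_uy P \<tau> \<in> H_inf outer_disc (n_u P) (n_u P)"
proof -
  have wf: "mat_A P \<in> carrier_mat (n_x P) (n_x P)" "B_w P \<in> carrier_mat (n_x P) (n_w P)"
    "C_z P \<in> carrier_mat (n_z P) (n_x P)" "C_y P \<in> carrier_mat (n_u P) (n_x P)"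
    using P unfolding plant_class_def well_formed_def mem_Collect_eq by blast+
  have D: "D_wz P = 0\<^sub>m (n_z P) (n_w P)" "D_wy P = 0\<^sub>m (n_u P) (n_w P)"
    and H: "hat_wz P \<in> H_inf right_half_plane (n_z P) (n_w P)" "hat_wy P \<in> H_inf right_half_plane (n_u P) (n_w P)"
     "hat_uz P \<in> H_inf right_half_plane (n_z P) (n_u P)" "hat_uy P \<in> H_inf right_half_plane (n_u P) (n_u P)"
    using P unfolding plant_class_def mem_Collect_eq by blast+
  show "P_fz P \<tau> \<in> H_inf outer_disc (n_z P) (n_w P)"
    using filtered_H_inf[OF wf(1,2,3) \<tau>] H(1) unfolding hat_wz_def D P_fz_def[abs_def] .
  show "P_fy P \<tau> \<in> H_inf outer_disc (n_u P) (n_w P)"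
    using filtered_H_inf[OF wf(1,2,4) \<tau>] H(2) unfolding hat_wy_def D P_fy_def[abs_def] .
  show "P_uz P \<tau> \<in> H_inf outer_disc (n_z P) (n_u P)" "P_uy P \<tau> \<in> H_inf outer_disc (n_u P) (n_u P)"
    using bilinear_H_inf[OF H(3) \<tau>] bilinear_H_inf[OF H(4) \<tau>] unfolding P_uz_def[abs_def] P_uy_def[abs_def]
    by simp_all
qed


section \<open>Boundary behaviour of the factor\<close>

lemma eventually_outer_disc:
  assumes "cmod w = 1"
  shows "\<forall>\<^sub>F r in at_right 1. of_real r * w \<in> outer_disc"
  unfolding eventually_at_right_field using assms
  by (auto simp: outer_disc_def norm_mult intro!: exI[of _ 2])

lemma tendsto_radial:
  fixes w :: complex
  assumes "isCont g w"
  shows "((\<lambda>r. g (of_real r * w)) \<longlongrightarrow> g w) (at_right 1)"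
proof -
  have "((\<lambda>r. of_real r * w) \<longlongrightarrow> of_real 1 * w) (at_right 1)" by (intro tendsto_intros)
  then have "((\<lambda>r. of_real r * w) \<longlongrightarrow> w) (at_right 1)" by simp
  then show ?thesis by (rule isCont_tendsto_compose[OF assms])
qed

text \<open>A zero of the denominator on the circle is also a zero of the numerator, so it can be cancelled.\<close>

lemma bounded_rational_extend:
  fixes a b :: "complex poly"
  assumes "\<And>z. z \<in> outer_disc \<Longrightarrow> poly b z \<noteq> 0 \<and> f z = poly a z / poly b z"
    and "\<And>z. z \<in> outer_disc \<Longrightarrow> cmod (f z) \<le> B"
  shows "\<exists>a b :: complex poly. (\<forall>z. 1 \<le> cmod z \<longrightarrow> poly b z \<noteq> 0) \<and> (\<forall>z\<in>outer_disc. f z = poly a z / poly b z)"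
  using assms(1)
proof (induction "degree b" arbitrary: a b rule: less_induct)
  case less
  show ?case
  proof (cases "\<exists>w. cmod w = 1 \<and> poly b w = 0")
    case False
    then have "poly b z \<noteq> 0" if "1 \<le> cmod z" for z
      using that less.prems by (cases "cmod z = 1") (auto simp: outer_disc_def)
    then show ?thesis using less.prems by blast
  next
    case True
    then obtain w where w: "cmod w = 1" "poly b w = 0" by blast
    have b0: "b \<noteq> 0" using less.prems[of 2] by (auto simp: outer_disc_def)
    have "((\<lambda>r. B * cmod (poly b (of_real r * w)) - cmod (poly a (of_real r * w))) \<longlongrightarrow> B * cmod (poly b w) - cmod (poly a w)) (at_right 1)"
      by (intro tendsto_intros tendsto_radial) auto
    moreover have "\<forall>\<^sub>F r in at_right 1. 0 \<le> B * cmod (poly b (of_real r * w)) - cmod (poly a (of_real r * w))"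
      using eventually_outer_disc[OF w(1)]
    proof eventually_elim
      case (elim r)
      then show ?case using assms(2)[OF elim] less.prems[OF elim] by (simp add: norm_divide divide_le_eq)
    qed
    ultimately have "0 \<le> B * cmod (poly b w) - cmod (poly a w)"
      by (intro tendsto_lowerbound[of _ _ "at_right 1"]) auto
    then have "poly a w = 0" using w(2) by simp
    then obtain a' where a': "a = [:- w, 1:] * a'" by (auto simp: poly_eq_0_iff_dvd)
    obtain b' where b': "b = [:- w, 1:] * b'" using w(2) by (auto simp: poly_eq_0_iff_dvd)
    have "b' \<noteq> 0" using b0 b' by auto
    then have "degree b' < degree b" unfolding b' by (subst degree_mult_eq) auto
    moreover have "poly b' z \<noteq> 0 \<and> f z = poly a' z / poly b' z" if "z \<in> outer_disc" for z
    proof -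
      have lin: "poly ([:- w, 1:] * p) z = (z - w) * poly p z" for p by (simp add: algebra_simps)
      show ?thesis using less.prems[OF that] unfolding a' b' lin by auto
    qed
    ultimately show ?thesis using less.hyps by blast
  qed
qed

text \<open>After cancellation the function is continuous on the closed annulus 1 <= |z| <= 2, and
  uniform continuity there gives radial convergence uniformly in the direction w.\<close>

lemma bounded_rational_uniform:
  assumes rat: "\<And>z. z \<in> outer_disc \<Longrightarrow> poly b z \<noteq> 0 \<and> f z = poly a z / poly b z"
    and bd: "\<And>z. z \<in> outer_disc \<Longrightarrow> cmod (f z) \<le> B"
    and L: "\<And>w. cmod w = 1 \<Longrightarrow> ((\<lambda>r. f (of_real r * w)) \<longlongrightarrow> L w) (at_right 1)"
    and \<eta>: "0 < \<eta>"
  shows "\<forall>\<^sub>F r in at_right 1. \<forall>w. cmod w = 1 \<longrightarrow> cmod (f (of_real r * w) - L w) < \<eta>"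
proof -
  obtain a b where ab: "\<And>z. 1 \<le> cmod z \<Longrightarrow> poly b z \<noteq> 0" "\<And>z. z \<in> outer_disc \<Longrightarrow> f z = poly a z / poly b z"
    using bounded_rational_extend[OF rat bd] by blast
  define g where "g = (\<lambda>z. poly a z / poly b z)"
  define K where "K = cball 0 2 - ball (0::complex) 1"
  have K: "z \<in> K \<longleftrightarrow> 1 \<le> cmod z \<and> cmod z \<le> 2" for z by (auto simp: K_def)
  have "continuous_on K g" unfolding g_def using ab(1) K by (intro continuous_intros) auto
  moreover have "compact K" unfolding K_def by (intro compact_diff) auto
  ultimately have "uniformly_continuous_on K g" by (rule compact_uniformly_continuous)
  then obtain d where d: "0 < d" "\<And>x y. x \<in> K \<Longrightarrow> y \<in> K \<Longrightarrow> dist x y < d \<Longrightarrow> dist (g x) (g y) < \<eta>"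
    using \<eta> unfolding uniformly_continuous_on_def by metis
  have Lg: "L w = g w" if w: "cmod w = 1" for w
  proof -
    have "isCont g w" unfolding g_def using ab(1) w by (intro continuous_intros) auto
    from tendsto_radial[OF this] have "((\<lambda>r. g (of_real r * w)) \<longlongrightarrow> g w) (at_right 1)" .
    moreover have "\<forall>\<^sub>F r in at_right 1. g (of_real r * w) = f (of_real r * w)"
      using eventually_outer_disc[OF w] by eventually_elim (simp add: ab(2) g_def)
    ultimately have "((\<lambda>r. f (of_real r * w)) \<longlongrightarrow> g w) (at_right 1)" by (rule Lim_transform_eventually)
    then show ?thesis using L[OF w] by (intro tendsto_unique[of "at_right (1::real)"]) auto
  qed
  have "\<forall>\<^sub>F r in at_right 1. r < min 2 (1 + d)"
    unfolding eventually_at_right_field using d(1) by (auto intro!: exI[of _ "min 2 (1 + d)"])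
  then show ?thesis using eventually_at_right_less[of 1]
  proof eventually_elim
    case (elim r)
    show ?case
    proof (intro allI impI)
      fix w :: complex assume w: "cmod w = 1"
      have n: "cmod (of_real r * w) = r" using w elim by (simp add: norm_mult)
      have "of_real r * w - w = of_real (r - 1) * w" by (simp add: algebra_simps)
      then have "dist (of_real r * w) w = r - 1" using w elim by (simp add: dist_norm norm_mult del: of_real_diff)
      then have "dist (g (of_real r * w)) (g w) < \<eta>"
        using d(2)[of "of_real r * w" w] n w elim by (auto simp: K)
      moreover have "of_real r * w \<in> outer_disc" using n elim by (simp add: outer_disc_def)
      ultimately show "cmod (f (of_real r * w) - L w) < \<eta>" using ab(2) Lg[OF w] by (simp add: dist_norm g_def)
    qed
  qed
qed

lemma H_inf_boundary_bound:
  assumes S: "S \<in> H_inf outer_disc nr nc" and B: "\<And>q i j. q \<in> outer_disc \<Longrightarrow> i < nr \<Longrightarrow> j < nc \<Longrightarrow> cmod (S q $$ (i, j)) \<le> B"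
    and Y: "has_boundary_value S w nr nc Y" "cmod w = 1" "i < nr" "j < nc"
  shows "cmod (Y $$ (i, j)) \<le> B"
proof (rule tendsto_upperbound)
  show "((\<lambda>r. cmod (S (of_real r * w) $$ (i, j))) \<longlongrightarrow> cmod (Y $$ (i, j))) (at_right 1)"
    using Y by (auto simp: has_boundary_value_def intro!: tendsto_norm)
  show "\<forall>\<^sub>F r in at_right 1. cmod (S (of_real r * w) $$ (i, j)) \<le> B"
    using eventually_outer_disc[OF Y(2)] by eventually_elim (use B Y in auto)
qed auto

text \<open>\<open>G = L + L\<^sup>H\<close> is the inverse of H = Y + Y^H + \<epsilon> I, which
  dominates \<epsilon> I. With y = G x and x = H y, the form of \<open>G\<close> at x is the form of
  \<open>H\<close> at y, hence at least \<epsilon> |y|^2, while |x|^2 <= (m h)^2 |y|^2 because the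
  entries of \<open>H\<close> are at most h = 2 B + \<epsilon>. The factor 2 in the constant passes
  from \<open>G\<close> to \<open>L\<close>, and the summand 1 keeps the denominator positive when m
  = 0.\<close>

lemma factor_boundary_positive:
  fixes Y L :: "complex mat"
  assumes Y: "Y \<in> carrier_mat m m" and L: "L \<in> carrier_mat m m"
    and inv: "mat_inverse (Y + mat_adjoint Y + of_real \<epsilon> \<cdot>\<^sub>m 1\<^sub>m m) = Some (L + mat_adjoint L)"
    and pos: "\<And>y. 0 \<le> Re (kform {..<m} (\<lambda>i j. Y $$ (i, j)) y)" and \<epsilon>: "0 < \<epsilon>"
    and bd: "\<And>i j. i < m \<Longrightarrow> j < m \<Longrightarrow> cmod (Y $$ (i, j)) \<le> B" "0 \<le> B"
  shows "\<exists>H. \<forall>p<m. \<forall>q<m. (\<Sum>k<m. (L $$ (p, k) + cnj (L $$ (k, p))) * H k q) = (if p = q then 1 else 0)"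
    and "\<epsilon> / (2 * ((real m * (2 * B + \<epsilon>))\<^sup>2 + 1)) * (\<Sum>p<m. (cmod (x p))\<^sup>2) \<le> Re (kform {..<m} (\<lambda>i j. L $$ (i, j)) x)"
proof -
  define Hm where "Hm = Y + mat_adjoint Y + of_real \<epsilon> \<cdot>\<^sub>m 1\<^sub>m m"
  define H where "H = (\<lambda>p q. Y $$ (p, q) + cnj (Y $$ (q, p)) + (if p = q then of_real \<epsilon> else 0))"
  define G where "G = (\<lambda>p q. L $$ (p, q) + cnj (L $$ (q, p)))"
  have Hm: "Hm \<in> carrier_mat m m" unfolding Hm_def using Y by auto
  have Hix: "Hm $$ (p, q) = H p q" if "p < m" "q < m" for p q
    using that Y by (simp add: Hm_def H_def)
  have Gix: "(L + mat_adjoint L) $$ (p, q) = G p q" if "p < m" "q < m" for p q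
    using that L by (simp add: G_def)
  have LL: "L + mat_adjoint L \<in> carrier_mat m m" using L by auto
  have prod: "Hm * (L + mat_adjoint L) = 1\<^sub>m m" "(L + mat_adjoint L) * Hm = 1\<^sub>m m"
    using mat_inverse(2)[OF Hm, of "L + mat_adjoint L"] inv unfolding Hm_def by auto
  have GH: "(\<Sum>k<m. G p k * H k q) = (if p = q then 1 else 0)" if "p < m" "q < m" for p q
  proof -
    have "((L + mat_adjoint L) * Hm) $$ (p, q) = (\<Sum>k<m. (L + mat_adjoint L) $$ (p, k) * Hm $$ (k, q))"
      using that Hm LL by (simp add: scalar_prod_def lessThan_atLeast0 del: index_add_mat)
    then show ?thesis using prod(2) that by (simp add: Hix Gix del: index_add_mat)
  qed
  have HG: "(\<Sum>k<m. H p k * G k q) = (if p = q then 1 else 0)" if "p < m" "q < m" for p q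
  proof -
    have "(Hm * (L + mat_adjoint L)) $$ (p, q) = (\<Sum>k<m. Hm $$ (p, k) * (L + mat_adjoint L) $$ (k, q))"
      using that Hm LL by (simp add: scalar_prod_def lessThan_atLeast0 del: index_add_mat)
    then show ?thesis using prod(1) that by (simp add: Hix Gix del: index_add_mat)
  qed
  show "\<exists>H. \<forall>p<m. \<forall>q<m. (\<Sum>k<m. (L $$ (p, k) + cnj (L $$ (k, p))) * H k q) = (if p = q then 1 else 0)"
    using GH unfolding G_def by blast
  define y where "y = mv m G x"
  define N where "N = (\<Sum>p<m. (cmod (y p))\<^sup>2)"
  define h where "h = 2 * B + \<epsilon>"
  have N: "0 \<le> N" unfolding N_def by (simp add: sum_nonneg)
  have xH: "mv m H y p = x p" if "p < m" for p
    unfolding y_def using mv_inverse[of m H G] HG that by blast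
  have "kform {..<m} H y = kform {..<m} (\<lambda>p q. Y $$ (p, q) + cnj (Y $$ (q, p))) y + (\<Sum>p<m. of_real (\<epsilon> * (cmod (y p))\<^sup>2))"
  proof -
    have "kform {..<m} (\<lambda>p q. if p = q then of_real \<epsilon> else 0) y = (\<Sum>p<m. cnj (y p) * of_real \<epsilon> * y p)"
      unfolding kform_def by (intro sum.cong refl) (simp add: if_distrib[of "\<lambda>x. _ * x * _"] sum.delta cong: if_cong)
    also have "\<dots> = (\<Sum>p<m. of_real (\<epsilon> * (cmod (y p))\<^sup>2))"
    proof (intro sum.cong refl)
      fix p
      show "cnj (y p) * of_real \<epsilon> * y p = of_real (\<epsilon> * (cmod (y p))\<^sup>2)"
        using complex_norm_square[of "y p"] by (simp add: mult_ac)
    qed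
    finally show ?thesis unfolding H_def kform_add by simp
  qed
  then have "Re (kform {..<m} H y) = 2 * Re (kform {..<m} (\<lambda>p q. Y $$ (p, q)) y) + \<epsilon> * N"
    unfolding kform_add_adjoint[OF finite_lessThan] N_def sum_distrib_left by (simp del: of_real_mult)
  then have HN: "\<epsilon> * N \<le> Re (kform {..<m} H y)" using pos[of y] by linarith
  have "ip m y (mv m H y) = ip m y x" by (rule ip_cong) (auto simp: xH)
  then have "Re (kform {..<m} H y) = Re (ip m x y)" unfolding kform_eq_ip by (subst ip_commute) simp
  also have "\<dots> = Re (kform {..<m} G x)" unfolding kform_eq_ip y_def ..
  also have "\<dots> = 2 * Re (kform {..<m} (\<lambda>i j. L $$ (i, j)) x)"
    unfolding G_def kform_add_adjoint[OF finite_lessThan] by simp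
  finally have L2: "\<epsilon> * N \<le> 2 * Re (kform {..<m} (\<lambda>i j. L $$ (i, j)) x)" using HN by linarith
  have h: "0 \<le> h" using bd(2) \<epsilon> by (simp add: h_def)
  have Hbd: "cmod (H p q) \<le> h" if "p < m" "q < m" for p q
  proof -
    have "cmod (H p q) \<le> cmod (Y $$ (p, q)) + cmod (cnj (Y $$ (q, p))) + cmod (if p = q then complex_of_real \<epsilon> else 0)"
      unfolding H_def by (intro order_trans[OF norm_triangle_ineq] add_right_mono norm_triangle_ineq)
    then show ?thesis using bd(1)[OF that] bd(1)[OF that(2,1)] \<epsilon> unfolding h_def by (auto split: if_splits)
  qed
  have "(cmod (x p))\<^sup>2 \<le> real m * h\<^sup>2 * N" if p: "p < m" for p
  proof -
    have "cmod (x p) \<le> (\<Sum>q<m. h * cmod (y q))"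
      unfolding xH[OF p, symmetric] mv_def using Hbd p by (intro sum_norm_le) (auto simp: norm_mult intro!: mult_right_mono)
    then have "(cmod (x p))\<^sup>2 \<le> (\<Sum>q<m. h * cmod (y q))\<^sup>2" by (intro power_mono) auto
    also have "\<dots> \<le> (\<Sum>q<m. (h * cmod (y q))\<^sup>2) * card {..<m}" by (rule sum_squared_le_sum_of_squares)
    also have "\<dots> = real m * h\<^sup>2 * N" by (simp add: N_def power_mult_distrib sum_distrib_left mult_ac)
    finally show ?thesis .
  qed
  then have "(\<Sum>p<m. (cmod (x p))\<^sup>2) \<le> of_nat (card {..<m}) * (real m * h\<^sup>2 * N)"
    by (intro sum_bounded_above) auto
  also have "\<dots> = (real m * h)\<^sup>2 * N" by (simp add: power2_eq_square mult_ac)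
  also have "\<dots> \<le> ((real m * h)\<^sup>2 + 1) * N" using N by (simp add: algebra_simps)
  finally have xN: "(\<Sum>p<m. (cmod (x p))\<^sup>2) \<le> ((real m * h)\<^sup>2 + 1) * N" .
  have D: "0 < (real m * h)\<^sup>2 + 1" by (simp add: add_nonneg_pos)
  have "\<epsilon> / (2 * ((real m * h)\<^sup>2 + 1)) * (\<Sum>p<m. (cmod (x p))\<^sup>2) \<le> \<epsilon> / (2 * ((real m * h)\<^sup>2 + 1)) * (((real m * h)\<^sup>2 + 1) * N)"
    using xN \<epsilon> D by (intro mult_left_mono) auto
  also have "\<dots> = \<epsilon> * N / 2" using D by (simp add: field_simps)
  also have "\<dots> \<le> Re (kform {..<m} (\<lambda>i j. L $$ (i, j)) x)" using L2 by simp
  finally show "\<epsilon> / (2 * ((real m * (2 * B + \<epsilon>))\<^sup>2 + 1)) * (\<Sum>p<m. (cmod (x p))\<^sup>2) \<le> Re (kform {..<m} (\<lambda>i j. L $$ (i, j)) x)"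
    unfolding h_def .
qed

text \<open>The facts about the factor on the circle on which the rest relies: radial limits
  \<open>L w\<close>, a right inverse \<open>H w\<close> of \<open>L w\<close> plus its adjoint,
  positivity with a constant c independent of w, and convergence to the limits uniformly in
  w.\<close>

definition boundary_factor :: "nat \<Rightarrow> (complex \<Rightarrow> complex mat) \<Rightarrow> real \<Rightarrow>
    (complex \<Rightarrow> nat \<Rightarrow> nat \<Rightarrow> complex) \<Rightarrow> (complex \<Rightarrow> nat \<Rightarrow> nat \<Rightarrow> complex) \<Rightarrow> bool" where
  "boundary_factor m F c L H \<longleftrightarrow> 0 < c \<and>
    (\<forall>w p q. cmod w = 1 \<longrightarrow> p < m \<longrightarrow> q < m \<longrightarrow> ((\<lambda>r. F (of_real r * w) $$ (p, q)) \<longlongrightarrow> L w p q) (at_right 1)) \<and>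
    (\<forall>w p q. cmod w = 1 \<longrightarrow> p < m \<longrightarrow> q < m \<longrightarrow>
      (\<Sum>k<m. (L w p k + cnj (L w k p)) * H w k q) = (if p = q then 1 else 0)) \<and>
    (\<forall>w x. cmod w = 1 \<longrightarrow> c * (\<Sum>p<m. (cmod (x p))\<^sup>2) \<le> Re (kform {..<m} (L w) x)) \<and>
    (\<forall>\<eta>>0. \<forall>\<^sub>F r in at_right 1. \<forall>p<m. \<forall>q<m. \<forall>w. cmod w = 1 \<longrightarrow> cmod (F (of_real r * w) $$ (p, q) - L w p q) < \<eta>)"

lemma boundary_factorD:
  assumes "boundary_factor m F c L H"
  shows "0 < c"
    "cmod w = 1 \<Longrightarrow> p < m \<Longrightarrow> q < m \<Longrightarrow> ((\<lambda>r. F (of_real r * w) $$ (p, q)) \<longlongrightarrow> L w p q) (at_right 1)"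
    "cmod w = 1 \<Longrightarrow> p < m \<Longrightarrow> q < m \<Longrightarrow>
      (\<Sum>k<m. (L w p k + cnj (L w k p)) * H w k q) = (if p = q then 1 else 0)"
    "cmod w = 1 \<Longrightarrow> c * (\<Sum>p<m. (cmod (x p))\<^sup>2) \<le> Re (kform {..<m} (L w) x)"
    "0 < \<eta> \<Longrightarrow> \<forall>\<^sub>F r in at_right 1. \<forall>p<m. \<forall>q<m. \<forall>w. cmod w = 1 \<longrightarrow> cmod (F (of_real r * w) $$ (p, q) - L w p q) < \<eta>"
  using assms unfolding boundary_factor_def by blast+

text \<open>Passivity and boundedness of the transformed plant pass to its radial limits
  \<open>Y\<close>. The bound \<open>B\<close> does not depend on the boundary point, and therefore
  neither does the positivity constant.\<close>

lemma boundary_factor_exists: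
  assumes P: "P \<in> plant_class" and \<epsilon>: "0 < \<epsilon>" and \<tau>: "0 < \<tau>" and F: "is_factor P \<epsilon> \<tau> F"
  shows "\<exists>c L H. boundary_factor (n_u P) F c L H"
proof -
  define m where "m = n_u P"
  have uy: "P_uy P \<tau> \<in> H_inf outer_disc m m" unfolding m_def by (rule plant_class_H_inf(4)[OF P \<tau>])
  obtain B where B: "0 \<le> B" "\<And>q i j. q \<in> outer_disc \<Longrightarrow> i < m \<Longrightarrow> j < m \<Longrightarrow> cmod (P_uy P \<tau> q $$ (i, j)) \<le> B"
    using H_inf_bound[OF uy] by blast
  have FH: "F \<in> H_inf outer_disc m m" and rat: "mat_rational_on F outer_disc m m"
    using F unfolding is_factor_def m_def by blast+
  obtain BF where BF: "0 \<le> BF" "\<And>q i j. q \<in> outer_disc \<Longrightarrow> i < m \<Longrightarrow> j < m \<Longrightarrow> cmod (F q $$ (i, j)) \<le> BF"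
    using H_inf_bound[OF FH] by blast
  have "\<forall>w. cmod w = 1 \<longrightarrow> (\<exists>Y L. has_boundary_value (P_uy P \<tau>) w m m Y \<and> has_boundary_value F w m m L \<and>
        mat_inverse (Y + mat_adjoint Y + of_real \<epsilon> \<cdot>\<^sub>m 1\<^sub>m m) = Some (L + mat_adjoint L))"
    using F unfolding is_factor_def m_def by blast
  then obtain Y L where YL: "\<And>w. cmod w = 1 \<Longrightarrow> has_boundary_value (P_uy P \<tau>) w m m (Y w)"
    "\<And>w. cmod w = 1 \<Longrightarrow> has_boundary_value F w m m (L w)"
    "\<And>w. cmod w = 1 \<Longrightarrow> mat_inverse (Y w + mat_adjoint (Y w) + of_real \<epsilon> \<cdot>\<^sub>m 1\<^sub>m m) = Some (L w + mat_adjoint (L w))"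
    by metis
  have car: "Y w \<in> carrier_mat m m" "L w \<in> carrier_mat m m" if "cmod w = 1" for w
    using YL(1,2)[OF that] unfolding has_boundary_value_def by blast+
  have pass: "0 \<le> Re (kform {..<m} (\<lambda>i j. P_uy P \<tau> q $$ (i, j)) y)" if q: "q \<in> outer_disc" for q y
  proof -
    have "cayley \<tau> q \<in> right_half_plane" by (rule cayley_in_right_half_plane[OF \<tau> q])
    then have "0\<^sub>m m m \<preceq>\<^sub>H hat_uy P (cayley \<tau> q) + mat_adjoint (hat_uy P (cayley \<tau> q))"
      using P unfolding plant_class_def m_def by blast
    moreover have "P_uy P \<tau> q = hat_uy P (cayley \<tau> q)" by (simp add: P_uy_def bilinear_def cayley_def)
    ultimately show ?thesis using herm_le_zero_add_adjoint[OF H_inf_carrier[OF uy q]] by simp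
  qed
  have Ypos: "0 \<le> Re (kform {..<m} (\<lambda>i j. Y w $$ (i, j)) y)" if w: "cmod w = 1" for w y
  proof (rule tendsto_lowerbound)
    show "((\<lambda>r. Re (kform {..<m} (\<lambda>i j. P_uy P \<tau> (of_real r * w) $$ (i, j)) y)) \<longlongrightarrow> Re (kform {..<m} (\<lambda>i j. Y w $$ (i, j)) y)) (at_right 1)"
      using YL(1)[OF w] unfolding kform_def has_boundary_value_def by (intro tendsto_intros) auto
    show "\<forall>\<^sub>F r in at_right 1. 0 \<le> Re (kform {..<m} (\<lambda>i j. P_uy P \<tau> (of_real r * w) $$ (i, j)) y)"
      using eventually_outer_disc[OF w] by eventually_elim (rule pass)
  qed simp
  have Ybd: "cmod (Y w $$ (i, j)) \<le> B" if "cmod w = 1" "i < m" "j < m" for w i j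
    by (rule H_inf_boundary_bound[OF uy B(2) YL(1)]) (use that in auto)
  define c where "c = \<epsilon> / (2 * ((real m * (2 * B + \<epsilon>))\<^sup>2 + 1))"
  have "0 < c" unfolding c_def using \<epsilon> by (simp add: add_nonneg_pos)
  have ex_H: "\<exists>H. \<forall>p<m. \<forall>q<m. (\<Sum>k<m. (L w $$ (p, k) + cnj (L w $$ (k, p))) * H k q) = (if p = q then 1 else (0 :: complex))"
    if w: "cmod w = 1" for w
    by (rule factor_boundary_positive(1)[OF car(1)[OF w] car(2)[OF w] YL(3)[OF w] Ypos[OF w] \<epsilon> Ybd[OF w] B(1)])
  obtain H where H: "\<And>w p q. cmod w = 1 \<Longrightarrow> p < m \<Longrightarrow> q < m \<Longrightarrow>
       (\<Sum>k<m. (L w $$ (p, k) + cnj (L w $$ (k, p))) * H w k q) = (if p = q then 1 else (0 :: complex))"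
  proof -
    have "\<forall>w. \<exists>H. cmod w = 1 \<longrightarrow> (\<forall>p<m. \<forall>q<m. (\<Sum>k<m. (L w $$ (p, k) + cnj (L w $$ (k, p))) * H k q) = (if p = q then 1 else (0 :: complex)))"
      using ex_H by blast
    from choice[OF this] show ?thesis using that by blast
  qed
  have Lpos: "c * (\<Sum>p<m. (cmod (x p))\<^sup>2) \<le> Re (kform {..<m} (\<lambda>i j. L w $$ (i, j)) x)" if w: "cmod w = 1" for w x
    unfolding c_def
    by (rule factor_boundary_positive(2)[OF car(1)[OF w] car(2)[OF w] YL(3)[OF w] Ypos[OF w] \<epsilon> Ybd[OF w] B(1)])
  have lim: "((\<lambda>r. F (of_real r * w) $$ (p, q)) \<longlongrightarrow> L w $$ (p, q)) (at_right 1)" if "cmod w = 1" "p < m" "q < m" for w p q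
    using YL(2)[OF that(1)] that unfolding has_boundary_value_def by blast
  have unif: "\<forall>\<^sub>F r in at_right 1. \<forall>p<m. \<forall>q<m. \<forall>w. cmod w = 1 \<longrightarrow> cmod (F (of_real r * w) $$ (p, q) - L w $$ (p, q)) < \<eta>"
    if \<eta>: "0 < \<eta>" for \<eta>
  proof -
    have "\<forall>\<^sub>F r in at_right 1. \<forall>w. cmod w = 1 \<longrightarrow> cmod (F (of_real r * w) $$ (p, q) - L w $$ (p, q)) < \<eta>"
      if pq: "p < m" "q < m" for p q
    proof -
      obtain a b where ab: "\<And>z. z \<in> outer_disc \<Longrightarrow> poly b z \<noteq> 0 \<and> F z $$ (p, q) = poly a z / poly b z"
        using rat pq unfolding mat_rational_on_def by blast
      show ?thesis
        by (rule bounded_rational_uniform[where f = "\<lambda>z. F z $$ (p, q)", OF ab BF(2)[OF _ pq] lim[OF _ pq] \<eta>])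
    qed
    then have "\<forall>\<^sub>F r in at_right 1. \<forall>p\<in>{..<m}. \<forall>q\<in>{..<m}. \<forall>w. cmod w = 1 \<longrightarrow> cmod (F (of_real r * w) $$ (p, q) - L w $$ (p, q)) < \<eta>"
      by (intro eventually_ball_finite ballI) auto
    then show ?thesis by (rule eventually_mono) auto
  qed
  show ?thesis
    unfolding m_def[symmetric] boundary_factor_def
  proof (rule exI[of _ c], rule exI[of _ "\<lambda>w i j. L w $$ (i, j)"], rule exI[of _ H], intro conjI allI impI)
    show "0 < c" by fact
  qed (rule lim H Lpos unif; assumption)+
qed


section \<open>Weak duality\<close>

lemma conv_cong: "(\<And>i. i \<le> k \<Longrightarrow> c i = c' i) \<Longrightarrow> (\<And>i. i \<le> k \<Longrightarrow> d i = d' i) \<Longrightarrow> conv c d k = conv c' d' k"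
  by (simp add: conv_def)

lemma SUP_eq_of_matching:
  fixes f :: "'a \<Rightarrow> ereal"
  assumes "\<And>x. x \<in> A \<Longrightarrow> \<exists>y\<in>B. f x = g y" "\<And>y. y \<in> B \<Longrightarrow> \<exists>x\<in>A. f x = g y"
  shows "(SUP x\<in>A. f x) = (SUP y\<in>B. g y)"
  by (intro antisym SUP_least) (metis assms SUP_upper)+

section \<open>The synthesis problem in terms of coefficient sequences\<close>

locale synthesis =
  fixes P :: plant and F :: "complex \<Rightarrow> complex mat" and \<epsilon> \<tau> :: real
  assumes P_class: "P \<in> plant_class" and \<epsilon>_pos: "\<epsilon> > 0" and \<tau>_pos: "\<tau> > 0"
    and F_factor: "is_factor P \<epsilon> \<tau> F"
begin

abbreviation "m \<equiv> n_u P"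

definition "fz_coeff i j = markov_entry (\<lambda>q. P_fz P \<tau> q $$ (i, j))"
definition "uz_coeff i p = markov_entry (\<lambda>q. P_uz P \<tau> q $$ (i, p))"
definition "fy_coeff p j = markov_entry (\<lambda>q. P_fy P \<tau> q $$ (p, j))"
definition "F_coeff k p q = markov_entry (\<lambda>z. F z $$ (p, q)) k"

lemma F_H_inf: "F \<in> H_inf outer_disc m m"
  using F_factor unfolding is_factor_def by blast

lemma has_markov_plant:
  "i < n_z P \<Longrightarrow> j < n_w P \<Longrightarrow> has_markov (fz_coeff i j) (\<lambda>q. P_fz P \<tau> q $$ (i, j))"
  "i < n_z P \<Longrightarrow> p < m \<Longrightarrow> has_markov (uz_coeff i p) (\<lambda>q. P_uz P \<tau> q $$ (i, p))"
  "p < m \<Longrightarrow> j < n_w P \<Longrightarrow> has_markov (fy_coeff p j) (\<lambda>q. P_fy P \<tau> q $$ (p, j))"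
  "p < m \<Longrightarrow> p' < m \<Longrightarrow> has_markov (\<lambda>k. F_coeff k p p') (\<lambda>q. F q $$ (p, p'))"
  unfolding fz_coeff_def uz_coeff_def fy_coeff_def F_coeff_def
  using plant_class_H_inf[OF P_class \<tau>_pos] F_H_inf by (auto intro!: H_inf_has_markov)

text \<open>Coefficients of the closed loop by convolution. The sequence \<open>X\<close> is
  arbitrary and need not belong to a function, so truncations and formal limits are covered as
  well.\<close>

definition T_coeff :: "(nat \<Rightarrow> nat \<Rightarrow> nat \<Rightarrow> complex) \<Rightarrow> nat \<Rightarrow> nat \<Rightarrow> nat \<Rightarrow> complex" where
  "T_coeff X i j k = fz_coeff i j k - (\<Sum>q<m. conv (\<lambda>k. \<Sum>p<m. conv (uz_coeff i p) (\<lambda>k. X k p q) k) (fy_coeff q j) k)"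

definition objective :: "nat \<Rightarrow> (nat \<Rightarrow> nat \<Rightarrow> nat \<Rightarrow> complex) \<Rightarrow> real" where
  "objective n X = 1 / \<tau> * (\<Sum>k\<le>n. \<Sum>i<n_z P. \<Sum>j<n_w P. (cmod (T_coeff X i j k))\<^sup>2)"

definition V_coeff :: "(nat \<Rightarrow> nat \<Rightarrow> nat \<Rightarrow> complex) \<Rightarrow> nat \<Rightarrow> nat \<Rightarrow> nat \<Rightarrow> complex" where
  "V_coeff X k = Vk m (X k) (F_coeff k)"

text \<open>Twice the Hermitian part of the block Toeplitz matrix of V; that it is positive
  semidefinite on \<open>idx n (2 * m)\<close> is the relaxed constraint of order n.\<close>

definition V_kernel :: "(nat \<Rightarrow> nat \<Rightarrow> nat \<Rightarrow> complex) \<Rightarrow> nat \<times> nat \<Rightarrow> nat \<times> nat \<Rightarrow> complex" where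
  "V_kernel X a b = toep (V_coeff X) a b + cnj (toep (V_coeff X) b a)"

lemma T_coeff_cong:
  assumes "\<And>l p q. l \<le> k \<Longrightarrow> p < m \<Longrightarrow> q < m \<Longrightarrow> X l p q = X' l p q"
  shows "T_coeff X i j k = T_coeff X' i j k"
  unfolding T_coeff_def using assms by (auto intro!: sum.cong conv_cong)

lemma objective_cong:
  assumes "\<And>l p q. l \<le> n \<Longrightarrow> p < m \<Longrightarrow> q < m \<Longrightarrow> X l p q = X' l p q"
  shows "objective n X = objective n X'"
proof -
  have "T_coeff X i j k = T_coeff X' i j k" if "k \<le> n" for i j k
    by (rule T_coeff_cong) (use assms that in auto)
  then show ?thesis unfolding objective_def by simp
qed

lemma V_coeff_cong:
  assumes "\<And>p q. p < m \<Longrightarrow> q < m \<Longrightarrow> X k p q = X' k p q" "p < 2 * m"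
  shows "V_coeff X k p q = V_coeff X' k p q"
  using assms by (simp add: V_coeff_def Vk_def)

lemma V_kernel_cong:
  assumes "\<And>l p q. l \<le> n \<Longrightarrow> p < m \<Longrightarrow> q < m \<Longrightarrow> X l p q = X' l p q" "a \<in> idx n (2 * m)" "b \<in> idx n (2 * m)"
  shows "V_kernel X a b = V_kernel X' a b"
proof -
  have "V_coeff X k p q = V_coeff X' k p q" if "k \<le> n" "p < 2 * m" for k p q
    by (rule V_coeff_cong) (use assms(1) that in auto)
  then show ?thesis using assms(2,3) by (simp add: V_kernel_def toep_def idx_def split: prod.splits) auto
qed

lemma objective_mono: "n \<le> n' \<Longrightarrow> objective n X \<le> objective n' X"
  unfolding objective_def using \<tau>_pos by (intro mult_left_mono sum_mono2) (auto intro!: sum_nonneg)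

lemma T_fz_carrier:
  assumes "z \<in> outer_disc" "Q z \<in> carrier_mat m m"
  shows "T_fz P \<tau> Q z \<in> carrier_mat (n_z P) (n_w P)"
  using plant_class_H_inf[OF P_class \<tau>_pos, THEN H_inf_carrier, OF assms(1)] assms(2)
  unfolding T_fz_def by (metis minus_carrier_mat mult_carrier_mat)

lemma T_fz_index:
  assumes z: "z \<in> outer_disc" and Q: "Q z \<in> carrier_mat m m" and ij: "i < n_z P" "j < n_w P"
  shows "T_fz P \<tau> Q z $$ (i, j) = P_fz P \<tau> z $$ (i, j)
    - (\<Sum>q<m. (\<Sum>p<m. P_uz P \<tau> z $$ (i, p) * Q z $$ (p, q)) * P_fy P \<tau> z $$ (q, j))"
proof -
  note H = plant_class_H_inf[OF P_class \<tau>_pos, THEN H_inf_carrier, OF z]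
  have UQ: "P_uz P \<tau> z * Q z \<in> carrier_mat (n_z P) m" using H(3) Q by (rule mult_carrier_mat)
  have e: "(P_uz P \<tau> z * Q z) $$ (i, q) = (\<Sum>p<m. P_uz P \<tau> z $$ (i, p) * Q z $$ (p, q))" if "q < m" for q
    using H(3) Q ij that by (simp add: scalar_prod_def lessThan_atLeast0)
  have "(Y * P_fy P \<tau> z) $$ (i, j) = (\<Sum>q<m. Y $$ (i, q) * P_fy P \<tau> z $$ (q, j))" if "Y \<in> carrier_mat (n_z P) m" for Y
    using that H(2) ij by (simp add: scalar_prod_def lessThan_atLeast0)
  from this[OF UQ] have e2: "(P_uz P \<tau> z * Q z * P_fy P \<tau> z) $$ (i, j)
    = (\<Sum>q<m. (\<Sum>p<m. P_uz P \<tau> z $$ (i, p) * Q z $$ (p, q)) * P_fy P \<tau> z $$ (q, j))" by (simp add: e)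
  have UQF: "P_uz P \<tau> z * Q z * P_fy P \<tau> z \<in> carrier_mat (n_z P) (n_w P)" using UQ H(2) by (rule mult_carrier_mat)
  have "T_fz P \<tau> Q z $$ (i, j) = P_fz P \<tau> z $$ (i, j) - (P_uz P \<tau> z * Q z * P_fy P \<tau> z) $$ (i, j)"
    unfolding T_fz_def by (rule index_minus_mat(1)) (use UQF ij in auto)
  then show ?thesis unfolding e2 .
qed

lemma has_markov_T_fz:
  assumes Q: "\<And>z. z \<in> outer_disc \<Longrightarrow> Q z \<in> carrier_mat m m"
    and X: "\<And>p q. p < m \<Longrightarrow> q < m \<Longrightarrow> has_markov (\<lambda>k. X k p q) (\<lambda>z. Q z $$ (p, q))"
    and ij: "i < n_z P" "j < n_w P"
  shows "has_markov (T_coeff X i j) (\<lambda>z. T_fz P \<tau> Q z $$ (i, j))"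
proof (rule has_markov_cong)
  show "has_markov (T_coeff X i j) (\<lambda>z. P_fz P \<tau> z $$ (i, j)
    - (\<Sum>q<m. (\<Sum>p<m. P_uz P \<tau> z $$ (i, p) * Q z $$ (p, q)) * P_fy P \<tau> z $$ (q, j)))"
    unfolding T_coeff_def[abs_def]
    by (intro has_markov_diff has_markov_sum has_markov_mult has_markov_plant X) (use ij in auto)
qed (use T_fz_index Q ij in simp)

text \<open>By causality the coefficients up to n involve \<open>Q\<close> only up to n, so filling
  up with zeros beyond n does not change the value.\<close>

lemma gamma_check_eq: "gamma_check P \<tau> n Qc = objective n (\<lambda>k p q. Qc k $$ (p, q))"
proof -
  define X where "X = (\<lambda>k p q. if k \<le> n then Qc k $$ (p, q) else 0)"
  have car: "fir m n Qc z \<in> carrier_mat m m" for z by (simp add: fir_def)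
  have mk: "has_markov (\<lambda>k. X k p q) (\<lambda>z. fir m n Qc z $$ (p, q))" if "p < m" "q < m" for p q
    using has_markov_finite[of n "\<lambda>k. Qc k $$ (p, q)"] that by (simp add: fir_def X_def)
  have "gamma_check P \<tau> n Qc = objective n X"
  proof -
    have "(let T = markov (n_z P) (n_w P) (T_fz P \<tau> (fir m n Qc)) k in Re (mat_trace (mat_adjoint T * T)))
      = (\<Sum>i<n_z P. \<Sum>j<n_w P. (cmod (T_coeff X i j k))\<^sup>2)" for k
    proof -
      have c: "markov (n_z P) (n_w P) (T_fz P \<tau> (fir m n Qc)) k \<in> carrier_mat (n_z P) (n_w P)"
        by (simp add: markov_def)
      have "markov (n_z P) (n_w P) (T_fz P \<tau> (fir m n Qc)) k $$ (i, j) = T_coeff X i j k"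
        if "i < n_z P" "j < n_w P" for i j
        by (rule markov_eqI[OF has_markov_T_fz[OF car mk]]) (use that in auto)
      then show ?thesis unfolding Let_def trace_adjoint_mult[OF c] by simp
    qed
    then show ?thesis unfolding gamma_check_def objective_def by simp
  qed
  also have "\<dots> = objective n (\<lambda>k p q. Qc k $$ (p, q))" by (rule objective_cong) (simp add: X_def)
  finally show ?thesis .
qed

lemma op3_objective_ge:
  assumes Q: "\<And>z. z \<in> outer_disc \<Longrightarrow> Q z \<in> carrier_mat m m"
    and X: "\<And>p q. p < m \<Longrightarrow> q < m \<Longrightarrow> has_markov (\<lambda>k. X k p q) (\<lambda>z. Q z $$ (p, q))"
  shows "ereal (objective n X) \<le> op3_objective P \<tau> Q"
proof -
  have "ereal (\<Sum>k\<le>n. \<Sum>i<n_z P. \<Sum>j<n_w P. (cmod (T_coeff X i j k))\<^sup>2) \<le> h2_norm_sq (T_fz P \<tau> Q)"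
    by (rule h2_norm_sq_ge[OF has_markov_T_fz[OF Q X] T_fz_carrier[OF _ Q]])
  then have "ereal (1 / \<tau>) * ereal (\<Sum>k\<le>n. \<Sum>i<n_z P. \<Sum>j<n_w P. (cmod (T_coeff X i j k))\<^sup>2) \<le> op3_objective P \<tau> Q"
    unfolding op3_objective_def using \<tau>_pos by (intro ereal_mult_left_mono) auto
  then show ?thesis by (simp add: objective_def)
qed

lemma op3_objective_le:
  assumes Q: "\<And>z. z \<in> outer_disc \<Longrightarrow> Q z \<in> carrier_mat m m"
    and X: "\<And>p q. p < m \<Longrightarrow> q < m \<Longrightarrow> has_markov (\<lambda>k. X k p q) (\<lambda>z. Q z $$ (p, q))"
    and bd: "\<And>n. objective n X \<le> B"
  shows "op3_objective P \<tau> Q \<le> ereal B"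
proof -
  have "h2_norm_sq (T_fz P \<tau> Q) \<le> ereal (\<tau> * B)"
  proof (rule h2_norm_sq_le[OF has_markov_T_fz[OF Q X] T_fz_carrier[OF _ Q]])
    fix n show "(\<Sum>k\<le>n. \<Sum>i<n_z P. \<Sum>j<n_w P. (cmod (T_coeff X i j k))\<^sup>2) \<le> \<tau> * B"
      using bd[of n] \<tau>_pos by (simp add: objective_def field_simps)
  qed
  then have "op3_objective P \<tau> Q \<le> ereal (1 / \<tau>) * ereal (\<tau> * B)"
    unfolding op3_objective_def using \<tau>_pos by (intro ereal_mult_left_mono) auto
  then show ?thesis using \<tau>_pos by simp
qed

section \<open>From the constraint on the circle to Toeplitz forms\<close>

lemma has_markov_V_coeff:
  assumes "\<And>p q. p < m \<Longrightarrow> q < m \<Longrightarrow> has_markov (\<lambda>k. X k p q) (\<lambda>z. Q z $$ (p, q))" "p < 2 * m" "q < 2 * m"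
  shows "has_markov (\<lambda>k. V_coeff X k p q) (\<lambda>z. Vk m (\<lambda>p q. Q z $$ (p, q)) (\<lambda>p q. F z $$ (p, q)) p q)"
  using assms has_markov_plant(4) has_markov_zero unfolding V_coeff_def Vk_def
  by (cases "q < m"; cases "p < m") auto

lemma op3_U_index:
  assumes "z \<in> outer_disc" "Q z \<in> carrier_mat m m" "p < 2 * m" "q < 2 * m"
  shows "op3_U P F Q z $$ (p, q) = Uk m (\<lambda>p q. Q z $$ (p, q)) (\<lambda>p q. F z $$ (p, q)) p q"
  using assms H_inf_carrier[OF F_H_inf assms(1)] by (auto simp: op3_U_def Uk_def index_mat_four_block)

text \<open>At almost every point of the circle the constraint on U is turned into the one on V,
  using that the Hermitian part of the factor is invertible there; averaging over the circle then
  yields the Toeplitz forms.\<close>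

lemma op3_feasible_toep_nonneg:
  assumes feas: "Q \<in> op3_feasible P F"
    and X: "\<And>p q. p < m \<Longrightarrow> q < m \<Longrightarrow> has_markov (\<lambda>k. X k p q) (\<lambda>z. Q z $$ (p, q))"
  shows "0 \<le> Re (kform (idx n (2 * m)) (toep (V_coeff X)) x)"
proof -
  have QH: "Q \<in> H_inf outer_disc m m" using feas by (simp add: op3_feasible_def)
  note Qc = H_inf_carrier[OF QH]
  obtain BQ where BQ: "0 \<le> BQ" "\<And>q i j. q \<in> outer_disc \<Longrightarrow> i < m \<Longrightarrow> j < m \<Longrightarrow> cmod (Q q $$ (i, j)) \<le> BQ"
    using H_inf_bound[OF QH] by blast
  obtain BF where BF: "0 \<le> BF" "\<And>q i j. q \<in> outer_disc \<Longrightarrow> i < m \<Longrightarrow> j < m \<Longrightarrow> cmod (F q $$ (i, j)) \<le> BF"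
    using H_inf_bound[OF F_H_inf] by blast
  obtain c LF H where bf: "boundary_factor m F c LF H"
    using boundary_factor_exists[OF P_class \<epsilon>_pos \<tau>_pos F_factor] by blast
  note LF = boundary_factorD(2)[OF bf] and H = boundary_factorD(3)[OF bf]
  show ?thesis
  proof (rule toep_nonneg_of_boundary[OF has_markov_V_coeff[OF X], where B = "max BQ BF"])
    fix p q z assume "p < 2 * m" "q < 2 * m" "z \<in> outer_disc"
    then show "cmod (Vk m (\<lambda>p q. Q z $$ (p, q)) (\<lambda>p q. F z $$ (p, q)) p q) \<le> max BQ BF"
      using BQ BF by (auto simp: Vk_def le_max_iff_disj)
  next
    have "AE \<Omega> in lebesgue_on {-pi..pi}. \<exists>L. has_boundary_value (op3_U P F Q) (cis \<Omega>) (2 * m) (2 * m) L \<and>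
       0\<^sub>m (2 * m) (2 * m) \<preceq>\<^sub>H L + mat_adjoint L" using feas by (simp add: op3_feasible_def)
    then show "AE \<Omega> in lebesgue_on {-pi..pi}. \<exists>L.
      (\<forall>p<2 * m. \<forall>q<2 * m. ((\<lambda>r. Vk m (\<lambda>p q. Q (of_real r * cis \<Omega>) $$ (p, q)) (\<lambda>p q. F (of_real r * cis \<Omega>) $$ (p, q)) p q)
         \<longlongrightarrow> L p q) (at_right 1)) \<and> (\<forall>y. 0 \<le> Re (kform {..<2 * m} L y))"
    proof eventually_elim
      case (elim \<Omega>)
      define w where "w = cis \<Omega>"
      have w: "cmod w = 1" by (simp add: w_def)
      obtain L where L: "has_boundary_value (op3_U P F Q) w (2 * m) (2 * m) L" "0\<^sub>m (2 * m) (2 * m) \<preceq>\<^sub>H L + mat_adjoint L"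
        using elim unfolding w_def by blast
      have Lc: "L \<in> carrier_mat (2 * m) (2 * m)" using L(1) by (simp add: has_boundary_value_def)
      have U: "((\<lambda>r. Uk m (\<lambda>p q. Q (of_real r * w) $$ (p, q)) (\<lambda>p q. F (of_real r * w) $$ (p, q)) p q) \<longlongrightarrow> L $$ (p, q)) (at_right 1)"
        if pq: "p < 2 * m" "q < 2 * m" for p q
      proof (rule Lim_transform_eventually)
        show "((\<lambda>r. op3_U P F Q (of_real r * w) $$ (p, q)) \<longlongrightarrow> L $$ (p, q)) (at_right 1)"
          using L(1) pq unfolding has_boundary_value_def by blast
        show "\<forall>\<^sub>F r in at_right 1. op3_U P F Q (of_real r * w) $$ (p, q) = Uk m (\<lambda>p q. Q (of_real r * w) $$ (p, q)) (\<lambda>p q. F (of_real r * w) $$ (p, q)) p q"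
          using eventually_outer_disc[OF w] by eventually_elim (rule op3_U_index[OF _ Qc pq])
      qed
      \<comment> \<open>The upper left block of the boundary value of U is the radial limit of
        \<open>Q\<close>. With the known limit of the factor it determines \<open>L\<close>, since
        radial limits are unique.\<close>
      define LQ where "LQ = (\<lambda>p q. L $$ (p, q))"
      have QL: "((\<lambda>r. Q (of_real r * w) $$ (p, q)) \<longlongrightarrow> LQ p q) (at_right 1)" if "p < m" "q < m" for p q
        using U[of p q] that by (simp add: Uk_def LQ_def)
      have lim: "((\<lambda>r. Uk m (\<lambda>p q. Q (of_real r * w) $$ (p, q)) (\<lambda>p q. F (of_real r * w) $$ (p, q)) p q) \<longlongrightarrow> Uk m LQ (LF w) p q) (at_right 1)"
        if "p < 2 * m" "q < 2 * m" for p q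
        using that QL LF[OF w] unfolding Uk_def by (cases "p < m"; cases "q < m") auto
      have "L $$ (p, q) = Uk m LQ (LF w) p q" if "p < 2 * m" "q < 2 * m" for p q
        by (rule tendsto_unique[OF _ U lim]) (use that in auto)
      then have "kform {..<2 * m} (\<lambda>p q. L $$ (p, q)) y = kform {..<2 * m} (Uk m LQ (LF w)) y" for y
        by (intro kform_cong) auto
      then have "\<forall>y. 0 \<le> Re (kform {..<2 * m} (Uk m LQ (LF w)) y)"
        using L(2) herm_le_zero_add_adjoint[OF Lc] by simp
      then have "\<forall>y. 0 \<le> Re (kform {..<2 * m} (Vk m LQ (LF w)) y)"
        using Uk_nonneg_iff_Vk_nonneg[OF H[OF w], of LQ] by blast
      moreover have "((\<lambda>r. Vk m (\<lambda>p q. Q (of_real r * w) $$ (p, q)) (\<lambda>p q. F (of_real r * w) $$ (p, q)) p q) \<longlongrightarrow> Vk m LQ (LF w) p q) (at_right 1)"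
        if "p < 2 * m" "q < 2 * m" for p q
        using that QL LF[OF w] unfolding Vk_def by (cases "p < m"; cases "q < m") auto
      ultimately show ?case unfolding w_def by blast
    qed
  qed
qed

text \<open>The Lagrange dual function of minimising \<open>objective n\<close> subject to a
  positive semidefinite \<open>V_kernel\<close>, with \<open>Z\<close> as multiplier. Kernels with
  equal diagonal sums correspond to the same \<Xi> and have the same dual value.\<close>

definition dual :: "nat \<Rightarrow> (nat \<times> nat \<Rightarrow> nat \<times> nat \<Rightarrow> complex) \<Rightarrow> ereal" where
  "dual n Z = (INF Qc \<in> {Qc. \<forall>k\<le>n. Qc k \<in> carrier_mat m m}.
     ereal (objective n (\<lambda>k p q. Qc k $$ (p, q)) - Re (\<Sum>a\<in>idx n (2 * m). \<Sum>b\<in>idx n (2 * m).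
       cnj (Z a b) * V_kernel (\<lambda>k p q. Qc k $$ (p, q)) a b)))"

lemma op6_V_index:
  assumes "Qc k \<in> carrier_mat m m" "p < 2 * m" "q < 2 * m"
  shows "op6_V P F Qc k $$ (p, q) = V_coeff (\<lambda>k p q. Qc k $$ (p, q)) k p q"
proof -
  have "markov m m F k \<in> carrier_mat m m" by (simp add: markov_def)
  moreover have "markov m m F k $$ (p, q) = F_coeff k p q" if "p < m" "q < m" for p q
    using that by (simp add: markov_def F_coeff_def)
  ultimately show ?thesis using assms by (auto simp: op6_V_def V_coeff_def Vk_def index_mat_four_block)
qed

lemma op6_dual_eq:
  assumes Z: "kpsd (idx n (2 * m)) Z"
    and car: "\<And>k. k \<le> n \<Longrightarrow> Xi_block (2 * m) n X23 X33 k \<in> carrier_mat (2 * m) (2 * m)"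
    and Xi: "\<forall>k\<le>n. \<forall>p<2 * m. \<forall>q<2 * m. Xi_block (2 * m) n X23 X33 k $$ (p, q) = diag_sum n Z k p q"
  shows "op6_dual P \<tau> F n X23 X33 = dual n Z"
  unfolding op6_dual_def dual_def
proof (rule INF_cong[OF refl])
  fix Qc :: "nat \<Rightarrow> complex mat" assume "Qc \<in> {Qc. \<forall>k\<le>n. Qc k \<in> carrier_mat m m}"
  then have Qc: "Qc k \<in> carrier_mat m m" if "k \<le> n" for k using that by blast
  have V: "op6_V P F Qc k \<in> carrier_mat (2 * m) (2 * m)" if "k \<le> n" for k
    unfolding op6_V_def mult_2 by (rule four_block_carrier_mat) (use Qc[OF that] in \<open>auto simp: markov_def\<close>)
  have "(\<Sum>k\<le>n. mat_trace (op6_V P F Qc k * Xi_block (2 * m) n X23 X33 k))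
    = (\<Sum>a\<in>idx n (2 * m). \<Sum>b\<in>idx n (2 * m). cnj (Z a b) * toep (V_coeff (\<lambda>k p q. Qc k $$ (p, q))) a b)"
    by (rule trace_Xi_eq_inner[OF Z V car]) (use Xi op6_V_index Qc in auto)
  then show "ereal (gamma_check P \<tau> n Qc - 2 * Re (\<Sum>k\<le>n. mat_trace (op6_V P F Qc k * Xi_block (2 * m) n X23 X33 k)))
    = ereal (objective n (\<lambda>k p q. Qc k $$ (p, q)) - Re (\<Sum>a\<in>idx n (2 * m). \<Sum>b\<in>idx n (2 * m).
       cnj (Z a b) * V_kernel (\<lambda>k p q. Qc k $$ (p, q)) a b))"
    unfolding gamma_check_eq V_kernel_def inner_add_adjoint[OF Z] by simp
qed

lemma Xi_block_carrier: "X33 \<in> carrier_mat M M \<Longrightarrow> Xi_block M n X23 X33 k \<in> carrier_mat M M"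
  by (simp add: Xi_block_def)

text \<open>The slack matrix is gone: multipliers and kernels are matched in both directions so that
  dual values agree, which is enough for equal suprema although the matching is not a
  bijection.\<close>

lemma op6_value_eq:
  assumes n: "0 < n"
  shows "op6_value P \<tau> F n = (SUP Z \<in> {Z. kpsd (idx n (2 * m)) Z}. dual n Z)"
  unfolding op6_value_def
proof (rule SUP_eq_of_matching)
  fix x assume x: "x \<in> op6_feasible (2 * m) n"
  obtain X23 X33 S where xe: "x = (X23, X33, S)" by (cases x)
  have X33: "X33 \<in> carrier_mat (2 * m) (2 * m)" using x unfolding xe op6_feasible_def by blast
  obtain Z where "kpsd (idx n (2 * m)) Z"
    "\<forall>k\<le>n. \<forall>p<2 * m. \<forall>q<2 * m. Xi_block (2 * m) n X23 X33 k $$ (p, q) = diag_sum n Z k p q"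
    using op6_feasible_imp_kernel[OF n] x unfolding xe by blast
  then show "\<exists>y\<in>{Z. kpsd (idx n (2 * m)) Z}. (case x of (X23, X33, S) \<Rightarrow> op6_dual P \<tau> F n X23 X33) = dual n y"
    using op6_dual_eq[OF _ Xi_block_carrier[OF X33]] unfolding xe by auto
next
  fix Z assume "Z \<in> {Z. kpsd (idx n (2 * m)) Z}"
  then have Z: "kpsd (idx n (2 * m)) Z" by simp
  obtain X23 X33 S where x: "(X23, X33, S) \<in> op6_feasible (2 * m) n"
    and Xi: "\<forall>k\<le>n. \<forall>p<2 * m. \<forall>q<2 * m. Xi_block (2 * m) n X23 X33 k $$ (p, q) = diag_sum n Z k p q"
    using kernel_imp_op6_feasible[OF n Z] by blast
  have X33: "X33 \<in> carrier_mat (2 * m) (2 * m)" using x unfolding op6_feasible_def by blast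
  have "op6_dual P \<tau> F n X23 X33 = dual n Z" by (rule op6_dual_eq[OF Z Xi_block_carrier[OF X33] Xi])
  then show "\<exists>x\<in>op6_feasible (2 * m) n. (case x of (X23, X33, S) \<Rightarrow> op6_dual P \<tau> F n X23 X33) = dual n Z"
    using x by (intro bexI[of _ "(X23, X33, S)"]) auto
qed

text \<open>The coefficients of a feasible \<open>Q\<close> compete in the infimum. There the
  multiplier term has a favourable sign, as the inner product of two positive semidefinite kernels,
  and the truncated objective is at most the full one.\<close>

lemma dual_le_objective:
  assumes Z: "kpsd (idx n (2 * m)) Z" and feas: "Q \<in> op3_feasible P F"
  shows "dual n Z \<le> op3_objective P \<tau> Q"
proof -
  have QH: "Q \<in> H_inf outer_disc m m" using feas by (simp add: op3_feasible_def)
  define X where "X = (\<lambda>k p q. markov_entry (\<lambda>z. Q z $$ (p, q)) k)"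
  have X: "has_markov (\<lambda>k. X k p q) (\<lambda>z. Q z $$ (p, q))" if "p < m" "q < m" for p q
    unfolding X_def by (rule H_inf_has_markov[OF QH refl that])
  define Qc where "Qc = (\<lambda>k. mat m m (\<lambda>(p, q). X k p q))"
  have Qc: "Qc k $$ (p, q) = X k p q" if "p < m" "q < m" for k p q using that by (simp add: Qc_def)
  have "kpsd (idx n (2 * m)) (V_kernel X)"
    unfolding V_kernel_def[abs_def] kpsd_add_adjoint[OF finite_idx] using op3_feasible_toep_nonneg[OF feas X] by blast
  then have pos: "0 \<le> Re (\<Sum>a\<in>idx n (2 * m). \<Sum>b\<in>idx n (2 * m). cnj (Z a b) * V_kernel X a b)"
    by (rule kpsd_inner_nonneg[OF finite_idx Z])
  have "dual n Z \<le> ereal (objective n (\<lambda>k p q. Qc k $$ (p, q)) - Re (\<Sum>a\<in>idx n (2 * m). \<Sum>b\<in>idx n (2 * m).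
       cnj (Z a b) * V_kernel (\<lambda>k p q. Qc k $$ (p, q)) a b))"
    unfolding dual_def by (rule INF_lower) (simp add: Qc_def)
  also have "(\<Sum>a\<in>idx n (2 * m). \<Sum>b\<in>idx n (2 * m). cnj (Z a b) * V_kernel (\<lambda>k p q. Qc k $$ (p, q)) a b)
      = (\<Sum>a\<in>idx n (2 * m). \<Sum>b\<in>idx n (2 * m). cnj (Z a b) * V_kernel X a b)"
  proof (intro sum.cong refl)
    fix a b assume "a \<in> idx n (2 * m)" "b \<in> idx n (2 * m)"
    then have "V_kernel (\<lambda>k p q. Qc k $$ (p, q)) a b = V_kernel X a b" by (intro V_kernel_cong Qc) auto
    then show "cnj (Z a b) * V_kernel (\<lambda>k p q. Qc k $$ (p, q)) a b = cnj (Z a b) * V_kernel X a b" by simp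
  qed
  also have "objective n (\<lambda>k p q. Qc k $$ (p, q)) = objective n X" by (rule objective_cong) (rule Qc)
  also have "ereal (objective n X - Re (\<Sum>a\<in>idx n (2 * m). \<Sum>b\<in>idx n (2 * m). cnj (Z a b) * V_kernel X a b)) \<le> ereal (objective n X)"
    using pos by simp
  also have "\<dots> \<le> op3_objective P \<tau> Q" by (rule op3_objective_ge[OF H_inf_carrier[OF QH] X])
  finally show ?thesis .
qed

lemma op6_value_le_op3_value: "0 < n \<Longrightarrow> op6_value P \<tau> F n \<le> op3_value P \<tau> F"
  unfolding op6_value_eq op3_value_def by (intro SUP_least INF_greatest dual_le_objective) auto

text \<open>Padding \<open>Z\<close> with zeros leaves the pairing unchanged, while the objective of
  higher order only gains nonnegative terms.\<close>

lemma op6_value_mono: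
  assumes n: "0 < n" "n \<le> n'"
  shows "op6_value P \<tau> F n \<le> op6_value P \<tau> F n'"
proof -
  have "0 < n'" using n by simp
  let ?I = "idx n (2 * m)" and ?I' = "idx n' (2 * m)"
  have sub: "?I \<subseteq> ?I'" using n(2) by (auto simp: idx_def)
  have "dual n Z \<le> (SUP Z \<in> {Z. kpsd ?I' Z}. dual n' Z)" if Z: "kpsd ?I Z" for Z
  proof -
    define Z' where "Z' = (\<lambda>a b. if a \<in> ?I \<and> b \<in> ?I then Z a b else 0)"
    have restrict: "(\<Sum>a\<in>?I'. \<Sum>b\<in>?I'. g a b * Z' a b) = (\<Sum>a\<in>?I. \<Sum>b\<in>?I. g a b * Z a b)" for g
    proof -
      have "(\<Sum>a\<in>?I'. \<Sum>b\<in>?I'. g a b * Z' a b) = (\<Sum>a\<in>?I. \<Sum>b\<in>?I'. g a b * Z' a b)"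
        by (rule sum.mono_neutral_right) (use sub in \<open>auto simp: Z'_def\<close>)
      also have "\<dots> = (\<Sum>a\<in>?I. \<Sum>b\<in>?I. g a b * Z' a b)"
        by (intro sum.cong refl sum.mono_neutral_right) (use sub in \<open>auto simp: Z'_def\<close>)
      finally show ?thesis by (simp add: Z'_def)
    qed
    have restrict': "(\<Sum>a\<in>?I'. \<Sum>b\<in>?I'. cnj (Z' a b) * g a b) = (\<Sum>a\<in>?I. \<Sum>b\<in>?I. cnj (Z a b) * g a b)" for g
      using arg_cong[OF restrict[of "\<lambda>a b. cnj (g a b)"], of cnj] by (simp add: mult.commute)
    have "kpsd ?I' Z'"
    proof (rule kpsdI)
      fix a b show "Z' b a = cnj (Z' a b)"
        using kpsd_hermitian[OF Z, of a b] by (auto simp: Z'_def)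
    next
      fix x
      have "kform ?I' Z' x = kform ?I Z x"
        unfolding kform_def using restrict[of "\<lambda>a b. cnj (x a) * x b"] by (simp add: mult_ac)
      then show "0 \<le> Re (kform ?I' Z' x)" using kpsd_form_nonneg[OF Z] by simp
    qed
    moreover have "dual n Z \<le> dual n' Z'"
      unfolding dual_def
    proof (rule INF_mono)
      fix Qc :: "nat \<Rightarrow> complex mat" assume Qc: "Qc \<in> {Qc. \<forall>k\<le>n'. Qc k \<in> carrier_mat m m}"
      have "objective n (\<lambda>k p q. Qc k $$ (p, q)) \<le> objective n' (\<lambda>k p q. Qc k $$ (p, q))" by (rule objective_mono[OF n(2)])
      then show "\<exists>Qc'\<in>{Qc. \<forall>k\<le>n. Qc k \<in> carrier_mat m m}.
        ereal (objective n (\<lambda>k p q. Qc' k $$ (p, q)) - Re (\<Sum>a\<in>?I. \<Sum>b\<in>?I. cnj (Z a b) * V_kernel (\<lambda>k p q. Qc' k $$ (p, q)) a b))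
        \<le> ereal (objective n' (\<lambda>k p q. Qc k $$ (p, q)) - Re (\<Sum>a\<in>?I'. \<Sum>b\<in>?I'. cnj (Z' a b) * V_kernel (\<lambda>k p q. Qc k $$ (p, q)) a b))"
        unfolding restrict' using Qc n(2) by (intro bexI[of _ Qc]) auto
    qed
    ultimately show ?thesis using SUP_upper2[of Z' "{Z. kpsd ?I' Z}" "dual n Z" "dual n'"] by simp
  qed
  then show ?thesis unfolding op6_value_eq[OF n(1)] op6_value_eq[OF \<open>0 < n'\<close>] by (intro SUP_least) simp
qed

end


section \<open>Penalised approximants and their limit\<close>

lemma kpsd_two_point:
  assumes "kpsd I Y" "finite I" "a \<in> I" "b \<in> I" "a \<noteq> b"
  shows "0 \<le> Re (Y a a) + 2 * Re (cnj \<beta> * Y b a) + (cmod \<beta>)\<^sup>2 * Re (Y b b)"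
proof -
  have J: "kpsd {b, a} Y" by (rule kpsd_subset[OF assms(2) _ assms(1)]) (use assms in auto)
  define x where "x = (\<lambda>i. if i = b then \<beta> else 1)"
  have xa: "x a = 1" "x b = \<beta>" using assms(5) by (auto simp: x_def)
  have h: "Y i b = cnj (Y b i)" if "i \<in> {a}" for i
    using kpsd_hermitian[OF assms(1,4,3)] that by simp
  have "Re (kform {b, a} Y x) = (cmod \<beta>)\<^sup>2 * Re (Y b b) + 2 * Re (cnj \<beta> * Y b a) + Re (Y a a)"
    using kform_insert_hermitian[of "{a}" b Y x, OF _ _ h] assms(5) xa by (simp add: kform_def)
  then show ?thesis using kpsd_form_nonneg[OF J, of x] by simp
qed

text \<open>The phase of \<beta> is chosen opposite to that of \<open>X\<close> and its modulus
  equal to t, which turns the real part into - t |X|.\<close>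

lemma norm_le_of_two_point:
  fixes X :: complex
  assumes "\<And>\<beta>. 0 \<le> A + 2 * Re (cnj \<beta> * X) + (cmod \<beta>)\<^sup>2 * B + \<delta> * (1 + cmod \<beta>)\<^sup>2" and "0 \<le> t"
  shows "2 * t * cmod X \<le> A + t\<^sup>2 * B + \<delta> * (1 + t)\<^sup>2"
proof (cases "X = 0")
  case True
  then show ?thesis using assms(1)[of "of_real t"] assms(2) by simp
next
  case False
  define \<beta> where "\<beta> = - of_real (t / cmod X) * X"
  have "cmod \<beta> = t" using False assms(2) by (simp add: \<beta>_def norm_mult norm_divide)
  moreover have "cnj \<beta> * X = - of_real (t / cmod X) * of_real ((cmod X)\<^sup>2)"
    unfolding \<beta>_def complex_norm_square by simp
  then have "cnj \<beta> * X = of_real (- t * cmod X)" using False by (simp add: power2_eq_square)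
  then have "Re (cnj \<beta> * X) = - t * cmod X" by (simp only: Re_complex_of_real)
  ultimately show ?thesis using assms(1)[of \<beta>] by simp
qed

text \<open>A countable product of discs is compact and metrisable, hence sequentially compact; this
  replaces an explicit diagonal argument.\<close>

lemma bounded_fun_seq_convergent_subseq:
  fixes x :: "nat \<Rightarrow> 'a::countable \<Rightarrow> complex"
  assumes "\<And>n v. cmod (x n v) \<le> R"
  shows "\<exists>s l. strict_mono (s :: nat \<Rightarrow> nat) \<and> (\<forall>v. (\<lambda>n. x (s n) v) \<longlonglongrightarrow> l v) \<and> (\<forall>v. cmod (l v) \<le> R)"
proof -
  have "compact {f :: 'a \<Rightarrow> complex. \<forall>v. f v \<in> cball 0 R}" by (rule compact_coordinatewise) simp
  then have "seq_compact {f :: 'a \<Rightarrow> complex. \<forall>v. f v \<in> cball 0 R}" by (simp add: compact_eq_seq_compact_metric)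
  moreover have "\<forall>n. x n \<in> {f. \<forall>v. f v \<in> cball 0 R}" using assms by simp
  ultimately obtain l s where l: "l \<in> {f. \<forall>v. f v \<in> cball 0 R}" "strict_mono s" "(x \<circ> s) \<longlonglongrightarrow> l"
    unfolding seq_compact_def by blast
  have "(\<lambda>n. (x \<circ> s) n v) \<longlonglongrightarrow> l v" for v
    by (rule continuous_on_tendsto_compose[OF continuous_on_product_coordinates l(3)]) auto
  then show ?thesis using l(1,2) by (intro exI[of _ s] exI[of _ l]) auto
qed

context synthesis
begin

text \<open>The penalty method takes unknowns indexed by a single type, here the triples (k, p,
  q).\<close>

abbreviation curry3 :: "(nat \<times> nat \<times> nat \<Rightarrow> complex) \<Rightarrow> nat \<Rightarrow> nat \<Rightarrow> nat \<Rightarrow> complex" where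
  "curry3 x \<equiv> \<lambda>k p q. x (k, p, q)"

section \<open>Affinity, continuity and the base point required by the penalty method\<close>

lemma conv_affine1: "conv (\<lambda>k. c k + t * (d k - c k)) e n = conv c e n + t * (conv d e n - conv c e n)"
  unfolding conv_def by (simp add: algebra_simps sum.distrib sum_subtractf sum_distrib_left)

lemma conv_affine2: "conv e (\<lambda>k. c k + t * (d k - c k)) n = conv e c n + t * (conv e d n - conv e c n)"
  unfolding conv_def by (simp add: algebra_simps sum.distrib sum_subtractf sum_distrib_left)

lemma sum_affine:
  "(\<Sum>i\<in>I. c i + t * (d i - c i)) = (\<Sum>i\<in>I. c i) + t * ((\<Sum>i\<in>I. d i) - (\<Sum>i\<in>I. c i :: complex))"
  by (simp add: algebra_simps sum.distrib sum_subtractf sum_distrib_left)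

lemma T_coeff_affine:
  "T_coeff (\<lambda>k p q. X k p q + t * (X' k p q - X k p q)) i j k = T_coeff X i j k + t * (T_coeff X' i j k - T_coeff X i j k)"
  unfolding T_coeff_def conv_affine2 sum_affine conv_affine1 by (simp add: algebra_simps)

lemma toep_affine:
  "toep (V_coeff (\<lambda>k p q. X k p q + of_real t * (X' k p q - X k p q))) a b
    = toep (V_coeff X) a b + of_real t * (toep (V_coeff X') a b - toep (V_coeff X) a b)"
  by (simp add: toep_def V_coeff_def Vk_def)

lemma V_kernel_affine:
  "V_kernel (\<lambda>k p q. X k p q + of_real t * (X' k p q - X k p q)) a b = V_kernel X a b + of_real t * (V_kernel X' a b - V_kernel X a b)"
  unfolding V_kernel_def toep_affine by (simp add: algebra_simps)

lemma continuous_T_coeff: "continuous_on UNIV (\<lambda>x. T_coeff (curry3 x) i j k)"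
  unfolding T_coeff_def conv_def by (intro continuous_intros continuous_on_product_coordinates)

lemma continuous_toep: "continuous_on UNIV (\<lambda>x. toep (V_coeff (curry3 x)) a b)"
  unfolding toep_def V_coeff_def Vk_def
  by (cases "fst b \<le> fst a"; cases "snd b < m"; cases "snd a < m")
     (auto intro!: continuous_intros continuous_on_product_coordinates)

text \<open>At \<open>Q = 0\<close> the closed loop is \<open>P_fz\<close>, whose coefficients are
  square summable because it is bounded. The constant does not depend on n.\<close>

lemma objective_zero_bounded: obtains C where "0 \<le> C" "\<And>n. objective n (\<lambda>_ _ _. 0) \<le> C"
proof -
  have t0: "T_coeff (\<lambda>_ _ _. 0) i j k = fz_coeff i j k" for i j k by (simp add: T_coeff_def conv_def)
  obtain B where B: "0 \<le> B" "\<And>q i j. q \<in> outer_disc \<Longrightarrow> i < n_z P \<Longrightarrow> j < n_w P \<Longrightarrow> cmod (P_fz P \<tau> q $$ (i, j)) \<le> B"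
    using H_inf_bound[OF plant_class_H_inf(1)[OF P_class \<tau>_pos]] by blast
  define C where "C = 1 / \<tau> * (\<Sum>i<n_z P. \<Sum>j<n_w P. B\<^sup>2)"
  have "objective n (\<lambda>_ _ _. 0) \<le> C" for n
  proof -
    have "(\<Sum>k\<le>n. \<Sum>i<n_z P. \<Sum>j<n_w P. (cmod (fz_coeff i j k))\<^sup>2) = (\<Sum>i<n_z P. \<Sum>k\<le>n. \<Sum>j<n_w P. (cmod (fz_coeff i j k))\<^sup>2)"
      by (rule sum.swap)
    also have "\<dots> = (\<Sum>i<n_z P. \<Sum>j<n_w P. \<Sum>k\<le>n. (cmod (fz_coeff i j k))\<^sup>2)"
      by (intro sum.cong refl sum.swap)
    also have "\<dots> \<le> (\<Sum>i<n_z P. \<Sum>j<n_w P. B\<^sup>2)"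
      by (intro sum_mono has_markov_bounded_l2(1)[OF has_markov_plant(1) B(2)]) auto
    finally show ?thesis unfolding objective_def C_def t0 using \<tau>_pos by (intro mult_left_mono) auto
  qed
  moreover have "0 \<le> C" unfolding C_def using \<tau>_pos by (simp add: sum_nonneg)
  ultimately show ?thesis using that by blast
qed

lemma kform_V_kernel: "kform I (V_kernel X) x = of_real (2 * Re (kform I (toep (V_coeff X)) x))" if "finite I"
  unfolding V_kernel_def[abs_def] by (rule kform_add_adjoint[OF that])

text \<open>For \<open>Q = 0\<close> only the block of the factor remains, and its real part is
  positive on the circle. Hence 0 is admissible as the base point of the penalty method for every
  n.\<close>

lemma V_kernel_zero_kpsd: "kpsd (idx n (2 * m)) (V_kernel (\<lambda>_ _ _. 0))"
  unfolding V_kernel_def[abs_def] kpsd_add_adjoint[OF finite_idx]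
proof
  fix x
  obtain c LF H where bf: "boundary_factor m F c LF H"
    using boundary_factor_exists[OF P_class \<epsilon>_pos \<tau>_pos F_factor] by blast
  obtain BF where BF: "0 \<le> BF" "\<And>q i j. q \<in> outer_disc \<Longrightarrow> i < m \<Longrightarrow> j < m \<Longrightarrow> cmod (F q $$ (i, j)) \<le> BF"
    using H_inf_bound[OF F_H_inf] by blast
  have mk0: "has_markov (\<lambda>k. V_coeff (\<lambda>_ _ _. 0) k p q) (\<lambda>z. Vk m (\<lambda>_ _. 0) (\<lambda>p q. F z $$ (p, q)) p q)"
    if "p < 2 * m" "q < 2 * m" for p q
    using that has_markov_plant(4) has_markov_zero unfolding V_coeff_def Vk_def by (cases "q < m"; cases "p < m") auto
  show "0 \<le> Re (kform (idx n (2 * m)) (toep (V_coeff (\<lambda>_ _ _. 0))) x)"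
  proof (rule toep_nonneg_of_boundary[OF mk0, where B = BF])
    fix p q z assume "p < 2 * m" "q < 2 * m" "z \<in> outer_disc"
    then show "cmod (Vk m (\<lambda>_ _. 0) (\<lambda>p q. F z $$ (p, q)) p q) \<le> BF"
      using BF by (auto simp: Vk_def)
  next
    show "AE \<Omega> in lebesgue_on {-pi..pi}. \<exists>L.
      (\<forall>p<2 * m. \<forall>q<2 * m. ((\<lambda>r. Vk m (\<lambda>_ _. 0) (\<lambda>p q. F (of_real r * cis \<Omega>) $$ (p, q)) p q) \<longlongrightarrow> L p q) (at_right 1)) \<and>
      (\<forall>y. 0 \<le> Re (kform {..<2 * m} L y))"
    proof (rule AE_I2)
      fix \<Omega>
      have w: "cmod (cis \<Omega>) = 1" by simp
      have "((\<lambda>r. Vk m (\<lambda>_ _. 0) (\<lambda>p q. F (of_real r * cis \<Omega>) $$ (p, q)) p q) \<longlongrightarrow> Vk m (\<lambda>_ _. 0) (LF (cis \<Omega>)) p q) (at_right 1)"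
        if "p < 2 * m" "q < 2 * m" for p q
        using that boundary_factorD(2)[OF bf w] unfolding Vk_def by (cases "p < m"; cases "q < m") auto
      moreover have "0 \<le> Re (kform {..<2 * m} (Vk m (\<lambda>_ _. 0) (LF (cis \<Omega>))) y)" for y
      proof -
        define b where "b = (\<lambda>p. y (p + m))"
        have "0 \<le> c * (\<Sum>p<m. (cmod (b p))\<^sup>2)" using boundary_factorD(1)[OF bf] by (intro mult_nonneg_nonneg sum_nonneg) auto
        also have "\<dots> \<le> Re (kform {..<m} (LF (cis \<Omega>)) b)" by (rule boundary_factorD(4)[OF bf w])
        also have "\<dots> = Re (kform {..<2 * m} (Vk m (\<lambda>_ _. 0) (LF (cis \<Omega>))) y)"
          unfolding kform_Vk pass_form_def kform_eq_ip[of m] b_def by (simp add: ip_def mv_def)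
        finally show ?thesis .
      qed
      ultimately show "\<exists>L. (\<forall>p<2 * m. \<forall>q<2 * m. ((\<lambda>r. Vk m (\<lambda>_ _. 0) (\<lambda>p q. F (of_real r * cis \<Omega>) $$ (p, q)) p q) \<longlongrightarrow> L p q) (at_right 1)) \<and>
        (\<forall>y. 0 \<le> Re (kform {..<2 * m} L y))" by blast
    qed
  qed
qed

text \<open>Up to a factor 2 it bounds the diagonal entries of \<open>V_kernel\<close> that belong
  to the second block; these do not depend on \<open>X\<close>.\<close>

definition "F0_bound = (\<Sum>p<m. cmod (F_coeff 0 p p))"

lemma F_coeff_le_F0_bound: "p < m \<Longrightarrow> Re (F_coeff 0 p p) \<le> F0_bound"
  unfolding F0_bound_def by (rule order_trans[OF complex_Re_le_cmod], rule member_le_sum) auto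

text \<open>Near-feasibility already bounds the coefficients: test the form on two coordinates, first for
  the diagonal entries of the constant coefficient and then for all others.\<close>

lemma coefficients_bounded:
  assumes Y: "kpsd (idx n (2 * m)) Y" and \<delta>: "0 \<le> \<delta>"
    and d: "\<And>a b. a \<in> idx n (2 * m) \<Longrightarrow> b \<in> idx n (2 * m) \<Longrightarrow> cmod (V_kernel X a b - Y a b) \<le> \<delta>"
    and k: "k \<le> n" and pq: "p < m" "q < m"
  shows "cmod (X k p q) \<le> 5 * F0_bound + 7 * \<delta>"
proof -
  have two: "0 \<le> 2 * Re (X 0 q q) + 2 * Re (cnj \<beta> * X k p q) + (cmod \<beta>)\<^sup>2 * (2 * F0_bound) + \<delta> * (1 + cmod \<beta>)\<^sup>2"
    if k: "k \<le> n" and pq: "p < m" "q < m" for k p q \<beta>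
  proof -
    \<comment> \<open>Coordinate a lies in the first half of block 0 and b in the second half of
      block k. The entry at (b, a) is then exactly the unknown \<open>X k p q\<close>, and the one
      at (b, b) comes from the factor.\<close>
    define a where "a = (0 :: nat, q)"
    define b where "b = (k, p + m)"
    have ab: "a \<in> idx n (2 * m)" "b \<in> idx n (2 * m)" "a \<noteq> b" using k pq by (auto simp: a_def b_def idx_def)
    have Maa: "Re (V_kernel X a a) = 2 * Re (X 0 q q)" using pq by (simp add: V_kernel_def toep_def a_def V_coeff_def Vk_def)
    have Mbb: "Re (V_kernel X b b) = 2 * Re (F_coeff 0 p p)" using pq by (simp add: V_kernel_def toep_def b_def V_coeff_def Vk_def)
    have Mba: "V_kernel X b a = X k p q" using pq by (simp add: V_kernel_def toep_def a_def b_def V_coeff_def Vk_def)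
    have close: "Re (u * Y x y) \<le> Re (u * V_kernel X x y) + cmod u * \<delta>" if "x \<in> {a, b}" "y \<in> {a, b}" for x y u
    proof -
      have "Re (u * Y x y) - Re (u * V_kernel X x y) = Re (- u * (V_kernel X x y - Y x y))" by (simp add: algebra_simps)
      also have "\<dots> \<le> cmod (- u * (V_kernel X x y - Y x y))" by (rule complex_Re_le_cmod)
      also have "\<dots> \<le> cmod u * \<delta>" unfolding norm_mult norm_minus_cancel
        using that ab by (intro mult_left_mono d) auto
      finally show ?thesis by linarith
    qed
    have "0 \<le> Re (Y a a) + 2 * Re (cnj \<beta> * Y b a) + (cmod \<beta>)\<^sup>2 * Re (Y b b)"
      by (rule kpsd_two_point[OF Y finite_idx ab])
    moreover have "Re (Y a a) \<le> 2 * Re (X 0 q q) + \<delta>" using close[of a a 1] Maa by simp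
    moreover have "Re (cnj \<beta> * Y b a) \<le> Re (cnj \<beta> * X k p q) + cmod \<beta> * \<delta>"
      using close[of b a "cnj \<beta>"] Mba by simp
    moreover have "(cmod \<beta>)\<^sup>2 * Re (Y b b) \<le> (cmod \<beta>)\<^sup>2 * (2 * F0_bound + \<delta>)"
      using close[of b b 1] Mbb F_coeff_le_F0_bound[OF pq(1)] by (intro mult_left_mono) auto
    ultimately show ?thesis by (simp add: algebra_simps power2_eq_square)
  qed
  have diag: "2 * cmod (X 0 q q) \<le> 8 * F0_bound + 9 * \<delta>"
  proof -
    \<comment> \<open>Modulus 2 for \<beta> puts 4 |X 0 q q| on the left against 2 Re (X 0 q q) on
      the right, so the right-hand term can be absorbed.\<close>
    have "2 * 2 * cmod (X 0 q q) \<le> 2 * Re (X 0 q q) + 2\<^sup>2 * (2 * F0_bound) + \<delta> * (1 + 2)\<^sup>2"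
      by (rule norm_le_of_two_point[OF two]) (use pq in auto)
    then show ?thesis using complex_Re_le_cmod[of "X 0 q q"] by simp
  qed
  \<comment> \<open>Modulus 1 for \<beta>, combined with the diagonal bound, gives 10
    \<open>F0_bound\<close> + 13 \<delta> for twice the modulus; halving and rounding up yields the
    constants 5 and 7.\<close>
  have "2 * 1 * cmod (X k p q) \<le> 2 * Re (X 0 q q) + 1\<^sup>2 * (2 * F0_bound) + \<delta> * (1 + 1)\<^sup>2"
    by (rule norm_le_of_two_point[OF two]) (use k pq in auto)
  then show ?thesis using complex_Re_le_cmod[of "X 0 q q"] diag \<delta> by simp
qed

text \<open>Weight n + 1 and tolerance sqrt (C / (n + 1)) multiply out to
  \<open>\<mu> * \<delta>\<^sup>2 = C\<close>, which dominates the objective at 0. The tolerance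
  tends to 0, yet it never exceeds sqrt C, so the bound on the coefficients is uniform in n.\<close>

lemma penalised_approximant:
  assumes C: "0 \<le> C" "\<And>n. objective n (\<lambda>_ _ _. 0) \<le> C"
  shows "\<exists>x Y Z. (\<forall>v. cmod (x v) \<le> 5 * F0_bound + 7 * sqrt C) \<and> kpsd (idx n (2 * m)) Y \<and> kpsd (idx n (2 * m)) Z \<and>
    (\<forall>a\<in>idx n (2 * m). \<forall>b\<in>idx n (2 * m). cmod (V_kernel (curry3 x) a b - Y a b) \<le> sqrt (C / real (Suc n))) \<and>
    ereal (objective n (curry3 x)) \<le> dual n Z"
proof -
  define J where "J = {v :: nat \<times> nat \<times> nat. fst v \<le> n \<and> fst (snd v) < m \<and> snd (snd v) < m}"
  define S where "S = {..n} \<times> {..<n_z P} \<times> {..<n_w P}"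
  \<comment> \<open>Scaled by 1 / sqrt \<tau> so that the sum of squares is the objective
    itself.\<close>
  define r where "r = (\<lambda>s x. of_real (1 / sqrt \<tau>) * T_coeff (curry3 x) (fst (snd s)) (snd (snd s)) (fst s))"
  define M where "M = (\<lambda>a b x. V_kernel (curry3 x) a b)"
  define \<mu> where "\<mu> = real (Suc n)"
  define \<delta> where "\<delta> = sqrt (C / real (Suc n))"
  define R where "R = 5 * F0_bound + 7 * sqrt C"
  have objective: "(\<Sum>s\<in>S. (cmod (r s x))\<^sup>2) = objective n (curry3 x)" for x
  proof -
    have "(cmod (r s x))\<^sup>2 = 1 / \<tau> * (cmod (T_coeff (curry3 x) (fst (snd s)) (snd (snd s)) (fst s)))\<^sup>2" for s
      using \<tau>_pos by (simp add: r_def norm_mult norm_divide power_mult_distrib power_divide)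
    then show ?thesis unfolding S_def objective_def sum.cartesian_product' by (simp add: sum_distrib_left)
  qed
  have F0_bound: "0 \<le> F0_bound" by (simp add: F0_bound_def sum_nonneg)
  have \<delta>0: "0 \<le> \<delta>" using C(1) by (simp add: \<delta>_def)
  have \<delta>C: "\<delta> \<le> sqrt C" unfolding \<delta>_def using C(1) by (simp add: divide_le_eq mult_le_cancel_left1)
  have "\<exists>x\<in>{x. \<forall>v. v \<notin> J \<longrightarrow> x v = 0}. \<exists>Y Z. kpsd (idx n (2 * m)) Y \<and> kpsd (idx n (2 * m)) Z \<and>
    (\<forall>a\<in>idx n (2 * m). \<forall>b\<in>idx n (2 * m). cmod (M a b x - Y a b) \<le> \<delta>) \<and>
    (\<forall>x'\<in>{x. \<forall>v. v \<notin> J \<longrightarrow> x v = 0}. (\<Sum>s\<in>S. (cmod (r s x))\<^sup>2)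
       \<le> (\<Sum>s\<in>S. (cmod (r s x'))\<^sup>2) - Re (\<Sum>a\<in>idx n (2 * m). \<Sum>b\<in>idx n (2 * m). cnj (Z a b) * M a b x'))"
  proof (rule penalty_multiplier[where \<mu> = \<mu> and R = R])
    show "finite S" "finite (idx n (2 * m))" by (simp_all add: S_def)
    show "r s (\<lambda>v. x v + of_real t * (x' v - x v)) = r s x + of_real t * (r s x' - r s x)" for s x x' t
      unfolding r_def T_coeff_affine by (simp add: algebra_simps)
    show "M a b (\<lambda>v. x v + of_real t * (x' v - x v)) = M a b x + of_real t * (M a b x' - M a b x)" for a b x x' t
      unfolding M_def V_kernel_affine ..
    show "continuous_on UNIV (r s)" for s
      unfolding r_def by (intro continuous_intros continuous_T_coeff)
    show "continuous_on UNIV (M a b)" for a b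
      unfolding M_def V_kernel_def by (intro continuous_intros continuous_toep)
    show "M b a x = cnj (M a b x)" for a b x by (simp add: M_def V_kernel_def)
    show "kpsd (idx n (2 * m)) (\<lambda>a b. M a b (\<lambda>_. 0))" unfolding M_def using V_kernel_zero_kpsd .
    show "0 < \<mu>" "0 \<le> \<delta>" using \<delta>0 by (simp_all add: \<mu>_def)
    show "(\<Sum>s\<in>S. (cmod (r s (\<lambda>_. 0)))\<^sup>2) \<le> \<mu> * \<delta>\<^sup>2"
      unfolding objective using C by (simp add: \<mu>_def \<delta>_def)
    fix x Y v assume x: "x \<in> {x. \<forall>v. v \<notin> J \<longrightarrow> x v = 0}" and Y: "kpsd (idx n (2 * m)) Y"
      and d: "\<And>a b. a \<in> idx n (2 * m) \<Longrightarrow> b \<in> idx n (2 * m) \<Longrightarrow> cmod (M a b x - Y a b) \<le> \<delta>"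
    show "cmod (x v) \<le> R"
    proof (cases "v \<in> J")
      case True
      then have "cmod (curry3 x (fst v) (fst (snd v)) (snd (snd v))) \<le> 5 * F0_bound + 7 * \<delta>"
        using d unfolding M_def J_def by (intro coefficients_bounded[OF Y \<delta>0]) auto
      then show ?thesis using \<delta>C by (simp add: R_def)
    next
      case False
      then have "x v = 0" using x by blast
      then show ?thesis using F0_bound C(1) by (simp add: R_def)
    qed
  qed
  then obtain x Y Z where x: "\<forall>v. v \<notin> J \<longrightarrow> x v = 0" and Y: "kpsd (idx n (2 * m)) Y" and Z: "kpsd (idx n (2 * m)) Z"
    and d: "\<forall>a\<in>idx n (2 * m). \<forall>b\<in>idx n (2 * m). cmod (M a b x - Y a b) \<le> \<delta>"
    and opt: "\<And>x'. \<forall>v. v \<notin> J \<longrightarrow> x' v = 0 \<Longrightarrow> objective n (curry3 x)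
       \<le> objective n (curry3 x') - Re (\<Sum>a\<in>idx n (2 * m). \<Sum>b\<in>idx n (2 * m). cnj (Z a b) * M a b x')"
    unfolding objective by blast
  have "cmod (x v) \<le> R" for v
  proof (cases "v \<in> J")
    case True
    then have "cmod (curry3 x (fst v) (fst (snd v)) (snd (snd v))) \<le> 5 * F0_bound + 7 * \<delta>"
      using d unfolding M_def J_def by (intro coefficients_bounded[OF Y \<delta>0]) auto
    then show ?thesis using \<delta>C by (simp add: R_def)
  next
    case False
    then have "x v = 0" using x by blast
    then show ?thesis using F0_bound C(1) by (simp add: R_def)
  qed
  moreover have "ereal (objective n (curry3 x)) \<le> dual n Z"
    unfolding dual_def
  proof (rule INF_greatest)
    fix Qc :: "nat \<Rightarrow> complex mat"
    \<comment> \<open>An arbitrary competitor is cut down to the admissible index set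
      \<open>J\<close>; entries outside it affect neither the objective of order n nor the
      kernel.\<close>
    define x' where "x' = (\<lambda>v. if v \<in> J then Qc (fst v) $$ (fst (snd v), snd (snd v)) else 0)"
    have eq: "curry3 x' l p q = Qc l $$ (p, q)" if "l \<le> n" "p < m" "q < m" for l p q
      using that by (simp add: x'_def J_def)
    have "objective n (curry3 x) \<le> objective n (curry3 x') - Re (\<Sum>a\<in>idx n (2 * m). \<Sum>b\<in>idx n (2 * m). cnj (Z a b) * M a b x')"
      by (rule opt) (simp add: x'_def)
    also have "objective n (curry3 x') = objective n (\<lambda>k p q. Qc k $$ (p, q))" by (rule objective_cong) (rule eq)
    also have "(\<Sum>a\<in>idx n (2 * m). \<Sum>b\<in>idx n (2 * m). cnj (Z a b) * M a b x')
      = (\<Sum>a\<in>idx n (2 * m). \<Sum>b\<in>idx n (2 * m). cnj (Z a b) * V_kernel (\<lambda>k p q. Qc k $$ (p, q)) a b)"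
    proof (intro sum.cong refl)
      fix a b assume "a \<in> idx n (2 * m)" "b \<in> idx n (2 * m)"
      then have "M a b x' = V_kernel (\<lambda>k p q. Qc k $$ (p, q)) a b" unfolding M_def by (intro V_kernel_cong eq) auto
      then show "cnj (Z a b) * M a b x' = cnj (Z a b) * V_kernel (\<lambda>k p q. Qc k $$ (p, q)) a b" by simp
    qed
    finally show "ereal (objective n (curry3 x)) \<le> ereal (objective n (\<lambda>k p q. Qc k $$ (p, q)) -
      Re (\<Sum>a\<in>idx n (2 * m). \<Sum>b\<in>idx n (2 * m). cnj (Z a b) * V_kernel (\<lambda>k p q. Qc k $$ (p, q)) a b))" by simp
  qed
  ultimately show ?thesis using Y Z d unfolding R_def \<delta>_def M_def by blast
qed

text \<open>A fixed order N is eventually below \<open>s n\<close>. From then on the Toeplitz form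
  of order N is bounded below by a multiple of - \<delta>, which tends to 0, and the objective of
  order N is at most a dual value. Both inequalities involve finitely many coefficients and survive
  the limit.\<close>

lemma limit_of_approximants:
  "\<exists>X R. (\<forall>k p q. cmod (X k p q) \<le> R) \<and>
    (\<forall>n x. 0 \<le> Re (kform (idx n (2 * m)) (toep (V_coeff X)) x)) \<and>
    (\<forall>N. ereal (objective N X) \<le> (SUP n\<in>{0<..}. op6_value P \<tau> F n))"
proof -
  obtain C where C: "0 \<le> C" "\<And>n. objective n (\<lambda>_ _ _. 0) \<le> C" using objective_zero_bounded by blast
  define R where "R = 5 * F0_bound + 7 * sqrt C"
  define \<delta> where "\<delta> = (\<lambda>n. sqrt (C / real (Suc n)))"
  define ap where "ap = (\<lambda>n x Y Z. (\<forall>v. cmod (x v) \<le> R) \<and> kpsd (idx n (2 * m)) Y \<and> kpsd (idx n (2 * m)) Z \<and>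
    (\<forall>a\<in>idx n (2 * m). \<forall>b\<in>idx n (2 * m). cmod (V_kernel (curry3 x) a b - Y a b) \<le> \<delta> n) \<and>
    ereal (objective n (curry3 x)) \<le> dual n Z)"
  have "\<forall>n. \<exists>x Y Z. ap n x Y Z"
    using penalised_approximant[OF C] unfolding R_def \<delta>_def ap_def ..
  then obtain x Y Z where "\<And>n. ap n (x n) (Y n) (Z n)" by metis
  note xYZ = this[unfolded ap_def]
  have xR: "cmod (x n v) \<le> R" for n v using xYZ[of n] by blast
  have Y: "kpsd (idx n (2 * m)) (Y n)" for n using xYZ[of n] by blast
  have Z: "kpsd (idx n (2 * m)) (Z n)" for n using xYZ[of n] by blast
  have d: "cmod (V_kernel (curry3 (x n)) a b - Y n a b) \<le> \<delta> n" if "a \<in> idx n (2 * m)" "b \<in> idx n (2 * m)" for n a b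
    using xYZ[of n] that by blast
  have val: "ereal (objective n (curry3 (x n))) \<le> dual n (Z n)" for n using xYZ[of n] by blast
  from bounded_fun_seq_convergent_subseq[of x R, OF xR]
  obtain s l where sl: "strict_mono (s :: nat \<Rightarrow> nat) \<and> (\<forall>v. (\<lambda>n. x (s n) v) \<longlonglongrightarrow> l v) \<and> (\<forall>v. cmod (l v) \<le> R)"
    by (elim exE)
  then have s: "strict_mono s" and lim: "\<And>v. (\<lambda>n. x (s n) v) \<longlonglongrightarrow> l v" and lR: "\<And>v. cmod (l v) \<le> R"
    by (simp_all only: simp_thms)
  have s_ge: "n \<le> s n" for n by (rule seq_suble[OF s])
  have T_coeff_lim: "(\<lambda>n. T_coeff (curry3 (x (s n))) i j k) \<longlonglongrightarrow> T_coeff (curry3 l) i j k" for i j k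
    unfolding T_coeff_def conv_def by (intro tendsto_intros lim)
  have toep_lim: "(\<lambda>n. toep (V_coeff (curry3 (x (s n)))) a b) \<longlonglongrightarrow> toep (V_coeff (curry3 l)) a b" for a b
    unfolding toep_def V_coeff_def Vk_def by (auto intro!: tendsto_intros lim)
  have \<delta>_lim: "\<delta> \<longlonglongrightarrow> 0"
  proof -
    have "(\<lambda>n. C * (1 / real (Suc n))) \<longlonglongrightarrow> C * 0"
      by (intro tendsto_mult tendsto_const LIMSEQ_Suc[OF lim_1_over_n])
    then have "(\<lambda>n. sqrt (C * (1 / real (Suc n)))) \<longlonglongrightarrow> sqrt (C * 0)" by (rule tendsto_real_sqrt)
    then show ?thesis by (simp add: \<delta>_def)
  qed
  show ?thesis
  proof (rule exI[of _ "curry3 l"], rule exI[of _ R], intro conjI allI)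
    show "cmod (curry3 l k p q) \<le> R" for k p q by (rule lR)
  next
    fix N y
    let ?I = "idx N (2 * m)"
    define W where "W = (\<Sum>a\<in>?I. \<Sum>b\<in>?I. cmod (y a) * cmod (y b))"
    \<comment> \<open>The approximant differs entrywise by at most \<delta> from a positive
      semidefinite kernel, so its form is at least - \<delta> times the sum of the products |y a| |y
      b|.\<close>
    have low: "- \<delta> (s n) * W \<le> 2 * Re (kform ?I (toep (V_coeff (curry3 (x (s n))))) y)" if n: "N \<le> n" for n
    proof -
      have sub: "?I \<subseteq> idx (s n) (2 * m)" using n s_ge[of n] by (auto simp: idx_def)
      have Yp: "kpsd ?I (Y (s n))" by (rule kpsd_subset[OF finite_idx sub Y])
      have "kform ?I (V_kernel (curry3 (x (s n)))) y = kform ?I (Y (s n)) y + kform ?I (\<lambda>a b. V_kernel (curry3 (x (s n))) a b - Y (s n) a b) y"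
        unfolding kform_add[symmetric] by simp
      moreover have "- (\<delta> (s n) * W) \<le> Re (kform ?I (\<lambda>a b. V_kernel (curry3 (x (s n))) a b - Y (s n) a b) y)"
      proof -
        have "cmod (kform ?I (\<lambda>a b. V_kernel (curry3 (x (s n))) a b - Y (s n) a b) y) \<le> \<delta> (s n) * W"
          unfolding kform_def W_def sum_distrib_left
        proof (intro sum_norm_le)
          fix a b assume "a \<in> ?I" "b \<in> ?I"
          then have "cmod (V_kernel (curry3 (x (s n))) a b - Y (s n) a b) \<le> \<delta> (s n)" using sub by (intro d) auto
          then have "(cmod (y a) * cmod (y b)) * cmod (V_kernel (curry3 (x (s n))) a b - Y (s n) a b) \<le> (cmod (y a) * cmod (y b)) * \<delta> (s n)"
            by (intro mult_left_mono) auto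
          then show "cmod (cnj (y a) * (V_kernel (curry3 (x (s n))) a b - Y (s n) a b) * y b) \<le> \<delta> (s n) * (cmod (y a) * cmod (y b))"
            by (simp add: norm_mult mult_ac)
        qed
        then show ?thesis using abs_Re_le_cmod[of "kform ?I (\<lambda>a b. V_kernel (curry3 (x (s n))) a b - Y (s n) a b) y"] by linarith
      qed
      ultimately have "- (\<delta> (s n) * W) \<le> Re (kform ?I (V_kernel (curry3 (x (s n)))) y)"
        using kpsd_form_nonneg[OF Yp, of y] by simp
      then show ?thesis unfolding kform_V_kernel[OF finite_idx] by simp
    qed
    have l1: "(\<lambda>n. - \<delta> (s n) * W) \<longlonglongrightarrow> - 0 * W"
      by (intro tendsto_mult tendsto_minus tendsto_const LIMSEQ_subseq_LIMSEQ[OF \<delta>_lim s, unfolded o_def])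
    have l2: "(\<lambda>n. 2 * Re (kform ?I (toep (V_coeff (curry3 (x (s n))))) y)) \<longlonglongrightarrow> 2 * Re (kform ?I (toep (V_coeff (curry3 l))) y)"
      unfolding kform_def by (intro tendsto_intros toep_lim)
    have "- 0 * W \<le> 2 * Re (kform ?I (toep (V_coeff (curry3 l))) y)"
      by (rule LIMSEQ_le[OF l1 l2]) (use low in blast)
    then show "0 \<le> Re (kform ?I (toep (V_coeff (curry3 l))) y)" by simp
  next
    fix N
    let ?V = "SUP n\<in>{0<..}. op6_value P \<tau> F n"
    have up: "ereal (objective N (curry3 (x (s n)))) \<le> ?V" if n: "Suc N \<le> n" for n
    proof -
      have N: "N \<le> s n" "0 < s n" using n s_ge[of n] by auto
      have "ereal (objective N (curry3 (x (s n)))) \<le> ereal (objective (s n) (curry3 (x (s n))))"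
        using objective_mono[OF N(1)] by simp
      also have "\<dots> \<le> dual (s n) (Z (s n))" by (rule val)
      also have "\<dots> \<le> op6_value P \<tau> F (s n)" unfolding op6_value_eq[OF N(2)] by (intro SUP_upper) (simp add: Z)
      also have "\<dots> \<le> ?V" by (rule SUP_upper) (simp add: N)
      finally show ?thesis .
    qed
    have "(\<lambda>n. ereal (objective N (curry3 (x (s n))))) \<longlonglongrightarrow> ereal (objective N (curry3 l))"
      unfolding objective_def lim_ereal by (intro tendsto_intros T_coeff_lim)
    then show "ereal (objective N (curry3 l)) \<le> ?V"
      by (rule LIMSEQ_le_const2) (use up in blast)
  qed
qed

end


section \<open>Dilation\<close>

lemma has_markov_suminf_bounded:
  assumes "\<And>k. cmod (c k) \<le> R"
  shows "has_markov c (\<lambda>z. \<Sum>k. c k / z ^ k)"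
  unfolding has_markov_def
proof
  fix z assume z: "z \<in> outer_disc"
  have "summable (\<lambda>k. R * (1 / cmod z) ^ k)"
    using z by (intro summable_mult summable_geometric) (simp add: outer_disc_def divide_less_eq)
  then have "summable (\<lambda>k. c k / z ^ k)"
  proof (rule summable_comparison_test[rotated], intro exI[of _ 0] allI impI)
    fix k :: nat
    have "cmod (c k) / cmod z ^ k \<le> R / cmod z ^ k" by (intro divide_right_mono assms) simp
    then show "norm (c k / z ^ k) \<le> R * (1 / cmod z) ^ k" by (simp add: norm_divide norm_power power_one_over)
  qed
  then show "(\<lambda>k. c k / z ^ k) sums (\<Sum>k. c k / z ^ k)" by (rule summable_sums)
qed

lemma has_markov_dilate:
  assumes "has_markov c f" "1 \<le> r"
  shows "has_markov (\<lambda>k. s * c k / of_real r ^ k) (\<lambda>z. s * f (of_real r * z))"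
  unfolding has_markov_def
proof
  fix z assume z: "z \<in> outer_disc"
  have "1 * 1 < r * cmod z" using z assms(2) by (intro mult_le_less_imp_less) (auto simp: outer_disc_def)
  then have "of_real r * z \<in> outer_disc" using assms(2) by (simp add: outer_disc_def norm_mult)
  then have "(\<lambda>k. s * (c k / (of_real r * z) ^ k)) sums (s * f (of_real r * z))"
    using assms(1) unfolding has_markov_def by (intro sums_mult) blast
  then show "(\<lambda>k. s * c k / of_real r ^ k / z ^ k) sums (s * f (of_real r * z))"
    by (simp add: power_mult_distrib)
qed

text \<open>Young's inequality with weight \<eta>: the price of a factor 1 + \<eta> close to 1 is a
  large constant on the error term, which is harmless because the error is sent to 0 first.\<close>

lemma square_add_bound:
  fixes x y :: complex
  assumes "0 < \<eta>"
  shows "(cmod x)\<^sup>2 \<le> (1 + \<eta>) * (cmod y)\<^sup>2 + (1 + 1 / \<eta>) * (cmod (x - y))\<^sup>2"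
proof -
  define a b where "a = cmod y" and "b = cmod (x - y)"
  have "cmod x \<le> a + b" unfolding a_def b_def by (metis norm_triangle_sub add.commute)
  then have "(cmod x)\<^sup>2 \<le> (a + b)\<^sup>2" by (intro power_mono) auto
  also have "(a + b)\<^sup>2 = a\<^sup>2 + b\<^sup>2 + 2 * a * b" by (simp add: power2_eq_square algebra_simps)
  also have "2 * a * b \<le> \<eta> * a\<^sup>2 + b\<^sup>2 / \<eta>"
  proof -
    have "0 \<le> (\<eta> * a - b)\<^sup>2 / \<eta>" using assms by simp
    also have "\<dots> = \<eta> * a\<^sup>2 + b\<^sup>2 / \<eta> - 2 * a * b" using assms by (simp add: power2_eq_square field_simps)
    finally show ?thesis by simp
  qed
  finally show ?thesis unfolding a_def b_def by (simp add: algebra_simps)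
qed

context synthesis
begin

definition Qf :: "(nat \<Rightarrow> nat \<Rightarrow> nat \<Rightarrow> complex) \<Rightarrow> complex \<Rightarrow> nat \<Rightarrow> nat \<Rightarrow> complex" where
  "Qf X z p q = (\<Sum>k. X k p q / z ^ k)"

definition Qd :: "(nat \<Rightarrow> nat \<Rightarrow> nat \<Rightarrow> complex) \<Rightarrow> real \<Rightarrow> real \<Rightarrow> complex \<Rightarrow> complex mat" where
  "Qd X d r z = mat m m (\<lambda>(p, q). of_real (1 - d) * Qf X (of_real r * z) p q)"

definition Xd :: "(nat \<Rightarrow> nat \<Rightarrow> nat \<Rightarrow> complex) \<Rightarrow> real \<Rightarrow> real \<Rightarrow> nat \<Rightarrow> nat \<Rightarrow> nat \<Rightarrow> complex" where
  "Xd X d r k p q = of_real (1 - d) * X k p q / of_real r ^ k"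

end

text \<open>A coefficient family as delivered by \<open>limit_of_approximants\<close>. The bound
  \<open>R\<close> makes the series converge on the exterior of the disc; boundedness of the sum
  there is derived from passivity.\<close>

locale interior_feasible = synthesis +
  fixes X :: "nat \<Rightarrow> nat \<Rightarrow> nat \<Rightarrow> complex" and R BF :: real
  assumes X_bound: "\<And>k p q. cmod (X k p q) \<le> R"
    and X_toep: "\<And>n x. 0 \<le> Re (kform (idx n (2 * m)) (toep (V_coeff X)) x)"
    and BF_nonneg: "0 \<le> BF"
    and F_bound: "\<And>z p q. z \<in> outer_disc \<Longrightarrow> p < m \<Longrightarrow> q < m \<Longrightarrow> cmod (F z $$ (p, q)) \<le> BF"
begin

section \<open>The limit point as a bounded passive function and its dilations\<close>

lemma has_markov_Qf: "has_markov (\<lambda>k. X k p q) (\<lambda>z. Qf X z p q)"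
  unfolding Qf_def by (rule has_markov_suminf_bounded[OF X_bound])

lemma pass_form_interior:
  assumes z: "z \<in> outer_disc"
  shows "0 \<le> pass_form m (Qf X z) (\<lambda>p q. F z $$ (p, q)) a b"
proof -
  have mk: "has_markov (\<lambda>k. V_coeff X k p q) (\<lambda>z. Vk m (Qf X z) (\<lambda>p q. F z $$ (p, q)) p q)"
    if "p < 2 * m" "q < 2 * m" for p q
    using that has_markov_plant(4) has_markov_zero has_markov_Qf unfolding V_coeff_def Vk_def
    by (cases "q < m"; cases "p < m") auto
  have "\<forall>x. 0 \<le> Re (kform {..<2 * m} (Vk m (Qf X z) (\<lambda>p q. F z $$ (p, q))) x)"
    using interior_nonneg_of_toep[OF mk X_toep z] by blast
  then show ?thesis using pass_form_nonneg_iff_Vk by blast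
qed

text \<open>The two-coordinate test used for the coefficients, applied pointwise at z with zero
  tolerance: the diagonal entry is bounded first and then controls all entries.\<close>

lemma Qf_bound:
  assumes z: "z \<in> outer_disc" and pq: "p < m" "q < m"
  shows "cmod (Qf X z p q) \<le> 5 * BF"
proof -
  have two: "0 \<le> 2 * Re (Qf X z q q) + 2 * Re (cnj \<beta> * Qf X z p q) + (cmod \<beta>)\<^sup>2 * (2 * BF) + 0 * (1 + cmod \<beta>)\<^sup>2"
    if pq: "p < m" "q < m" for p q \<beta>
  proof -
    define a where "a = (\<lambda>i. if i = q then 1 else 0 :: complex)"
    define b where "b = (\<lambda>i. if i = p then \<beta> else 0)"
    have mva: "mv m K a i = K i q" for K i
      using pq by (simp add: mv_def a_def if_distrib[of "\<lambda>x. _ * x"] sum.delta cong: if_cong)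
    have mvb: "mv m K b i = K i p * \<beta>" for K i
      using pq by (simp add: mv_def b_def if_distrib[of "\<lambda>x. _ * x"] sum.delta cong: if_cong)
    have ipa: "ip m a c = c q" for c
      using pq by (simp add: ip_def a_def if_distrib[of "\<lambda>x. cnj x * _"] sum.delta cong: if_cong)
    have ipb: "ip m b c = cnj \<beta> * c p" for c
      using pq by (simp add: ip_def b_def if_distrib[of "\<lambda>x. cnj x * _"] sum.delta cong: if_cong)
    have "pass_form m (Qf X z) (\<lambda>p q. F z $$ (p, q)) a b
      = Re (Qf X z q q) + Re (cnj \<beta> * Qf X z p q) + Re (cnj \<beta> * (F z $$ (p, p) * \<beta>))"
      unfolding pass_form_def ipa ipb mva mvb by simp
    moreover have "Re (cnj \<beta> * (F z $$ (p, p) * \<beta>)) \<le> (cmod \<beta>)\<^sup>2 * BF"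
    proof -
      have "Re (cnj \<beta> * (F z $$ (p, p) * \<beta>)) \<le> cmod (cnj \<beta> * (F z $$ (p, p) * \<beta>))" by (rule complex_Re_le_cmod)
      also have "\<dots> = (cmod \<beta>)\<^sup>2 * cmod (F z $$ (p, p))" by (simp add: norm_mult power2_eq_square)
      also have "\<dots> \<le> (cmod \<beta>)\<^sup>2 * BF" by (intro mult_left_mono F_bound z pq) auto
      finally show ?thesis .
    qed
    ultimately show ?thesis using pass_form_interior[OF z, of a b] by simp
  qed
  have diag: "2 * cmod (Qf X z q q) \<le> 8 * BF"
  proof -
    have "2 * 2 * cmod (Qf X z q q) \<le> 2 * Re (Qf X z q q) + 2\<^sup>2 * (2 * BF) + 0 * (1 + 2)\<^sup>2"
      by (rule norm_le_of_two_point[OF two]) (use pq in auto)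
    then show ?thesis using complex_Re_le_cmod[of "Qf X z q q"] by simp
  qed
  have "2 * 1 * cmod (Qf X z p q) \<le> 2 * Re (Qf X z q q) + 1\<^sup>2 * (2 * BF) + 0 * (1 + 1)\<^sup>2"
    by (rule norm_le_of_two_point[OF two]) (use pq in auto)
  then show ?thesis using complex_Re_le_cmod[of "Qf X z q q"] diag by simp
qed

lemma dilated_in_outer_disc: "1 < r \<Longrightarrow> 1 \<le> cmod z \<Longrightarrow> of_real r * z \<in> outer_disc"
proof -
  assume "1 < r" "1 \<le> cmod z"
  then have "1 * 1 < r * cmod z" by (intro mult_less_le_imp_less) auto
  then show ?thesis using \<open>1 < r\<close> by (simp add: outer_disc_def norm_mult)
qed

lemma Qd_carrier: "Qd X d r z \<in> carrier_mat m m"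
  by (simp add: Qd_def)

lemma has_markov_Qd:
  assumes "1 < r" "p < m" "q < m"
  shows "has_markov (\<lambda>k. Xd X d r k p q) (\<lambda>z. Qd X d r z $$ (p, q))"
  using has_markov_dilate[OF has_markov_Qf, of r "of_real (1 - d)" p q] assms by (simp add: Xd_def Qd_def)

lemma Qd_bound:
  assumes "1 < r" "0 < d" "d < 1" "z \<in> outer_disc" "p < m" "q < m"
  shows "cmod (Qd X d r z $$ (p, q)) \<le> 5 * BF"
proof -
  have "cmod (Qf X (of_real r * z) p q) \<le> 5 * BF"
    using assms by (intro Qf_bound dilated_in_outer_disc) (auto simp: outer_disc_def)
  then have "\<bar>1 - d\<bar> * cmod (Qf X (of_real r * z) p q) \<le> 1 * (5 * BF)"
    using assms BF_nonneg by (intro mult_mono) auto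
  moreover have "cmod (Qd X d r z $$ (p, q)) = \<bar>1 - d\<bar> * cmod (Qf X (of_real r * z) p q)"
    unfolding Qd_def using assms(5,6) by (simp add: norm_mult del: of_real_diff)
  ultimately show ?thesis by simp
qed

lemma Qd_H_inf:
  assumes "1 < r" "0 < d" "d < 1"
  shows "Qd X d r \<in> H_inf outer_disc m m"
  unfolding H_inf_def mat_analytic_on_def
  using Qd_carrier has_markov_analytic[OF has_markov_Qd] Qd_bound assms by blast

lemma Qd_boundary:
  assumes r: "1 < r" and w: "cmod w = 1" and pq: "p < m" "q < m"
  shows "((\<lambda>t. Qd X d r (of_real t * w) $$ (p, q)) \<longlongrightarrow> of_real (1 - d) * Qf X (of_real r * w) p q) (at_right 1)"
proof -
  have "isCont (\<lambda>z. Qf X z p q) (of_real r * w)"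
    using has_markov_analytic[OF has_markov_Qf] analytic_imp_holomorphic holomorphic_on_imp_continuous_on
      continuous_on_eq_continuous_at[OF open_outer_disc] dilated_in_outer_disc[OF r] w by fastforce
  moreover have "((\<lambda>t. of_real r * (of_real t * w)) \<longlongrightarrow> of_real r * w) (at_right (1 :: real))"
    by (rule tendsto_radial[where g = "\<lambda>z. of_real r * z"]) (intro continuous_intros)
  ultimately have "((\<lambda>t. Qf X (of_real r * (of_real t * w)) p q) \<longlongrightarrow> Qf X (of_real r * w) p q) (at_right 1)"
    by (rule isCont_tendsto_compose)
  then show ?thesis using pq unfolding Qd_def by (simp add: tendsto_mult_left del: of_real_diff)
qed

text \<open>On the circle the factor at \<open>w\<close> dominates \<open>1 - d\<close> times the factor at \<open>r w\<close>, because it is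
  uniformly positive and \<open>F (r w)\<close> converges uniformly.\<close>

lemma pass_form_dilated:
  assumes bf: "boundary_factor m F c LF H" and d: "0 < d" "d < 1" and r: "1 < r" and w: "cmod w = 1"
    and close: "\<And>p q. p < m \<Longrightarrow> q < m \<Longrightarrow> cmod (F (of_real r * w) $$ (p, q) - LF w p q) \<le> d * c / (real m + 1)"
  shows "0 \<le> pass_form m (\<lambda>p q. of_real (1 - d) * Qf X (of_real r * w) p q) (LF w) a b"
proof -
  define Fr where "Fr = (\<lambda>p q. F (of_real r * w) $$ (p, q))"
  define N where "N = (\<Sum>p<m. (cmod (b p))\<^sup>2)"
  \<comment> \<open>By Cauchy-Schwarz an entrywise error \<eta> changes the form by at most \<eta> m
    N, which is at most d c N, the slack left by the factor 1 - d. The summand 1 in the denominator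
    covers m = 0.\<close>
  define \<eta> where "\<eta> = d * c / (real m + 1)"
  have c: "0 < c" by (rule boundary_factorD(1)[OF bf])
  have N: "0 \<le> N" by (simp add: N_def sum_nonneg)
  have \<eta>: "0 \<le> \<eta>" using d c by (simp add: \<eta>_def)
  have A: "c * N \<le> Re (kform {..<m} (LF w) b)" unfolding N_def by (rule boundary_factorD(4)[OF bf w])
  have "kform {..<m} Fr b = kform {..<m} (LF w) b + kform {..<m} (\<lambda>p q. Fr p q - LF w p q) b"
    unfolding kform_add[symmetric] by simp
  moreover have "cmod (kform {..<m} (\<lambda>p q. Fr p q - LF w p q) b) \<le> \<eta> * (real m * N)"
  proof -
    have "cmod (kform {..<m} (\<lambda>p q. Fr p q - LF w p q) b) \<le> (\<Sum>p<m. \<Sum>q<m. \<eta> * (cmod (b p) * cmod (b q)))"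
      unfolding kform_def
    proof (intro sum_norm_le)
      fix p q assume "p \<in> {..<m}" "q \<in> {..<m}"
      then have "(cmod (b p) * cmod (b q)) * cmod (Fr p q - LF w p q) \<le> (cmod (b p) * cmod (b q)) * \<eta>"
        unfolding Fr_def \<eta>_def by (intro mult_left_mono close) auto
      then show "cmod (cnj (b p) * (Fr p q - LF w p q) * b q) \<le> \<eta> * (cmod (b p) * cmod (b q))"
        by (simp add: norm_mult mult_ac)
    qed
    also have "\<dots> = \<eta> * (\<Sum>p<m. cmod (b p))\<^sup>2"
      unfolding power2_eq_square sum_product unfolding sum_distrib_left ..
    also have "\<dots> \<le> \<eta> * (N * real m)"
      using sum_squared_le_sum_of_squares[of "\<lambda>p. cmod (b p)" "{..<m}"] \<eta>
      unfolding N_def by (intro mult_left_mono) simp_all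
    finally show ?thesis by (simp add: mult.commute)
  qed
  ultimately have "Re (kform {..<m} Fr b) \<le> Re (kform {..<m} (LF w) b) + \<eta> * (real m * N)"
    using complex_Re_le_cmod[of "kform {..<m} (\<lambda>p q. Fr p q - LF w p q) b"] by simp
  then have "(1 - d) * Re (kform {..<m} Fr b) \<le> (1 - d) * (Re (kform {..<m} (LF w) b) + \<eta> * (real m * N))"
    using d by (intro mult_left_mono) auto
  also have "\<dots> \<le> (1 - d) * Re (kform {..<m} (LF w) b) + d * (c * N)"
  proof -
    have "(1 - d) * (\<eta> * (real m * N)) \<le> 1 * (\<eta> * (real m * N))"
      using d \<eta> N by (intro mult_right_mono) auto
    also have "\<dots> \<le> \<eta> * ((real m + 1) * N)" using \<eta> N by (simp add: algebra_simps)
    also have "\<dots> = d * (c * N)" by (simp add: \<eta>_def)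
    finally show ?thesis by (simp add: algebra_simps)
  qed
  also have "\<dots> \<le> (1 - d) * Re (kform {..<m} (LF w) b) + d * Re (kform {..<m} (LF w) b)"
    using d A by (intro add_left_mono mult_left_mono) auto
  finally have dom: "(1 - d) * Re (kform {..<m} Fr b) \<le> Re (kform {..<m} (LF w) b)" by (simp add: algebra_simps)
  have "0 \<le> (1 - d) * pass_form m (Qf X (of_real r * w)) Fr a b"
    unfolding Fr_def using d w by (intro mult_nonneg_nonneg pass_form_interior dilated_in_outer_disc[OF r]) auto
  also have "\<dots> = Re (of_real (1 - d) * (ip m a (mv m (Qf X (of_real r * w)) a) + ip m b (mv m (Qf X (of_real r * w)) a)))
      + (1 - d) * Re (kform {..<m} Fr b)"
    unfolding pass_form_def kform_eq_ip by (simp add: algebra_simps)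
  also have "\<dots> \<le> Re (of_real (1 - d) * (ip m a (mv m (Qf X (of_real r * w)) a) + ip m b (mv m (Qf X (of_real r * w)) a)))
      + Re (kform {..<m} (LF w) b)"
    using dom by simp
  also have "\<dots> = pass_form m (\<lambda>p q. of_real (1 - d) * Qf X (of_real r * w) p q) (LF w) a b"
  proof -
    have s: "ip m x (mv m (\<lambda>p q. s * K p q) y) = s * ip m x (mv m K y)" for x y s K
      by (simp add: ip_def mv_def sum_distrib_left mult_ac)
    show ?thesis unfolding pass_form_def kform_eq_ip s by (simp add: algebra_simps)
  qed
  finally show ?thesis .
qed

text \<open>For fixed d the admissible error in the factor is a positive constant, and uniform
  convergence makes every r near 1 work for all boundary points at once. Since \<open>r w\<close> is
  an interior point, boundary values of the dilation are ordinary values; the form of V is finally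
  turned back into that of U.\<close>

lemma dilated_feasible:
  assumes d: "0 < d" "d < 1"
  shows "\<forall>\<^sub>F r in at_right 1. Qd X d r \<in> op3_feasible P F"
proof -
  obtain c LF H where bf: "boundary_factor m F c LF H"
    using boundary_factor_exists[OF P_class \<epsilon>_pos \<tau>_pos F_factor] by blast
  have "0 < d * c / (real m + 1)" using d boundary_factorD(1)[OF bf] by simp
  from boundary_factorD(5)[OF bf this] eventually_at_right_less[of 1]
  show ?thesis
  proof eventually_elim
    case (elim r)
    have "AE \<Omega> in lebesgue_on {-pi..pi}. \<exists>L. has_boundary_value (op3_U P F (Qd X d r)) (cis \<Omega>) (2 * m) (2 * m) L \<and>
       0\<^sub>m (2 * m) (2 * m) \<preceq>\<^sub>H L + mat_adjoint L"
    proof (rule AE_I2)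
      fix \<Omega>
      define w where "w = cis \<Omega>"
      have w: "cmod w = 1" by (simp add: w_def)
      define Q' where "Q' = (\<lambda>p q. of_real (1 - d) * Qf X (of_real r * w) p q)"
      define L where "L = mat (2 * m) (2 * m) (\<lambda>(p, q). Uk m Q' (LF w) p q)"
      have Lc: "L \<in> carrier_mat (2 * m) (2 * m)" by (simp add: L_def)
      have "((\<lambda>t. op3_U P F (Qd X d r) (of_real t * w) $$ (p, q)) \<longlongrightarrow> L $$ (p, q)) (at_right 1)"
        if pq: "p < 2 * m" "q < 2 * m" for p q
      proof (rule Lim_transform_eventually)
        show "((\<lambda>t. Uk m (\<lambda>p q. Qd X d r (of_real t * w) $$ (p, q)) (\<lambda>p q. F (of_real t * w) $$ (p, q)) p q) \<longlongrightarrow> L $$ (p, q)) (at_right 1)"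
          using pq Qd_boundary[OF elim(2) w] boundary_factorD(2)[OF bf w] unfolding L_def Uk_def Q'_def
          by (cases "p < m"; cases "q < m") (auto simp del: of_real_diff)
        show "\<forall>\<^sub>F t in at_right 1. Uk m (\<lambda>p q. Qd X d r (of_real t * w) $$ (p, q)) (\<lambda>p q. F (of_real t * w) $$ (p, q)) p q
          = op3_U P F (Qd X d r) (of_real t * w) $$ (p, q)"
          using eventually_outer_disc[OF w] by eventually_elim (rule op3_U_index[symmetric, OF _ Qd_carrier pq])
      qed
      then have "has_boundary_value (op3_U P F (Qd X d r)) w (2 * m) (2 * m) L"
        using Lc unfolding has_boundary_value_def by blast
      moreover have "\<forall>a b. 0 \<le> pass_form m Q' (LF w) a b"
        unfolding Q'_def using pass_form_dilated[OF bf d elim(2) w] elim(1) w less_imp_le by blast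
      then have "\<forall>x. 0 \<le> Re (kform {..<2 * m} (Uk m Q' (LF w)) x)"
        using Uk_nonneg_iff_Vk_nonneg[OF boundary_factorD(3)[OF bf w], of Q'] pass_form_nonneg_iff_Vk[of m Q' "LF w"] by blast
      moreover have "kform {..<2 * m} (\<lambda>p q. L $$ (p, q)) x = kform {..<2 * m} (Uk m Q' (LF w)) x" for x
        by (rule kform_cong) (auto simp: L_def)
      ultimately show "\<exists>L. has_boundary_value (op3_U P F (Qd X d r)) (cis \<Omega>) (2 * m) (2 * m) L \<and>
         0\<^sub>m (2 * m) (2 * m) \<preceq>\<^sub>H L + mat_adjoint L"
        unfolding w_def[symmetric] using herm_le_zero_add_adjoint[OF Lc] by (intro exI[of _ L]) simp
    qed
    then show ?case using Qd_H_inf[OF elim(2) d] by (simp add: op3_feasible_def)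
  qed
qed

text \<open>The closed loops of the dilation and of the limit function differ by the sandwich of the
  change of \<open>Q\<close> between \<open>P_uz\<close> and \<open>P_fy\<close>. Bounds on these
  two and the Bessel estimate control its coefficients with a constant \<open>K\<close> depending on
  the plant alone; Young's inequality handles the cross terms.\<close>

lemma objective_dilated_le:
  obtains K where "0 \<le> K" "\<And>d r \<eta> n. 1 < r \<Longrightarrow> 0 < d \<Longrightarrow> d < 1 \<Longrightarrow> 0 < \<eta> \<Longrightarrow>
    objective n (Xd X d r) \<le> (1 + \<eta>) * objective n X + (1 + 1 / \<eta>) * (K * (\<Sum>p<m. \<Sum>q<m. \<Sum>k. (cmod (Xd X d r k p q - X k p q))\<^sup>2))"
proof -
  obtain Bu where Bu: "0 \<le> Bu" "\<And>z i j. z \<in> outer_disc \<Longrightarrow> i < n_z P \<Longrightarrow> j < m \<Longrightarrow> cmod (P_uz P \<tau> z $$ (i, j)) \<le> Bu"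
    using H_inf_bound[OF plant_class_H_inf(3)[OF P_class \<tau>_pos]] by blast
  obtain By where By: "0 \<le> By" "\<And>z i j. z \<in> outer_disc \<Longrightarrow> i < m \<Longrightarrow> j < n_w P \<Longrightarrow> cmod (P_fy P \<tau> z $$ (i, j)) \<le> By"
    using H_inf_bound[OF plant_class_H_inf(2)[OF P_class \<tau>_pos]] by blast
  define I where "I = {..<m} \<times> {..<m}"
  \<comment> \<open>The square of a sum over all pairs (p, q) is at most the number of pairs times
    the sum of squares.\<close>
  define C where "C = (Bu * By)\<^sup>2 * real (card I)"
  have C: "0 \<le> C" by (simp add: C_def)
  define K where "K = real (n_z P) * (real (n_w P) * C) / \<tau>"
  have "objective n (Xd X d r) \<le> (1 + \<eta>) * objective n X + (1 + 1 / \<eta>) * (K * (\<Sum>p<m. \<Sum>q<m. \<Sum>k. (cmod (Xd X d r k p q - X k p q))\<^sup>2))"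
    if r: "1 < r" and d: "0 < d" "d < 1" and \<eta>: "0 < \<eta>" for d r \<eta> n
  proof -
    define \<Delta> where "\<Delta> = (\<lambda>z p q. Qd X d r z $$ (p, q) - Qf X z p q)"
    define E where "E = (\<Sum>p<m. \<Sum>q<m. \<Sum>k. (cmod (Xd X d r k p q - X k p q))\<^sup>2)"
    define T where "T = (\<lambda>i j k. T_coeff (Xd X d r) i j k - T_coeff X i j k)"
    have mk\<Delta>: "has_markov (\<lambda>k. Xd X d r k p q - X k p q) (\<lambda>z. \<Delta> z p q)" if "p < m" "q < m" for p q
      unfolding \<Delta>_def by (intro has_markov_diff has_markov_Qd has_markov_Qf r that)
    have bd\<Delta>: "cmod (\<Delta> z p q) \<le> 10 * BF" if "z \<in> outer_disc" "p < m" "q < m" for z p q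
      using Qd_bound[OF r d that] Qf_bound[OF that] norm_triangle_ineq4[of "Qd X d r z $$ (p, q)" "Qf X z p q"]
      unfolding \<Delta>_def by linarith
    have T: "(\<Sum>k\<le>n. (cmod (T i j k))\<^sup>2) \<le> C * E" if ij: "i < n_z P" "j < n_w P" for i j
    proof -
      define QX where "QX = (\<lambda>z. mat m m (\<lambda>(p, q). Qf X z p q))"
      have QXc: "QX z \<in> carrier_mat m m" for z by (simp add: QX_def)
      have mkQX: "has_markov (\<lambda>k. X k p q) (\<lambda>z. QX z $$ (p, q))" if "p < m" "q < m" for p q
        using has_markov_Qf[of p q] that by (simp add: QX_def)
      have mkT: "has_markov (T i j) (\<lambda>z. T_fz P \<tau> (Qd X d r) z $$ (i, j) - T_fz P \<tau> QX z $$ (i, j))"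
        unfolding T_def
        by (intro has_markov_diff has_markov_T_fz ij Qd_carrier has_markov_Qd r QXc mkQX)
      have bound: "(cmod (T_fz P \<tau> (Qd X d r) z $$ (i, j) - T_fz P \<tau> QX z $$ (i, j)))\<^sup>2
          \<le> C * (\<Sum>pq\<in>I. (cmod (\<Delta> z (fst pq) (snd pq)))\<^sup>2)" if z: "z \<in> outer_disc" for z
      proof -
        have QX_ix: "QX z $$ (p, q) = Qf X z p q" if "p < m" "q < m" for p q using that by (simp add: QX_def)
        have "T_fz P \<tau> (Qd X d r) z $$ (i, j) - T_fz P \<tau> QX z $$ (i, j)
          = - (\<Sum>q<m. \<Sum>p<m. P_uz P \<tau> z $$ (i, p) * \<Delta> z p q * P_fy P \<tau> z $$ (q, j))"
          unfolding T_fz_index[OF z Qd_carrier ij] T_fz_index[OF z QXc ij]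
          by (simp add: QX_ix \<Delta>_def sum_distrib_left sum_distrib_right sum_subtractf algebra_simps)
        then have "cmod (T_fz P \<tau> (Qd X d r) z $$ (i, j) - T_fz P \<tau> QX z $$ (i, j))
          = cmod (\<Sum>q<m. \<Sum>p<m. P_uz P \<tau> z $$ (i, p) * \<Delta> z p q * P_fy P \<tau> z $$ (q, j))" by simp
        also have "\<dots> \<le> (\<Sum>q<m. \<Sum>p<m. Bu * By * cmod (\<Delta> z p q))"
        proof (intro sum_norm_le)
          fix q p assume qp: "q \<in> {..<m}" "p \<in> {..<m}"
          then have "cmod (P_uz P \<tau> z $$ (i, p)) * cmod (P_fy P \<tau> z $$ (q, j)) \<le> Bu * By"
            using Bu(1) ij by (intro mult_mono Bu(2) By(2) z) auto
          then have "cmod (P_uz P \<tau> z $$ (i, p)) * cmod (P_fy P \<tau> z $$ (q, j)) * cmod (\<Delta> z p q) \<le> Bu * By * cmod (\<Delta> z p q)"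
            by (intro mult_right_mono) auto
          then show "cmod (P_uz P \<tau> z $$ (i, p) * \<Delta> z p q * P_fy P \<tau> z $$ (q, j)) \<le> Bu * By * cmod (\<Delta> z p q)"
            by (simp add: norm_mult mult_ac)
        qed
        also have "\<dots> = (\<Sum>p<m. \<Sum>q<m. Bu * By * cmod (\<Delta> z p q))" by (rule sum.swap)
        also have "\<dots> = (\<Sum>pq\<in>I. Bu * By * cmod (\<Delta> z (fst pq) (snd pq)))"
          unfolding I_def sum.cartesian_product' by simp
        finally have "(cmod (T_fz P \<tau> (Qd X d r) z $$ (i, j) - T_fz P \<tau> QX z $$ (i, j)))\<^sup>2
          \<le> (\<Sum>pq\<in>I. Bu * By * cmod (\<Delta> z (fst pq) (snd pq)))\<^sup>2" by (intro power_mono) auto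
        also have "\<dots> \<le> (\<Sum>pq\<in>I. (Bu * By * cmod (\<Delta> z (fst pq) (snd pq)))\<^sup>2) * card I"
          by (rule sum_squared_le_sum_of_squares)
        also have "\<dots> = C * (\<Sum>pq\<in>I. (cmod (\<Delta> z (fst pq) (snd pq)))\<^sup>2)"
          by (simp add: C_def power_mult_distrib sum_distrib_left mult_ac)
        finally show ?thesis .
      qed
      have "(\<Sum>k\<le>n. (cmod (T i j k))\<^sup>2)
        \<le> C * (\<Sum>pq\<in>I. \<Sum>k. (cmod (Xd X d r k (fst pq) (snd pq) - X k (fst pq) (snd pq)))\<^sup>2)"
      proof (rule has_markov_bessel[OF mkT _ _ bound C])
        fix pq assume "pq \<in> I"
        then have pq: "fst pq < m" "snd pq < m" by (auto simp: I_def)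
        show "has_markov (\<lambda>k. Xd X d r k (fst pq) (snd pq) - X k (fst pq) (snd pq)) (\<lambda>z. \<Delta> z (fst pq) (snd pq))"
          by (rule mk\<Delta>[OF pq])
        show "summable (\<lambda>k. (cmod (Xd X d r k (fst pq) (snd pq) - X k (fst pq) (snd pq)))\<^sup>2)"
          by (rule has_markov_bounded_l2(2)[OF mk\<Delta>[OF pq] bd\<Delta>[OF _ pq]])
      qed (simp add: I_def)
      also have "\<dots> = C * E" unfolding E_def I_def sum.cartesian_product' by simp
      finally show ?thesis .
    qed
    have "(\<Sum>k\<le>n. \<Sum>i<n_z P. \<Sum>j<n_w P. (cmod (T_coeff (Xd X d r) i j k))\<^sup>2)
      \<le> (\<Sum>k\<le>n. \<Sum>i<n_z P. \<Sum>j<n_w P. (1 + \<eta>) * (cmod (T_coeff X i j k))\<^sup>2 + (1 + 1 / \<eta>) * (cmod (T i j k))\<^sup>2)"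
      unfolding T_def by (intro sum_mono square_add_bound \<eta>)
    also have "\<dots> = (1 + \<eta>) * (\<Sum>k\<le>n. \<Sum>i<n_z P. \<Sum>j<n_w P. (cmod (T_coeff X i j k))\<^sup>2)
      + (1 + 1 / \<eta>) * (\<Sum>k\<le>n. \<Sum>i<n_z P. \<Sum>j<n_w P. (cmod (T i j k))\<^sup>2)"
      unfolding sum.distrib sum_distrib_left ..
    also have "(\<Sum>k\<le>n. \<Sum>i<n_z P. \<Sum>j<n_w P. (cmod (T i j k))\<^sup>2) \<le> real (n_z P) * (real (n_w P) * (C * E))"
    proof -
      have "(\<Sum>k\<le>n. \<Sum>i<n_z P. \<Sum>j<n_w P. (cmod (T i j k))\<^sup>2) = (\<Sum>i<n_z P. \<Sum>k\<le>n. \<Sum>j<n_w P. (cmod (T i j k))\<^sup>2)"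
        by (rule sum.swap)
      also have "\<dots> = (\<Sum>i<n_z P. \<Sum>j<n_w P. \<Sum>k\<le>n. (cmod (T i j k))\<^sup>2)"
        by (intro sum.cong refl sum.swap)
      also have "\<dots> \<le> (\<Sum>i<n_z P. \<Sum>j<n_w P. C * E)" by (intro sum_mono T) auto
      finally show ?thesis by simp
    qed
    finally have "(\<Sum>k\<le>n. \<Sum>i<n_z P. \<Sum>j<n_w P. (cmod (T_coeff (Xd X d r) i j k))\<^sup>2)
      \<le> (1 + \<eta>) * (\<Sum>k\<le>n. \<Sum>i<n_z P. \<Sum>j<n_w P. (cmod (T_coeff X i j k))\<^sup>2)
      + (1 + 1 / \<eta>) * (real (n_z P) * (real (n_w P) * (C * E)))" using \<eta> by (simp add: mult_left_mono)
    from mult_left_mono[OF this, of "1 / \<tau>"] \<tau>_pos show ?thesis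
      unfolding objective_def K_def E_def[symmetric] by (simp add: algebra_simps add_divide_distrib)
  qed
  moreover have "0 \<le> K" unfolding K_def using C \<tau>_pos by simp
  ultimately show ?thesis using that by blast
qed

text \<open>Dominated convergence for series: each term tends to 0 and is at most |X k p q|^2, which
  is summable in k because the function is bounded.\<close>

lemma dilation_error_tendsto:
  assumes d: "d \<longlonglongrightarrow> 0" "\<And>j. 0 < d j" "\<And>j. d j < 1" and r: "r \<longlonglongrightarrow> 1" "\<And>j. 1 < r j"
  shows "(\<lambda>j. \<Sum>p<m. \<Sum>q<m. \<Sum>k. (cmod (Xd X (d j) (r j) k p q - X k p q))\<^sup>2) \<longlonglongrightarrow> 0"
proof -
  have "(\<lambda>j. \<Sum>k. (cmod (Xd X (d j) (r j) k p q - X k p q))\<^sup>2) \<longlonglongrightarrow> (\<Sum>k. 0)" if pq: "p < m" "q < m" for p q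
  proof -
    have g: "Xd X (d j) (r j) k p q - X k p q = of_real ((1 - d j) / r j ^ k - 1) * X k p q" for j k
      by (simp add: Xd_def algebra_simps)
    have "(\<lambda>j. (cmod (Xd X (d j) (r j) k p q - X k p q))\<^sup>2) \<longlonglongrightarrow> 0" for k
    proof -
      have "(\<lambda>j. (1 - d j) / r j ^ k - 1) \<longlonglongrightarrow> (1 - 0) / 1 ^ k - 1"
        by (intro tendsto_intros d(1) r(1)) simp
      then have "(\<lambda>j. (cmod (of_real ((1 - d j) / r j ^ k - 1) * X k p q))\<^sup>2) \<longlonglongrightarrow> (cmod (of_real ((1 - 0) / 1 ^ k - 1) * X k p q))\<^sup>2"
        by (intro tendsto_power tendsto_norm tendsto_mult tendsto_of_real tendsto_const)
      then show ?thesis unfolding g by simp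
    qed
    moreover have "\<forall>\<^sub>F (k, j) in at_top \<times>\<^sub>F sequentially. norm ((cmod (Xd X (d j) (r j) k p q - X k p q))\<^sup>2) \<le> (cmod (X k p q))\<^sup>2"
    proof (intro always_eventually allI, clarify)
      fix k j
      have "1 \<le> r j ^ k" using r(2)[of j] by (simp add: one_le_power)
      then have "(1 - d j) / r j ^ k \<le> 1 - d j" using d(3)[of j] by (simp add: divide_le_eq mult_le_cancel_left1)
      moreover have "0 \<le> (1 - d j) / r j ^ k" using d(3)[of j] r(2)[of j] by simp
      \<comment> \<open>The factor lies in [0, 1], so multiplying by it changes a coefficient by at
        most its own modulus.\<close>
      ultimately have "\<bar>(1 - d j) / r j ^ k - 1\<bar> \<le> 1" using d(2)[of j] by linarith
      then have "cmod (Xd X (d j) (r j) k p q - X k p q) \<le> 1 * cmod (X k p q)"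
        unfolding g norm_mult norm_of_real by (intro mult_right_mono) auto
      then show "norm ((cmod (Xd X (d j) (r j) k p q - X k p q))\<^sup>2) \<le> (cmod (X k p q))\<^sup>2"
        by (simp add: power_mono)
    qed
    moreover have "summable (\<lambda>k. (cmod (X k p q))\<^sup>2)"
      by (rule has_markov_bounded_l2(2)[OF has_markov_Qf Qf_bound[OF _ pq]])
    ultimately show ?thesis
      using tannerys_theorem[of "\<lambda>k j. (cmod (Xd X (d j) (r j) k p q - X k p q))\<^sup>2" "\<lambda>_. 0" sequentially "\<lambda>k. (cmod (X k p q))\<^sup>2"]
      by simp
  qed
  then have "(\<lambda>j. \<Sum>p<m. \<Sum>q<m. \<Sum>k. (cmod (Xd X (d j) (r j) k p q - X k p q))\<^sup>2) \<longlonglongrightarrow> (\<Sum>p<m. \<Sum>q<m. \<Sum>k. 0)"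
    by (intro tendsto_sum) auto
  then show ?thesis by simp
qed

text \<open>The order of limits matters: d is fixed before r is chosen close enough to 1 for
  feasibility. Along such a sequence the error vanishes for each fixed \<eta>, and only then does
  \<eta> tend to 0.\<close>

lemma op3_value_le:
  assumes v: "\<And>N. objective N X \<le> v"
  shows "op3_value P \<tau> F \<le> ereal v"
proof -
  obtain K where K: "0 \<le> K" "\<And>d r \<eta> n. 1 < r \<Longrightarrow> 0 < d \<Longrightarrow> d < 1 \<Longrightarrow> 0 < \<eta> \<Longrightarrow>
    objective n (Xd X d r) \<le> (1 + \<eta>) * objective n X + (1 + 1 / \<eta>) * (K * (\<Sum>p<m. \<Sum>q<m. \<Sum>k. (cmod (Xd X d r k p q - X k p q))\<^sup>2))"
    using objective_dilated_le by blast
  \<comment> \<open>The double successor keeps d strictly below 1 already at j = 0.\<close>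
  define d where "d = (\<lambda>j. 1 / real (Suc (Suc j)))"
  have d: "0 < d j" "d j < 1" for j by (simp_all add: d_def)
  have d_lim: "d \<longlonglongrightarrow> 0" unfolding d_def by (intro LIMSEQ_Suc lim_1_over_n)
  have "\<exists>r. 1 < r \<and> r < 1 + d j \<and> Qd X (d j) r \<in> op3_feasible P F" for j
  proof -
    have "\<forall>\<^sub>F r in at_right 1. r < 1 + d j"
      unfolding eventually_at_right_field using d(1)[of j] by (auto intro!: exI[of _ "1 + d j"])
    with eventually_at_right_less[of 1] dilated_feasible[OF d]
    have "\<forall>\<^sub>F r in at_right 1. 1 < r \<and> r < 1 + d j \<and> Qd X (d j) r \<in> op3_feasible P F"
      by eventually_elim auto
    then show ?thesis by (rule eventually_happens'[rotated]) simp
  qed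
  then have "\<exists>r. \<forall>j. 1 < r j \<and> r j < 1 + d j \<and> Qd X (d j) (r j) \<in> op3_feasible P F"
    by (intro choice) blast
  then obtain r where "\<forall>j. 1 < r j \<and> r j < 1 + d j \<and> Qd X (d j) (r j) \<in> op3_feasible P F" by blast
  then have r: "\<And>j. 1 < r j" "\<And>j. r j < 1 + d j" and feas: "\<And>j. Qd X (d j) (r j) \<in> op3_feasible P F" by blast+
  have r_lim: "r \<longlonglongrightarrow> 1"
  proof (rule tendsto_sandwich[of "\<lambda>_. 1" r sequentially "\<lambda>j. 1 + d j"])
    show "(\<lambda>j. 1 + d j) \<longlonglongrightarrow> 1" using tendsto_add[OF tendsto_const d_lim, of 1] by simp
    show "\<forall>\<^sub>F j in sequentially. 1 \<le> r j" "\<forall>\<^sub>F j in sequentially. r j \<le> 1 + d j"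
      using r by (auto intro!: always_eventually less_imp_le)
  qed simp
  define E where "E = (\<lambda>j. \<Sum>p<m. \<Sum>q<m. \<Sum>k. (cmod (Xd X (d j) (r j) k p q - X k p q))\<^sup>2)"
  have E: "E \<longlonglongrightarrow> 0" unfolding E_def by (rule dilation_error_tendsto[OF d_lim d r_lim r(1)])
  have step: "op3_value P \<tau> F \<le> ereal ((1 + \<eta>) * v)" if \<eta>: "0 < \<eta>" for \<eta>
  proof -
    have bound: "op3_value P \<tau> F \<le> ereal ((1 + \<eta>) * v + (1 + 1 / \<eta>) * (K * E j))" for j
    proof -
      have "op3_value P \<tau> F \<le> op3_objective P \<tau> (Qd X (d j) (r j))"
        unfolding op3_value_def by (rule INF_lower[OF feas])
      also have "\<dots> \<le> ereal ((1 + \<eta>) * v + (1 + 1 / \<eta>) * (K * E j))"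
      proof (rule op3_objective_le[OF Qd_carrier has_markov_Qd[OF r(1)]])
        fix n
        have "objective n (Xd X (d j) (r j)) \<le> (1 + \<eta>) * objective n X + (1 + 1 / \<eta>) * (K * E j)"
          unfolding E_def by (rule K(2)[OF r(1) d \<eta>])
        also have "(1 + \<eta>) * objective n X \<le> (1 + \<eta>) * v" using \<eta> v by (intro mult_left_mono) auto
        finally show "objective n (Xd X (d j) (r j)) \<le> (1 + \<eta>) * v + (1 + 1 / \<eta>) * (K * E j)" by simp
      qed
      finally show ?thesis .
    qed
    have "(\<lambda>j. ereal ((1 + \<eta>) * v + (1 + 1 / \<eta>) * (K * E j))) \<longlonglongrightarrow> ereal ((1 + \<eta>) * v + (1 + 1 / \<eta>) * (K * 0))"
      unfolding lim_ereal by (intro tendsto_intros E)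
    then have "op3_value P \<tau> F \<le> ereal ((1 + \<eta>) * v + (1 + 1 / \<eta>) * (K * 0))"
      by (rule LIMSEQ_le_const) (use bound in blast)
    then show ?thesis by simp
  qed
  \<comment> \<open>The sequence d is reused as a sequence of positive values of \<eta> tending to
    0.\<close>
  have "(\<lambda>j. ereal ((1 + d j) * v)) \<longlonglongrightarrow> ereal ((1 + 0) * v)"
    unfolding lim_ereal by (intro tendsto_intros d_lim)
  then have "op3_value P \<tau> F \<le> ereal ((1 + 0) * v)"
    by (rule LIMSEQ_le_const) (use step d(1) in blast)
  then show ?thesis by simp
qed

end

section \<open>The supremum of the dual values\<close>

context synthesis
begin

lemma op3_value_le_SUP: "op3_value P \<tau> F \<le> (SUP n\<in>{0<..}. op6_value P \<tau> F n)" (is "_ \<le> ?V")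
proof -
  obtain X R where X: "\<And>k p q. cmod (X k p q) \<le> R" "\<And>n x. 0 \<le> Re (kform (idx n (2 * m)) (toep (V_coeff X)) x)"
    and V: "\<And>N. ereal (objective N X) \<le> ?V"
    using limit_of_approximants by blast
  obtain BF where BF: "0 \<le> BF" "\<And>z p q. z \<in> outer_disc \<Longrightarrow> p < m \<Longrightarrow> q < m \<Longrightarrow> cmod (F z $$ (p, q)) \<le> BF"
    using H_inf_bound[OF F_H_inf] by blast
  interpret interior_feasible P F \<epsilon> \<tau> X R BF
    by unfold_locales (use X BF in auto)
  show ?thesis
  proof (cases ?V)
    case (real v)
    then have "objective N X \<le> v" for N using V[of N] by simp
    then show ?thesis unfolding real by (rule op3_value_le)
  next
    case PInf
    then show ?thesis by simp
  next
    \<comment> \<open>Impossible, since the supremum is at least the real number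
      \<open>objective 0 X\<close>.\<close>
    case MInf
    then show ?thesis using V[of 0] by simp
  qed
qed

end

theorem theorem8:
  fixes P :: plant and F :: "complex \<Rightarrow> complex mat" and \<epsilon> \<tau> :: real
  assumes "P \<in> plant_class" and "\<epsilon> > 0" and "\<tau> > 0"
    and "is_factor P \<epsilon> \<tau> F"
  shows "(\<forall>n>0. op6_value P \<tau> F n \<le> op3_value P \<tau> F) \<and>
    (\<forall>m n. 0 < m \<and> m \<le> n \<longrightarrow> op6_value P \<tau> F m \<le> op6_value P \<tau> F n) \<and>
    (\<lambda>n. op6_value P \<tau> F n) \<longlonglongrightarrow> op3_value P \<tau> F"
proof -
  interpret synthesis P F \<epsilon> \<tau> by unfold_locales (fact assms)+
  \<comment> \<open>The relaxations are compared from order 1 on; the shifted sequence has the same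
    limit.\<close>
  have "incseq (\<lambda>n. op6_value P \<tau> F (Suc n))"
    by (intro incseq_SucI op6_value_mono) auto
  then have "(\<lambda>n. op6_value P \<tau> F (Suc n)) \<longlonglongrightarrow> (SUP n. op6_value P \<tau> F (Suc n))"
    by (rule LIMSEQ_SUP)
  moreover have "(SUP n. op6_value P \<tau> F (Suc n)) = op3_value P \<tau> F"
  proof (rule antisym)
    show "(SUP n. op6_value P \<tau> F (Suc n)) \<le> op3_value P \<tau> F"
      by (intro SUP_least op6_value_le_op3_value) simp
    have "(SUP n\<in>{0<..}. op6_value P \<tau> F n) \<le> (SUP n. op6_value P \<tau> F (Suc n))"
    proof (rule SUP_least)
      fix n :: nat assume "n \<in> {0<..}"
      then show "op6_value P \<tau> F n \<le> (SUP n. op6_value P \<tau> F (Suc n))"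
        by (intro SUP_upper2[of "n - 1"]) auto
    qed
    then show "op3_value P \<tau> F \<le> (SUP n. op6_value P \<tau> F (Suc n))"
      using op3_value_le_SUP by order
  qed
  ultimately have "(\<lambda>n. op6_value P \<tau> F n) \<longlonglongrightarrow> op3_value P \<tau> F"
    by (simp add: LIMSEQ_imp_Suc)
  then show ?thesis using op6_value_le_op3_value op6_value_mono by blast
qed

end
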